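(* Let $n\ge 1$, let $\alpha=(\alpha_1,\ldots,\alpha_n)\in\mathbb{Z}_{\ge 0}^n$ be a composition, let $N$ be an integer with $N\ge \alpha_i$ for all $i$, and let $\tau=(\tau_1,\ldots,\tau_n)\in\{W,E\}^n$ be arbitrary. Then $$\kappa_\alpha(x_1,\ldots,x_n)=\sum_{\pi\in \operatorname{HPD}_{\tau}(\alpha)}\operatorname{wt}(\pi).$$
   Context: Key polynomials: for $1\le i\le n-1$ the Demazure operator $\pi_i$ on $\mathbb{Z}[x_1,\ldots,x_n]$ is $\pi_i f=\dfrac{x_i f-x_{i+1}\,f|_{x_i\leftrightarrow x_{i+1}}}{x_i-x_{i+1}}$. For $\alpha\in\mathbb{Z}_{\ge0}^n$, $\kappa_\alpha$ is defined by: if $\alpha_1\ge\cdots\ge\alpha_n$ then $\kappa_\alpha=x_1^{\alpha_1}\cdots x_n^{\alpha_n}$; if $\alpha_i<\alpha_{i+1}$ then $\kappa_\alpha=\pi_i\kappa_{\alpha'}$ where $\alpha'$ is $\alpha$ with $\alpha_i,\alpha_{i+1}$ exchanged. Tiles. The set of colors is $[n]=\{1,\ldots,n\}$. A tile is a square divided horizontally into $n$ sub-tiles, numbered $1,\ldots,n$ from left to right. Each sub-tile has a left wall, right wall, floor and ceiling; the floor (ceiling) of sub-tile $j$ is called the $j$-th floor ($j$-th ceiling) of the tile; the left wall of the tile is the left wall of sub-tile $1$ and the right wall of the tile is the right wall of sub-tile $n$. Each sub-tile contains one of the following pieces, each pipe segment carrying a color in $[n]$: empty; a vertical pipe (floor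 to ceiling); a horizontal pipe (left wall to right wall); a crossing (one vertical pipe and one horizontal pipe); and two elbows which depend on the tile kind: in a west tile the elbows are "left wall to ceiling" and "floor to right wall"; in an east tile the elbows are "ceiling to right wall" and "left wall to floor". Requirements: a pipe touching the $j$-th floor or $j$-th ceiling must have color $j$; in a crossing of a west tile the horizontal pipe has color smaller than the vertical pipe, in a crossing of an east tile the horizontal pipe has color larger than the vertical pipe; consecutive sub-tiles match (the right wall of sub-tile $j$ carries a pipe iff the left wall of sub-tile $j+1$ does, with the same color). A west tile (east tile) is such a stack using west (east) pieces. The set $\operatorname{HPD}_\tau(\alpha)$. Take a grid of $n$ rows (row $1$ on top, row $n$ at the bottom) and $N+1$ columns (column $0$ leftmost, column $N$ rightmost). Row $i$ is of west type if $\tau_i=W$ and of east type if $\tau_i=E$. Let $k$ be the number of $W$'s in $\tau$. The west-type rows are labeled $1,2,\ldots,k$ from top to bottom and the east-type rows are labeled $n,n-1,\ldots,k+1$ from top to bottom; the row labeled $i$ is called the $i$-row. $\operatorname{HPD}_\tau(\alpha)$ is the set of fillings of the grid by tiles, west tiles in west-type rows and east tiles in east-type rows, such that: pipes match across every shared edge (walls of horizontally adjacent tiles; the $j$-th floor of a tile and the $j$-th ceiling of the tile below it) with equal colors; the left wall of column $0$ in a west-type row labeled $c$ carries a pipe of color $c$, and in an east-type row it carries no pipe; the right wall of column $N$ in an east-type row labeled $c$ carries a pipe of color $c$, and in a west-type row it carries no pipe; in row $1$, for each $i\in[n]$ the $i$-th ceiling of the tile in column $\alpha_i$ carries a pipe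 of color $i$, and all other ceilings of row $1$ carry no pipe; no floor of row $n$ carries a pipe. Weight: for $\pi\in\operatorname{HPD}_\tau(\alpha)$, $\operatorname{wt}(\pi)=x_1^{m_1}\cdots x_n^{m_n}$, where $m_i$ is the number of tiles in the $i$-row whose right wall is touched by a pipe if the $i$-row is of west type, and the number of tiles in the $i$-row whose right wall is not touched by any pipe if the $i$-row is of east type. *)

theory Defs
  imports Main "HOL-Library.Poly_Mapping"
begin

text \<open>A monomial is a finitely supported exponent vector (variable index \<Rightarrow> exponent),
  a polynomial is a finitely supported map from monomials to integer coefficients.
  Variables are indexed by 1, 2, ... as in the paper.\<close>

type_synonym mono = "nat \<Rightarrow>\<^sub>0 nat"
type_synonym mpoly = "mono \<Rightarrow>\<^sub>0 int"

definition var :: "nat \<Rightarrow> mpoly" where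
  "var i = Poly_Mapping.single (Poly_Mapping.single i 1) 1"

definition tr :: "nat \<Rightarrow> nat \<Rightarrow> nat" where
  "tr i k = (if k = i then Suc i else if k = Suc i then i else k)"

definition swap_mono :: "nat \<Rightarrow> mono \<Rightarrow> mono" where
  "swap_mono i m = Abs_poly_mapping (\<lambda>k. Poly_Mapping.lookup m (tr i k))"

definition swap_vars :: "nat \<Rightarrow> mpoly \<Rightarrow> mpoly" where
  "swap_vars i f = Abs_poly_mapping (\<lambda>m. Poly_Mapping.lookup f (swap_mono i m))"

text \<open>Demazure operator: the (unique, exact) quotient
  (x_i f - x_(i+1) f|_(x_i <-> x_(i+1))) / (x_i - x_(i+1)).\<close>
definition demazure :: "nat \<Rightarrow> mpoly \<Rightarrow> mpoly" where
  "demazure i f = (THE g. (var i - var (Suc i)) * g = var i * f - var (Suc i) * swap_vars i f)"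

text \<open>Compositions are functions nat \<Rightarrow> nat; only the entries 1..n matter.\<close>
definition swap_comp :: "nat \<Rightarrow> (nat \<Rightarrow> nat) \<Rightarrow> (nat \<Rightarrow> nat)" where
  "swap_comp i a = a \<circ> tr i"

definition monomial_of :: "nat \<Rightarrow> (nat \<Rightarrow> nat) \<Rightarrow> mpoly" where
  "monomial_of n a = (\<Prod>i\<in>{1..n}. var i ^ a i)"

inductive key_rel :: "nat \<Rightarrow> (nat \<Rightarrow> nat) \<Rightarrow> mpoly \<Rightarrow> bool" for n where
  dominant: "(\<forall>i. 1 \<le> i \<and> i < n \<longrightarrow> a (Suc i) \<le> a i) \<Longrightarrow> key_rel n a (monomial_of n a)"
| step: "1 \<le> i \<Longrightarrow> i < n \<Longrightarrow> a i < a (Suc i) \<Longrightarrow> key_rel n (swap_comp i a) g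
          \<Longrightarrow> key_rel n a (demazure i g)"

definition key :: "nat \<Rightarrow> (nat \<Rightarrow> nat) \<Rightarrow> mpoly" where
  "key n a = (THE f. key_rel n a f)"

datatype dir = W | E

text \<open>Pieces of a sub-tile. Vert c: vertical pipe of colour c; Horiz c: horizontal pipe;
  Cross v h: crossing of a vertical pipe of colour v and a horizontal pipe of colour h;
  Elb1 c: elbow "left wall to ceiling" (west) resp. "ceiling to right wall" (east);
  Elb2 c: elbow "floor to right wall" (west) resp. "left wall to floor" (east).\<close>
datatype piece = Empty | Vert nat | Horiz nat | Cross nat nat | Elb1 nat | Elb2 nat

fun pleft :: "dir \<Rightarrow> piece \<Rightarrow> nat option" where
  "pleft d (Horiz c) = Some c"
| "pleft d (Cross v h) = Some h"
| "pleft W (Elb1 c) = Some c"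
| "pleft E (Elb2 c) = Some c"
| "pleft d p = None"

fun pright :: "dir \<Rightarrow> piece \<Rightarrow> nat option" where
  "pright d (Horiz c) = Some c"
| "pright d (Cross v h) = Some h"
| "pright E (Elb1 c) = Some c"
| "pright W (Elb2 c) = Some c"
| "pright d p = None"

fun pceil :: "dir \<Rightarrow> piece \<Rightarrow> nat option" where
  "pceil d (Vert c) = Some c"
| "pceil d (Cross v h) = Some v"
| "pceil d (Elb1 c) = Some c"
| "pceil d p = None"

fun pfloor :: "dir \<Rightarrow> piece \<Rightarrow> nat option" where
  "pfloor d (Vert c) = Some c"
| "pfloor d (Cross v h) = Some v"
| "pfloor d (Elb2 c) = Some c"
| "pfloor d p = None"

fun pcolors :: "piece \<Rightarrow> nat set" where
  "pcolors Empty = {}"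
| "pcolors (Vert c) = {c}"
| "pcolors (Horiz c) = {c}"
| "pcolors (Cross v h) = {v, h}"
| "pcolors (Elb1 c) = {c}"
| "pcolors (Elb2 c) = {c}"

definition valid_piece :: "nat \<Rightarrow> dir \<Rightarrow> nat \<Rightarrow> piece \<Rightarrow> bool" where
  "valid_piece n d j p \<longleftrightarrow>
     pcolors p \<subseteq> {1..n}
   \<and> (pfloor d p \<noteq> None \<longrightarrow> pfloor d p = Some j)
   \<and> (pceil d p \<noteq> None \<longrightarrow> pceil d p = Some j)
   \<and> (\<forall>v h. p = Cross v h \<longrightarrow> (if d = W then h < v else v < h))"

text \<open>A tile is a function from sub-tile indices 1..n to pieces.\<close>
type_synonym tile = "nat \<Rightarrow> piece"

definition valid_tile :: "nat \<Rightarrow> dir \<Rightarrow> tile \<Rightarrow> bool" where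
  "valid_tile n d t \<longleftrightarrow>
     (\<forall>j\<in>{1..n}. valid_piece n d j (t j))
   \<and> (\<forall>j. 1 \<le> j \<and> j < n \<longrightarrow> pright d (t j) = pleft d (t (Suc j)))"

definition tile_left :: "dir \<Rightarrow> tile \<Rightarrow> nat option" where
  "tile_left d t = pleft d (t 1)"

definition tile_right :: "nat \<Rightarrow> dir \<Rightarrow> tile \<Rightarrow> nat option" where
  "tile_right n d t = pright d (t n)"

text \<open>tau r = W means row r is of west type. k = number of W's.
  West rows are labelled 1..k top to bottom, east rows n, n-1, ..., k+1 top to bottom.\<close>
definition row_label :: "nat \<Rightarrow> (nat \<Rightarrow> dir) \<Rightarrow> nat \<Rightarrow> nat" where
  "row_label n tau r =
     (if tau r = W then card {s\<in>{1..r}. tau s = W}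
      else Suc n - card {s\<in>{1..r}. tau s = E})"

text \<open>A filling: F r c is the tile in row r (1..n) and column c (0..N);
  outside this range (and outside sub-tiles 1..n) everything is Empty, so that
  fillings are uniquely represented.\<close>
type_synonym filling = "nat \<Rightarrow> nat \<Rightarrow> tile"

definition HPD :: "nat \<Rightarrow> nat \<Rightarrow> (nat \<Rightarrow> dir) \<Rightarrow> (nat \<Rightarrow> nat) \<Rightarrow> filling set" where
  "HPD n N tau a = {F.
      (\<forall>r c j. \<not> (r \<in> {1..n} \<and> c \<le> N \<and> j \<in> {1..n}) \<longrightarrow> F r c j = Empty)
    \<and> (\<forall>r\<in>{1..n}. \<forall>c\<le>N. valid_tile n (tau r) (F r c))
    \<and> (\<forall>r\<in>{1..n}. \<forall>c<N. tile_right n (tau r) (F r c) = tile_left (tau r) (F r (Suc c)))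
    \<and> (\<forall>r. 1 \<le> r \<and> r < n \<longrightarrow> (\<forall>c\<le>N. \<forall>j\<in>{1..n}.
          pfloor (tau r) (F r c j) = pceil (tau (Suc r)) (F (Suc r) c j)))
    \<and> (\<forall>r\<in>{1..n}. tile_left (tau r) (F r 0) =
          (if tau r = W then Some (row_label n tau r) else None))
    \<and> (\<forall>r\<in>{1..n}. tile_right n (tau r) (F r N) =
          (if tau r = E then Some (row_label n tau r) else None))
    \<and> (\<forall>c\<le>N. \<forall>i\<in>{1..n}. pceil (tau 1) (F 1 c i) = (if c = a i then Some i else None))
    \<and> (\<forall>c\<le>N. \<forall>j\<in>{1..n}. pfloor (tau n) (F n c j) = None)}"

definition row_exp :: "nat \<Rightarrow> nat \<Rightarrow> (nat \<Rightarrow> dir) \<Rightarrow> filling \<Rightarrow> nat \<Rightarrow> nat" where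
  "row_exp n N tau F r =
     (if tau r = W then card {c\<in>{0..N}. tile_right n (tau r) (F r c) \<noteq> None}
      else card {c\<in>{0..N}. tile_right n (tau r) (F r c) = None})"

definition wt :: "nat \<Rightarrow> nat \<Rightarrow> (nat \<Rightarrow> dir) \<Rightarrow> filling \<Rightarrow> mpoly" where
  "wt n N tau F = (\<Prod>r\<in>{1..n}. var (row_label n tau r) ^ row_exp n N tau F r)"

end

theory Submission
  imports Defs "HOL-Library.FuncSet"
begin

text \<open>
  A filling is determined by the positions of the vertical pipes between consecutive rows, and a row
  with prescribed ceilings and floors exists iff an explicit condition holds for every pair of
  colours. So the weighted sum over fillings is an iterated sum over rows, and three facts about
  rows suffice.

  (1) A west row and an adjacent east row may be interchanged, by a weight-preserving bijection that
  fixes the outer positions. Since a single west row and a single east row with one colour have the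
  same weight, the sum does not depend on \<open>tau\<close>.

  (2) Replacing the entries \<open>i\<close>, \<open>i + 1\<close> of the ceiling by their increasing rearrangement commutes
  with every row that removes neither of these colours.

  (3) For two colours and two rows the sum is a monomial or a complete homogeneous sum, on which
  the Demazure operator is computed directly.

  To apply the \<open>i\<close>-th Demazure operator, choose \<open>tau\<close> so that the rows of the variables \<open>i\<close> and
  \<open>i + 1\<close> come last; the operator is linear over the variables of the rows above, so (2) and (3) give
  the recursion of key polynomials. For a dominant composition and only east rows there is exactly
  one filling, of the required weight.
\<close>

section \<open>Rows as pairwise conditions\<close>

text \<open>Interchanging two rows is not local in the tiles, and the middle positions of different
  colours might constrain one another. The proof rests on the fact that they do not: once the outer
  positions are fixed, the pair conditions split into a condition on the outer positions alone, the
  same for both orders of the rows, and one condition per colour on its own middle position. Both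
  sides are then products of ranges, matched one gap at a time.

  The labelling of rows fits this: a west row removes the smallest colour still present and an east
  row the largest, so the surviving colours always form an interval \<open>{l..h}\<close>, and
  interchanging the two types changes neither the removed colours nor the variables.

  Two algebraic facts come along. The quotient in the Demazure operator is exhibited as another row
  sum, which settles divisibility. And every derivation in \<open>key_rel\<close> produces the same
  row sum, so key polynomials do not depend on the chosen ascents.\<close>

text \<open>Scanning a row along its sub-tiles \<open>(c, j)\<close> in lexicographic order, colour \<open>j\<close> runs horizontally
  from its floor position to its ceiling position in a west row, and from its ceiling position to
  its floor position in an east row. Two such runs must be disjoint, and a run may only pass over a
  vertical pipe of larger (west) or smaller (east) colour. For two colours \<open>i < j\<close> with ceiling
  columns \<open>ai\<close>, \<open>aj\<close> and floor columns \<open>bi\<close>, \<open>bj\<close> this is what the following conditions say.\<close>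

definition west_pair :: "nat \<Rightarrow> nat \<Rightarrow> nat \<Rightarrow> nat \<Rightarrow> bool" where
  "west_pair ai bi aj bj \<longleftrightarrow> \<not> (bj < ai \<and> ai \<le> aj) \<and> (bi \<le> aj \<and> aj < ai \<longrightarrow> bj = aj)"

definition east_pair :: "nat \<Rightarrow> nat \<Rightarrow> nat \<Rightarrow> nat \<Rightarrow> bool" where
  "east_pair ai bi aj bj \<longleftrightarrow> \<not> (ai \<le> aj \<and> aj < bi) \<and> (aj < ai \<and> ai \<le> bj \<longrightarrow> bi = ai)"

text \<open>Columns are shifted by one: the value \<open>c + 1\<close> stands for column \<open>c\<close>, \<open>0\<close> for a pipe that has left
  through the left boundary, and \<open>N + 2\<close> for one that has left through the right boundary. The
  colours still present are \<open>l..h\<close>; a west row removes \<open>l\<close>, an east row removes \<open>h\<close>.\<close>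

definition west_step :: "nat \<Rightarrow> nat \<Rightarrow> (nat \<Rightarrow> nat) \<Rightarrow> (nat \<Rightarrow> nat) \<Rightarrow> bool" where
  "west_step l h a b \<longleftrightarrow> b l = 0 \<and> (\<forall>i. i \<notin> {l..h} \<longrightarrow> b i = a i) \<and> (\<forall>i\<in>{l..h}. b i \<le> a i)
     \<and> (\<forall>i\<in>{l..h}. \<forall>j\<in>{l..h}. i < j \<longrightarrow> west_pair (a i) (b i) (a j) (b j))"

definition east_step :: "nat \<Rightarrow> nat \<Rightarrow> nat \<Rightarrow> (nat \<Rightarrow> nat) \<Rightarrow> (nat \<Rightarrow> nat) \<Rightarrow> bool" where
  "east_step N l h a b \<longleftrightarrow> b h = N + 2 \<and> (\<forall>i. i \<notin> {l..h} \<longrightarrow> b i = a i) \<and> (\<forall>i\<in>{l..h}. a i \<le> b i)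
     \<and> (\<forall>i\<in>{l..h}. \<forall>j\<in>{l..h}. i < j \<longrightarrow> east_pair (a i) (b i) (a j) (b j))"

definition live :: "nat \<Rightarrow> nat \<Rightarrow> nat \<Rightarrow> (nat \<Rightarrow> nat) \<Rightarrow> bool" where
  "live N l h s \<longleftrightarrow> (\<forall>i\<in>{l..h}. 1 \<le> s i \<and> s i \<le> N + 1)"

text \<open>A run between shifted columns \<open>u\<close> and \<open>v\<close> touches
  \<open>v - u\<close> right walls of tiles. In a west row the run of \<open>l\<close> starts at 0,
  one step before the first column, whence the \<open>- 1\<close>. In an east row the untouched ones
  among \<open>N + 1\<close> right walls are counted, and the value \<open>N + 2\<close> makes the
  run of \<open>h\<close> include the last wall.\<close>

fun row_sum :: "nat \<Rightarrow> dir list \<Rightarrow> nat \<Rightarrow> nat \<Rightarrow> (nat \<Rightarrow> nat) \<Rightarrow> mpoly" where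
  "row_sum N [] l h s = 1"
| "row_sum N (W # ds) l h s =
     (\<Sum>b | west_step l h s b. var l ^ (sum s {l..h} - sum b {l..h} - 1) * row_sum N ds (Suc l) h b)"
| "row_sum N (E # ds) l h s =
     (\<Sum>b | east_step N l h s b. var h ^ (N + 1 - (sum b {l..h} - sum s {l..h})) * row_sum N ds l (h - 1) b)"

lemma west_step_pair:
  "west_step l h a b \<Longrightarrow> l \<le> i \<Longrightarrow> i < j \<Longrightarrow> j \<le> h \<Longrightarrow> west_pair (a i) (b i) (a j) (b j)"
  unfolding west_step_def by simp

lemma east_step_pair:
  "east_step N l h a b \<Longrightarrow> l \<le> i \<Longrightarrow> i < j \<Longrightarrow> j \<le> h \<Longrightarrow> east_pair (a i) (b i) (a j) (b j)"
  unfolding east_step_def by simp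

text \<open>The run of \<open>l\<close> covers everything from the left boundary to its ceiling, so
  no other colour can leave there: one whose ceiling it passes goes straight down, and one further
  right cannot run past that ceiling.\<close>

lemma west_step_live:
  assumes "west_step l h s b" "live N l h s" "l \<le> h"
  shows "live N (Suc l) h b"
proof -
  have "1 \<le> b i \<and> b i \<le> N + 1" if "i \<in> {Suc l..h}" for i
  proof -
    have "west_pair (s l) (b l) (s i) (b i)" "b l = 0" "b i \<le> s i"
      using assms(1) that west_step_pair[OF assms(1), of l i] unfolding west_step_def by auto
    moreover have "1 \<le> s i" "s i \<le> N + 1" "1 \<le> s l"
      using assms that unfolding live_def by auto
    ultimately show ?thesis unfolding west_pair_def by (cases "s i < s l") auto
  qed
  then show ?thesis unfolding live_def by auto
qed

lemma east_step_live:
  assumes "east_step N l h s b" "live N l h s" "l \<le> h" "1 \<le> l"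
  shows "live N l (h - 1) b"
proof -
  have "1 \<le> b i \<and> b i \<le> N + 1" if "i \<in> {l..h - 1}" for i
  proof -
    have "east_pair (s i) (b i) (s h) (b h)" "b h = N + 2" "s i \<le> b i"
      using assms(1,3,4) that east_step_pair[OF assms(1), of i h] unfolding east_step_def by auto
    moreover have "1 \<le> s i" "s i \<le> N + 1" "s h \<le> N + 1"
      using assms that unfolding live_def by auto
    ultimately show ?thesis unfolding east_pair_def by (cases "s i \<le> s h") auto
  qed
  then show ?thesis unfolding live_def by auto
qed

section \<open>Two adjacent rows of opposite type: intervals between outer positions\<close>

definition lex_less :: "nat \<Rightarrow> nat \<Rightarrow> nat \<Rightarrow> nat \<Rightarrow> bool" where
  "lex_less a i b j \<longleftrightarrow> a < b \<or> a = b \<and> i < j"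

text \<open>The part of the two-row condition that sees only outer positions: the west-east
  conditions tested at the largest possible middle positions, the minima.\<close>

definition commute_pair :: "nat \<Rightarrow> nat \<Rightarrow> nat \<Rightarrow> nat \<Rightarrow> bool" where
  "commute_pair ap gp aq gq \<longleftrightarrow>
     west_pair ap (min ap gp) aq (min aq gq) \<and> east_pair (min ap gp) gp (min aq gq) gq"

text \<open>This is the decoupling: besides the outer condition, each conjunct on the right mentions
  only one of \<open>bp\<close>, \<open>bq\<close>. If \<open>bq\<close> lies below
  \<open>min aq gq\<close>, colour \<open>q\<close> covers the stretch between them in both rows,
  and this stretch must avoid the whole interval of \<open>p\<close>.\<close>

lemma west_east_pair:
  assumes "p < q" "bp \<le> ap" "bp \<le> gp" "bq \<le> aq" "bq \<le> gq"
  shows "west_pair ap bp aq bq \<and> east_pair bp gp bq gq \<longleftrightarrow>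
    commute_pair ap gp aq gq
    \<and> (bq < min aq gq \<longrightarrow> lex_less (max ap gp) p bq q \<or> lex_less (min aq gq) q (min ap gp) p)
    \<and> (bp < min ap gp \<longrightarrow> lex_less (max aq gq) q bp p \<or> lex_less (min ap gp) p (min aq gq) q)"
  using assms unfolding west_pair_def east_pair_def commute_pair_def lex_less_def
  by (cases "ap \<le> gp"; cases "aq \<le> gq"; simp add: min_def max_def; linarith)

text \<open>Here the middle positions lie above the maxima, yet \<open>commute_pair\<close> appears
  verbatim. That both orders of rows share the outer condition is what makes the interchange
  possible.\<close>

lemma east_west_pair:
  assumes "p < q" "ap \<le> bp" "gp \<le> bp" "aq \<le> bq" "gq \<le> bq"
  shows "east_pair ap bp aq bq \<and> west_pair bp gp bq gq \<longleftrightarrow>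
    commute_pair ap gp aq gq
    \<and> (max aq gq < bq \<longrightarrow> lex_less (max ap gp) p (max aq gq) q \<or> lex_less bq q (min ap gp) p)
    \<and> (max ap gp < bp \<longrightarrow> lex_less (max aq gq) q (max ap gp) p \<or> lex_less bp p (min aq gq) q)"
  using assms unfolding west_pair_def east_pair_def commute_pair_def lex_less_def
  by (cases "ap \<le> gp"; cases "aq \<le> gq"; simp add: min_def max_def; linarith)

definition lo :: "(nat \<Rightarrow> nat) \<Rightarrow> (nat \<Rightarrow> nat) \<Rightarrow> nat \<Rightarrow> nat" where "lo a g i = min (a i) (g i)"
definition hi :: "(nat \<Rightarrow> nat) \<Rightarrow> (nat \<Rightarrow> nat) \<Rightarrow> nat \<Rightarrow> nat" where "hi a g i = max (a i) (g i)"

lemma lo_le_hi: "lo a g i \<le> hi a g i"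
  by (simp add: lo_def hi_def min_def max_def)

text \<open>Between ceiling row \<open>a\<close> and floor row \<open>g\<close> of a west-east pair of rows, the intermediate
  position of each colour is \<open>\<le> lo\<close>; for an east-west pair it is \<open>\<ge> hi\<close>. It may differ from
  \<open>lo\<close> (\<open>hi\<close>) only inside a stretch that meets no interval \<open>[lo, hi]\<close> of another colour.\<close>

definition below_ok :: "nat set \<Rightarrow> (nat \<Rightarrow> nat) \<Rightarrow> (nat \<Rightarrow> nat) \<Rightarrow> nat \<Rightarrow> nat \<Rightarrow> bool" where
  "below_ok A a g q b \<longleftrightarrow> b \<le> lo a g q \<and> (\<forall>p\<in>A. p \<noteq> q \<longrightarrow> b < lo a g q \<longrightarrow>
     lex_less (hi a g p) p b q \<or> lex_less (lo a g q) q (lo a g p) p)"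

definition above_ok :: "nat set \<Rightarrow> (nat \<Rightarrow> nat) \<Rightarrow> (nat \<Rightarrow> nat) \<Rightarrow> nat \<Rightarrow> nat \<Rightarrow> bool" where
  "above_ok A a g p b \<longleftrightarrow> hi a g p \<le> b \<and> (\<forall>q\<in>A. q \<noteq> p \<longrightarrow> hi a g p < b \<longrightarrow>
     lex_less (hi a g q) q (hi a g p) p \<or> lex_less b p (lo a g q) q)"

text \<open>Intervals may overlap, so \<open>p\<close> is the one that ends last in a cluster and
  \<open>q\<close> the one that starts first in the next cluster. Colours break ties between equal
  columns.\<close>

definition gap :: "nat set \<Rightarrow> (nat \<Rightarrow> nat) \<Rightarrow> (nat \<Rightarrow> nat) \<Rightarrow> nat \<Rightarrow> nat \<Rightarrow> bool" where
  "gap A a g p q \<longleftrightarrow> p \<in> A \<and> q \<in> A \<and> lex_less (hi a g p) p (lo a g q) q \<and>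
     (\<forall>i\<in>A. i \<noteq> p \<longrightarrow> i \<noteq> q \<longrightarrow>
        lex_less (hi a g i) i (hi a g p) p \<or> lex_less (lo a g q) q (lo a g i) i)"

lemma lex_max:
  assumes "finite A" "A \<noteq> {}"
  shows "\<exists>p\<in>A. \<forall>i\<in>A. i \<noteq> p \<longrightarrow> lex_less (f i) i (f p) p"
  using assms
proof (induction A rule: finite_ne_induct)
  case (insert x F)
  then obtain p where p: "p \<in> F" "\<forall>i\<in>F. i \<noteq> p \<longrightarrow> lex_less (f i) i (f p) p" by blast
  show ?case
  proof (cases "lex_less (f p) p (f x) x")
    case True
    then show ?thesis using p by (intro bexI[of _ x]) (auto simp: lex_less_def)
  next
    case False
    then show ?thesis using p insert.hyps by (intro bexI[of _ p]) (auto simp: lex_less_def)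
  qed
qed simp

lemma lex_min:
  assumes "finite A" "A \<noteq> {}"
  shows "\<exists>p\<in>A. \<forall>i\<in>A. i \<noteq> p \<longrightarrow> lex_less (f p) p (f i) i"
  using assms
proof (induction A rule: finite_ne_induct)
  case (insert x F)
  then obtain p where p: "p \<in> F" "\<forall>i\<in>F. i \<noteq> p \<longrightarrow> lex_less (f p) p (f i) i" by blast
  show ?case
  proof (cases "lex_less (f x) x (f p) p")
    case True
    then show ?thesis using p by (intro bexI[of _ x]) (auto simp: lex_less_def)
  next
    case False
    then show ?thesis using p insert.hyps by (intro bexI[of _ p]) (auto simp: lex_less_def)
  qed
qed simp

lemma lex_less_trans: "lex_less a i b j \<Longrightarrow> lex_less b j c k \<Longrightarrow> lex_less a i c k"
  by (auto simp: lex_less_def)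

lemma lex_less_mono: "lex_less a i b j \<Longrightarrow> b \<le> c \<Longrightarrow> lex_less a i c j"
  by (auto simp: lex_less_def)

lemma lex_less_mono': "lex_less b i c j \<Longrightarrow> a \<le> b \<Longrightarrow> lex_less a i c j"
  by (auto simp: lex_less_def)

lemma gap_neq: "gap A a g p q \<Longrightarrow> p \<noteq> q"
  using lo_le_hi[of a g p] unfolding gap_def lex_less_def by auto

text \<open>Of two candidates, neither can end before \<open>p\<close> does, since both start after
  that; so each would have to start before the other.\<close>

lemma gap_right_unique:
  assumes "gap A a g p q" "gap A a g p q'" shows "q = q'"
proof (rule ccontr)
  assume "q \<noteq> q'"
  then show False
    using assms gap_neq[OF assms(1)] gap_neq[OF assms(2)] lo_le_hi[of a g q] lo_le_hi[of a g q']
    unfolding gap_def lex_less_def by (smt (verit) less_le_trans less_not_sym order_le_less)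
qed

lemma gap_left_unique:
  assumes "gap A a g p q" "gap A a g p' q" shows "p = p'"
proof (rule ccontr)
  assume "p \<noteq> p'"
  then show False
    using assms gap_neq[OF assms(1)] gap_neq[OF assms(2)] lo_le_hi[of a g p] lo_le_hi[of a g p']
    unfolding gap_def lex_less_def by (smt (verit) less_le_trans less_not_sym order_le_less)
qed

text \<open>Take for \<open>p\<close> the interval that ends last among those ending before
  \<open>b\<close>; every other one ends earlier or starts after \<open>q\<close> does. The family
  is nonempty because \<open>p0\<close> does not start after \<open>q\<close>, so
  \<open>below_ok\<close> makes it end before \<open>b\<close>.\<close>

lemma below_ok_gap:
  assumes "finite A" "below_ok A a g q b" "b < lo a g q" "q \<in> A" "p0 \<in> A" "p0 \<noteq> q"
    and "\<not> lex_less (lo a g q) q (lo a g p0) p0"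
  shows "\<exists>p. gap A a g p q \<and> lex_less (hi a g p) p b q"
proof -
  let ?S = "{p\<in>A. p \<noteq> q \<and> lex_less (hi a g p) p b q}"
  have "p0 \<in> ?S" using assms unfolding below_ok_def by auto
  then obtain p where p: "p \<in> ?S" "\<forall>i\<in>?S. i \<noteq> p \<longrightarrow> lex_less (hi a g i) i (hi a g p) p"
    using lex_max[of ?S "hi a g"] assms(1) by auto
  have "lex_less (hi a g p) p (lo a g q) q"
    using p(1) assms(3) lex_less_mono[of "hi a g p" p b q "lo a g q"] by auto
  moreover have "lex_less (hi a g i) i (hi a g p) p \<or> lex_less (lo a g q) q (lo a g i) i"
    if "i \<in> A" "i \<noteq> p" "i \<noteq> q" for i
    using that p(2) assms(2,3) unfolding below_ok_def by blast
  ultimately show ?thesis using p(1) assms(4) unfolding gap_def by blast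
qed

lemma above_ok_gap:
  assumes "finite A" "above_ok A a g p b" "hi a g p < b" "p \<in> A" "q0 \<in> A" "q0 \<noteq> p"
    and "\<not> lex_less (hi a g q0) q0 (hi a g p) p"
  shows "\<exists>q. gap A a g p q \<and> lex_less b p (lo a g q) q"
proof -
  let ?S = "{q\<in>A. q \<noteq> p \<and> lex_less b p (lo a g q) q}"
  have "q0 \<in> ?S" using assms unfolding above_ok_def by auto
  then obtain q where q: "q \<in> ?S" "\<forall>i\<in>?S. i \<noteq> q \<longrightarrow> lex_less (lo a g q) q (lo a g i) i"
    using lex_min[of ?S "lo a g"] assms(1) by auto
  have "lex_less (hi a g p) p (lo a g q) q"
    using q(1) assms(3) lex_less_mono'[of b p "lo a g q" q "hi a g p"] by auto
  moreover have "lex_less (hi a g i) i (hi a g p) p \<or> lex_less (lo a g q) q (lo a g i) i"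
    if "i \<in> A" "i \<noteq> p" "i \<noteq> q" for i
    using that q(2) assms(2,3) unfolding above_ok_def by blast
  ultimately show ?thesis using q(1) assms(4) unfolding gap_def by blast
qed

lemma gap_below_ok:
  assumes "gap A a g p q" "lex_less (hi a g p) p b q" "b \<le> lo a g q"
  shows "below_ok A a g q b"
  using assms unfolding gap_def below_ok_def by (metis lex_less_trans)

lemma gap_above_ok:
  assumes "gap A a g p q" "lex_less b p (lo a g q) q" "hi a g p \<le> b"
  shows "above_ok A a g p b"
  using assms unfolding gap_def above_ok_def by (metis lex_less_trans)

text \<open>The tie-breaking colours stay in place when a stretch is reflected, so strictness at one
  end of a gap becomes strictness at the other, also where columns coincide.\<close>

lemma lex_less_reflect:
  assumes "b \<le> y" "x + y = b + c"
  shows "lex_less x i b j \<longleftrightarrow> lex_less c i y j"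
  using assms unfolding lex_less_def by auto

lemma west_east_iff:
  assumes "l < h"
  shows "west_step l h a b \<and> east_step N (Suc l) h b g \<longleftrightarrow>
    b l = 0 \<and> g l = 0 \<and> g h = N + 2 \<and> (\<forall>i. i \<notin> {l..h} \<longrightarrow> b i = a i \<and> g i = a i) \<and>
    (\<forall>p\<in>{l..h}. \<forall>q\<in>{l..h}. p < q \<longrightarrow> commute_pair (a p) (g p) (a q) (g q)) \<and>
    (\<forall>q\<in>{l..h}. below_ok {l..h} a g q (b q))" (is "?L \<longleftrightarrow> ?R")
proof -
  let ?A = "{l..h}"
  \<comment> \<open>Colour \<open>l\<close> is already gone in the east row but keeps position 0,
    where its conditions hold trivially. So both rows can be tested on the same index set.\<close>
  have l0: "east_pair 0 0 x y" for x y by (simp add: east_pair_def)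
  have sp: "?A = insert l {Suc l..h}" using assms by auto
  have "?L \<longleftrightarrow> b l = 0 \<and> g l = 0 \<and> g h = N + 2 \<and> (\<forall>i. i \<notin> ?A \<longrightarrow> b i = a i \<and> g i = a i) \<and>
      (\<forall>i\<in>?A. b i \<le> a i \<and> b i \<le> g i) \<and>
      (\<forall>p\<in>?A. \<forall>q\<in>?A. p < q \<longrightarrow> west_pair (a p) (b p) (a q) (b q) \<and> east_pair (b p) (g p) (b q) (g q))"
    (is "_ \<longleftrightarrow> ?M")
  proof
    assume L: ?L
    have gl: "g l = 0" using L unfolding west_step_def east_step_def by auto
    have "east_pair (b p) (g p) (b q) (g q)" if "p \<in> ?A" "q \<in> ?A" "p < q" for p q
    proof (cases "p = l")
      case True
      then show ?thesis using L gl l0 unfolding west_step_def by auto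
    next
      case False
      then show ?thesis using L that east_step_pair[of N "Suc l" h b g p q] by auto
    qed
    then show ?M using L gl unfolding west_step_def east_step_def by (auto simp: sp)
  next
    assume M: ?M
    have "g i = b i" if "i \<notin> {Suc l..h}" for i
      using M that by (cases "i = l") (auto simp: sp)
    then show ?L using M unfolding west_step_def east_step_def by (auto simp: sp)
  qed
  also have "\<dots> \<longleftrightarrow> ?R"
  proof
    assume M: ?M
    have pr: "commute_pair (a p) (g p) (a q) (g q)
      \<and> (b q < lo a g q \<longrightarrow> lex_less (hi a g p) p (b q) q \<or> lex_less (lo a g q) q (lo a g p) p)
      \<and> (b p < lo a g p \<longrightarrow> lex_less (hi a g q) q (b p) p \<or> lex_less (lo a g p) p (lo a g q) q)"
      if "p \<in> ?A" "q \<in> ?A" "p < q" for p q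
      using west_east_pair[of p q "b p" "a p" "g p" "b q" "a q" "g q"] M that unfolding lo_def hi_def by blast
    have "below_ok ?A a g q (b q)" if "q \<in> ?A" for q
      unfolding below_ok_def
    proof (intro conjI ballI impI)
      show "b q \<le> lo a g q" using M that by (auto simp: lo_def)
    next
      fix p assume "p \<in> ?A" "p \<noteq> q" "b q < lo a g q"
      then show "lex_less (hi a g p) p (b q) q \<or> lex_less (lo a g q) q (lo a g p) p"
        using pr[of p q] pr[of q p] that by (meson linorder_neqE_nat)
    qed
    then show ?R using M pr by blast
  next
    assume R: ?R
    have le: "b i \<le> a i \<and> b i \<le> g i" if "i \<in> ?A" for i
      using R that unfolding below_ok_def lo_def by auto
    have "west_pair (a p) (b p) (a q) (b q) \<and> east_pair (b p) (g p) (b q) (g q)"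
      if "p \<in> ?A" "q \<in> ?A" "p < q" for p q
    proof -
      have "below_ok ?A a g q (b q)" "below_ok ?A a g p (b p)" using R that by auto
      then have "(b q < lo a g q \<longrightarrow> lex_less (hi a g p) p (b q) q \<or> lex_less (lo a g q) q (lo a g p) p)"
        "(b p < lo a g p \<longrightarrow> lex_less (hi a g q) q (b p) p \<or> lex_less (lo a g p) p (lo a g q) q)"
        using that less_imp_neq[OF that(3)] less_imp_neq[OF that(3), symmetric]
        unfolding below_ok_def by blast+
      moreover have "commute_pair (a p) (g p) (a q) (g q)" using R that by blast
      ultimately show ?thesis
        using west_east_pair[of p q "b p" "a p" "g p" "b q" "a q" "g q"] le that unfolding lo_def hi_def by blast
    qed
    then show ?M using R le by blast
  qed
  finally show ?thesis .
qed

lemma east_west_iff: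
  assumes "l < h" "1 \<le> l" "live N l h a"
  shows "east_step N l h a b \<and> west_step l (h - 1) b g \<longleftrightarrow>
    b h = N + 2 \<and> g l = 0 \<and> g h = N + 2 \<and> (\<forall>i. i \<notin> {l..h} \<longrightarrow> b i = a i \<and> g i = a i) \<and>
    (\<forall>p\<in>{l..h}. \<forall>q\<in>{l..h}. p < q \<longrightarrow> commute_pair (a p) (g p) (a q) (g q)) \<and>
    (\<forall>q\<in>{l..h}. above_ok {l..h} a g q (b q))" (is "?L \<longleftrightarrow> ?R")
proof -
  let ?A = "{l..h}"
  have sp: "?A = insert h {l..h - 1}" using assms by auto
  have "?L \<longleftrightarrow> b h = N + 2 \<and> g l = 0 \<and> g h = N + 2 \<and> (\<forall>i. i \<notin> ?A \<longrightarrow> b i = a i \<and> g i = a i) \<and>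
      (\<forall>i\<in>?A. a i \<le> b i \<and> g i \<le> b i) \<and>
      (\<forall>p\<in>?A. \<forall>q\<in>?A. p < q \<longrightarrow> east_pair (a p) (b p) (a q) (b q) \<and> west_pair (b p) (g p) (b q) (g q))"
    (is "_ \<longleftrightarrow> ?M")
  proof
    assume L: ?L
    have gh: "g h = N + 2" "b h = N + 2"
      using L assms unfolding west_step_def east_step_def by auto
    \<comment> \<open>Colour \<open>h\<close> now sits at \<open>N + 2\<close>, beyond every
      position still in the grid, so its west conditions hold automatically; the bound on the other
      positions comes from here.\<close>
    have lv: "live N l (h - 1) b" using east_step_live L assms by auto
    have "west_pair (b p) (g p) (b q) (g q)" if "p \<in> ?A" "q \<in> ?A" "p < q" for p q
    proof (cases "q = h")
      case True
      then have "b p \<le> N + 1" using lv that unfolding live_def by auto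
      then show ?thesis using True gh by (auto simp: west_pair_def)
    next
      case False
      then show ?thesis using L that west_step_pair[of l "h - 1" b g p q] by auto
    qed
    then show ?M using L gh assms unfolding west_step_def east_step_def by (auto simp: sp)
  next
    assume M: ?M
    have "g i = b i" if "i \<notin> {l..h - 1}" for i
      using M that by (cases "i = h") (auto simp: sp)
    then show ?L using M assms unfolding west_step_def east_step_def by (auto simp: sp)
  qed
  also have "\<dots> \<longleftrightarrow> ?R"
  proof
    assume M: ?M
    have pr: "commute_pair (a p) (g p) (a q) (g q)
      \<and> (hi a g q < b q \<longrightarrow> lex_less (hi a g p) p (hi a g q) q \<or> lex_less (b q) q (lo a g p) p)
      \<and> (hi a g p < b p \<longrightarrow> lex_less (hi a g q) q (hi a g p) p \<or> lex_less (b p) p (lo a g q) q)"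
      if "p \<in> ?A" "q \<in> ?A" "p < q" for p q
      using east_west_pair[of p q "a p" "b p" "g p" "a q" "b q" "g q"] M that unfolding lo_def hi_def by blast
    have "above_ok ?A a g q (b q)" if "q \<in> ?A" for q
      unfolding above_ok_def
    proof (intro conjI ballI impI)
      show "hi a g q \<le> b q" using M that by (auto simp: hi_def)
    next
      fix p assume "p \<in> ?A" "p \<noteq> q" "hi a g q < b q"
      then show "lex_less (hi a g p) p (hi a g q) q \<or> lex_less (b q) q (lo a g p) p"
        using pr[of p q] pr[of q p] that by (meson linorder_neqE_nat)
    qed
    then show ?R using M pr by blast
  next
    assume R: ?R
    have le: "a i \<le> b i \<and> g i \<le> b i" if "i \<in> ?A" for i
      using R that unfolding above_ok_def hi_def by auto
    have "east_pair (a p) (b p) (a q) (b q) \<and> west_pair (b p) (g p) (b q) (g q)"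
      if "p \<in> ?A" "q \<in> ?A" "p < q" for p q
    proof -
      have "above_ok ?A a g q (b q)" "above_ok ?A a g p (b p)" using R that by auto
      then have "(hi a g q < b q \<longrightarrow> lex_less (hi a g p) p (hi a g q) q \<or> lex_less (b q) q (lo a g p) p)"
        "(hi a g p < b p \<longrightarrow> lex_less (hi a g q) q (hi a g p) p \<or> lex_less (b p) p (lo a g q) q)"
        using that less_imp_neq[OF that(3)] less_imp_neq[OF that(3), symmetric]
        unfolding above_ok_def by blast+
      moreover have "commute_pair (a p) (g p) (a q) (g q)" using R that by blast
      ultimately show ?thesis
        using east_west_pair[of p q "a p" "b p" "g p" "a q" "b q" "g q"] le that unfolding lo_def hi_def by blast
    qed
    then show ?M using R le by blast
  qed
  finally show ?thesis .
qed

section \<open>West and east rows commute\<close>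

text \<open>The weight-preserving bijection: on each gap between consecutive intervals, of \<open>p\<close> and then \<open>q\<close>,
  the free position of \<open>q\<close> (west-east) is reflected to the free position of \<open>p\<close> (east-west).\<close>

definition flip_up :: "nat set \<Rightarrow> (nat \<Rightarrow> nat) \<Rightarrow> (nat \<Rightarrow> nat) \<Rightarrow> (nat \<Rightarrow> nat) \<Rightarrow> nat \<Rightarrow> nat" where
  "flip_up A a g b p = (if p \<notin> A then b p
     else if \<exists>q. gap A a g p q then hi a g p + lo a g (THE q. gap A a g p q) - b (THE q. gap A a g p q)
     else hi a g p)"

definition flip_down :: "nat set \<Rightarrow> (nat \<Rightarrow> nat) \<Rightarrow> (nat \<Rightarrow> nat) \<Rightarrow> (nat \<Rightarrow> nat) \<Rightarrow> nat \<Rightarrow> nat" where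
  "flip_down A a g b q = (if q \<notin> A then b q
     else if \<exists>p. gap A a g p q then hi a g (THE p. gap A a g p q) + lo a g q - b (THE p. gap A a g p q)
     else lo a g q)"

lemma gap_in: "gap A a g p q \<Longrightarrow> p \<in> A" "gap A a g p q \<Longrightarrow> q \<in> A"
  by (auto simp: gap_def)

lemma flip_up_gap: "gap A a g p q \<Longrightarrow> flip_up A a g b p = hi a g p + lo a g q - b q"
proof -
  assume g: "gap A a g p q"
  have "(THE q. gap A a g p q) = q" using g gap_right_unique by (intro the_equality) auto
  then show ?thesis using g gap_in(1)[OF g] by (auto simp: flip_up_def)
qed

lemma flip_down_gap: "gap A a g p q \<Longrightarrow> flip_down A a g b q = hi a g p + lo a g q - b p"
proof -
  assume g: "gap A a g p q"
  have "(THE p. gap A a g p q) = p" using g gap_left_unique by (intro the_equality) auto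
  then show ?thesis using g gap_in(2)[OF g] by (auto simp: flip_down_def)
qed

lemma flip_up_no_gap: "p \<in> A \<Longrightarrow> \<nexists>q. gap A a g p q \<Longrightarrow> flip_up A a g b p = hi a g p"
  by (auto simp: flip_up_def)

lemma flip_down_no_gap: "q \<in> A \<Longrightarrow> \<nexists>p. gap A a g p q \<Longrightarrow> flip_down A a g b q = lo a g q"
  by (auto simp: flip_down_def)

text \<open>The interval of \<open>l\<close> starts at 0, so no free stretch is unbounded to the
  left: a middle position below \<open>lo\<close> always has an interval ending before it and thus
  lies in a gap. Colours without a gap to their left are rigid.\<close>

lemma gap_below_range:
  assumes "l < h" "a l \<ge> 1" "g l = 0" "b l = 0" and ok: "\<forall>q\<in>{l..h}. below_ok {l..h} a g q (b q)"
    and q: "q \<in> {l..h}"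
  shows "(\<nexists>p. gap {l..h} a g p q) \<Longrightarrow> b q = lo a g q"
    and "gap {l..h} a g p q \<Longrightarrow> lex_less (hi a g p) p (b q) q \<and> b q \<le> lo a g q"
proof -
  have le: "b q \<le> lo a g q" using ok q by (auto simp: below_ok_def)
  have lo0: "lo a g l = 0" using assms by (simp add: lo_def)
  have ex: "\<exists>p. gap {l..h} a g p q \<and> lex_less (hi a g p) p (b q) q" if "b q < lo a g q"
  proof (rule below_ok_gap[of "{l..h}" a g q "b q" l])
    show "l \<noteq> q" using that lo0 by auto
    show "\<not> lex_less (lo a g q) q (lo a g l) l" using lo0 that by (simp add: lex_less_def)
    show "l \<in> {l..h}" using assms(1) by simp
  qed (use ok q that in simp_all)
  show "(\<nexists>p. gap {l..h} a g p q) \<Longrightarrow> b q = lo a g q" using ex le by (meson le_neq_implies_less)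
  assume g: "gap {l..h} a g p q"
  show "lex_less (hi a g p) p (b q) q \<and> b q \<le> lo a g q"
  proof (cases "b q < lo a g q")
    case True
    then obtain p' where "gap {l..h} a g p' q" "lex_less (hi a g p') p' (b q) q" using ex by blast
    then show ?thesis using gap_left_unique[OF g] le by simp
  next
    case False
    then show ?thesis using g le unfolding gap_def by auto
  qed
qed

text \<open>Mirror image, with \<open>h\<close> in the part of \<open>l\<close>: its interval ends
  at \<open>N + 2\<close>, last in the order because ties go to the larger colour.\<close>

lemma gap_above_range:
  assumes "l < h" "live N l h a" "g h = N + 2" "b h = N + 2" and ok: "\<forall>q\<in>{l..h}. above_ok {l..h} a g q (b q)"
    and "\<forall>i\<in>{l..h}. g i \<le> N + 2" and p: "p \<in> {l..h}"
  shows "(\<nexists>q. gap {l..h} a g p q) \<Longrightarrow> b p = hi a g p"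
    and "gap {l..h} a g p q \<Longrightarrow> lex_less (b p) p (lo a g q) q \<and> hi a g p \<le> b p"
proof -
  have le: "hi a g p \<le> b p" using ok p by (auto simp: above_ok_def)
  have "a i \<le> N + 1" if "i \<in> {l..h}" for i using assms(2) that by (auto simp: live_def)
  from this[of h] this[OF p] have hh: "hi a g h = N + 2" and hb: "hi a g p \<le> N + 2"
    using assms(1,3,6,7) by (auto simp: hi_def)
  have ex: "\<exists>q. gap {l..h} a g p q \<and> lex_less (b p) p (lo a g q) q" if b: "hi a g p < b p"
  proof -
    have ph: "h \<noteq> p" using b hh assms(4) by auto
    have h0: "h \<in> {l..h}" using assms(1) by auto
    have "\<not> lex_less (hi a g h) h (hi a g p) p"
      using hh hb p ph by (auto simp: lex_less_def)
    then show ?thesis using above_ok_gap[OF _ bspec[OF ok p] b p h0 ph] by simp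
  qed
  show "(\<nexists>q. gap {l..h} a g p q) \<Longrightarrow> b p = hi a g p" using ex le by (metis le_neq_implies_less)
  assume g: "gap {l..h} a g p q"
  show "lex_less (b p) p (lo a g q) q \<and> hi a g p \<le> b p"
  proof (cases "hi a g p < b p")
    case True
    then obtain q' where "gap {l..h} a g p q'" "lex_less (b p) p (lo a g q') q'" using ex by blast
    then show ?thesis using gap_right_unique[OF g] le by simp
  next
    case False
    then show ?thesis using g le unfolding gap_def by auto
  qed
qed

context
  fixes l h N :: nat and a g :: "nat \<Rightarrow> nat"
  assumes lh: "l < h" and lv: "live N l h a" and gl: "g l = 0" and gh: "g h = N + 2"
    and gb: "\<forall>i\<in>{l..h}. g i \<le> N + 2"
begin

lemma low_end_pos: "1 \<le> a l" and high_end_le: "a h \<le> N + 1"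
  using lv lh by (auto simp: live_def)

text \<open>Nothing ends before position 0, so flipping down puts \<open>l\<close> at 0, as a west
  row requires; \<open>h\<close> is treated likewise below.\<close>

lemma no_gap_into_l: "\<not> gap {l..h} a g p l"
  using gl by (auto simp: gap_def lex_less_def lo_def)

lemma no_gap_from_h: "\<not> gap {l..h} a g h q"
proof
  assume q: "gap {l..h} a g h q"
  then have "a q \<le> N + 1" using lv gap_in(2)[OF q] by (auto simp: live_def)
  moreover have "N + 2 \<le> hi a g h" using gh by (simp add: hi_def)
  ultimately show False using q by (auto simp: gap_def lex_less_def lo_def)
qed

lemma flip_up_h: "flip_up {l..h} a g b h = N + 2"
  using flip_up_no_gap[of h "{l..h}" a g b] no_gap_from_h lh gh high_end_le by (auto simp: hi_def)

lemma flip_down_l: "flip_down {l..h} a g b l = 0"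
  using flip_down_no_gap[of l "{l..h}" a g b] no_gap_into_l lh gl by (auto simp: lo_def)

lemma flip_up_above_ok:
  assumes b: "b l = 0" "\<forall>q\<in>{l..h}. below_ok {l..h} a g q (b q)" and p: "p \<in> {l..h}"
  shows "above_ok {l..h} a g p (flip_up {l..h} a g b p)"
proof (cases "\<exists>q. gap {l..h} a g p q")
  case True
  then obtain q where q: "gap {l..h} a g p q" by blast
  note r = gap_below_range(2)[OF lh low_end_pos gl b gap_in(2)[OF q] q]
  show ?thesis
    unfolding flip_up_gap[OF q]
    by (rule gap_above_ok[OF q])
      (use r lex_less_reflect[of "b q" "lo a g q" "hi a g p" "hi a g p + lo a g q - b q" p q] in auto)
next
  case False
  then show ?thesis using flip_up_no_gap[OF p] by (auto simp: above_ok_def)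
qed

lemma flip_down_below_ok:
  assumes b: "b h = N + 2" "\<forall>q\<in>{l..h}. above_ok {l..h} a g q (b q)" and q: "q \<in> {l..h}"
  shows "below_ok {l..h} a g q (flip_down {l..h} a g b q)"
proof (cases "\<exists>p. gap {l..h} a g p q")
  case True
  then obtain p where p: "gap {l..h} a g p q" by blast
  note r = gap_above_range(2)[OF lh lv gh b gb gap_in(1)[OF p] p]
  have "b p \<le> lo a g q" using r by (auto simp: lex_less_def)
  then show ?thesis
    unfolding flip_down_gap[OF p]
    by (intro gap_below_ok[OF p])
      (use r lex_less_reflect[of "hi a g p + lo a g q - b p" "lo a g q" "hi a g p" "b p" p q] in auto)
next
  case False
  then show ?thesis using flip_down_no_gap[OF q] by (auto simp: below_ok_def)
qed

lemma flip_down_flip_up: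
  assumes b: "b l = 0" "\<forall>q\<in>{l..h}. below_ok {l..h} a g q (b q)"
  shows "flip_down {l..h} a g (flip_up {l..h} a g b) = b"
proof
  fix q
  consider "q \<notin> {l..h}" | p where "gap {l..h} a g p q" | "q \<in> {l..h}" "\<nexists>p. gap {l..h} a g p q" by blast
  then show "flip_down {l..h} a g (flip_up {l..h} a g b) q = b q"
  proof cases
    case 1
    then show ?thesis by (simp add: flip_down_def flip_up_def)
  next
    case (2 p)
    have "b q \<le> lo a g q" using gap_below_range(2)[OF lh low_end_pos gl b gap_in(2)[OF 2] 2] by simp
    then show ?thesis by (simp add: flip_down_gap[OF 2] flip_up_gap[OF 2])
  next
    case 3
    then show ?thesis using gap_below_range(1)[OF lh low_end_pos gl b] flip_down_no_gap by simp
  qed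
qed

lemma flip_up_flip_down:
  assumes b: "b h = N + 2" "\<forall>q\<in>{l..h}. above_ok {l..h} a g q (b q)"
  shows "flip_up {l..h} a g (flip_down {l..h} a g b) = b"
proof
  fix p
  consider "p \<notin> {l..h}" | q where "gap {l..h} a g p q" | "p \<in> {l..h}" "\<nexists>q. gap {l..h} a g p q" by blast
  then show "flip_up {l..h} a g (flip_down {l..h} a g b) p = b p"
  proof cases
    case 1
    then show ?thesis by (simp add: flip_down_def flip_up_def)
  next
    case (2 q)
    have "b p \<le> lo a g q"
      using gap_above_range(2)[OF lh lv gh b gb gap_in(1)[OF 2] 2] by (auto simp: lex_less_def)
    then show ?thesis by (simp add: flip_down_gap[OF 2] flip_up_gap[OF 2])
  next
    case 3
    then show ?thesis using gap_above_range(1)[OF lh lv gh b gb] flip_up_no_gap by simp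
  qed
qed

text \<open>Flipping hands the displacement \<open>lo - b\<close> of the right colour of a gap to
  the left colour, where it is measured above \<open>hi\<close>; colours without a gap to their left
  have displacement 0. As \<open>hi + lo\<close> equals \<open>a + g\<close> for each colour, the
  totals of the two middle rows are complementary, which is what equality of the weights
  needs.\<close>

lemma sum_flip_up:
  assumes b: "b l = 0" "\<forall>q\<in>{l..h}. below_ok {l..h} a g q (b q)"
  shows "sum (flip_up {l..h} a g b) {l..h} + sum b {l..h} = sum a {l..h} + sum g {l..h}"
proof -
  let ?A = "{l..h}"
  let ?D = "{p\<in>?A. \<exists>q. gap ?A a g p q}" and ?R = "{q\<in>?A. \<exists>p. gap ?A a g p q}"
  let ?nx = "\<lambda>p. THE q. gap ?A a g p q"
  have nx: "?nx p = q" if "gap ?A a g p q" for p q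
    using that gap_right_unique by (intro the_equality) auto
  have bij: "bij_betw ?nx ?D ?R"
  proof (rule bij_betwI')
    fix x y assume "x \<in> ?D" "y \<in> ?D"
    then obtain q q' where q: "gap ?A a g x q" "gap ?A a g y q'" by blast
    then show "(?nx x = ?nx y) = (x = y)" using nx gap_left_unique by metis
  next
    fix x assume "x \<in> ?D"
    then show "?nx x \<in> ?R" using nx gap_in by fastforce
  next
    fix y assume "y \<in> ?R"
    then obtain p where p: "gap ?A a g p y" by blast
    then show "\<exists>x\<in>?D. y = ?nx x" using nx[OF p] gap_in[OF p] by (intro bexI[of _ p]) auto
  qed
  have le: "b q \<le> lo a g q" if "q \<in> ?A" for q using b(2) that by (auto simp: below_ok_def)
  have "sum (flip_up ?A a g b) ?A
      = (\<Sum>p\<in>?A. hi a g p + (if \<exists>q. gap ?A a g p q then lo a g (?nx p) - b (?nx p) else 0))"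
  proof (rule sum.cong[OF refl])
    fix p assume p: "p \<in> ?A"
    show "flip_up ?A a g b p = hi a g p + (if \<exists>q. gap ?A a g p q then lo a g (?nx p) - b (?nx p) else 0)"
    proof (cases "\<exists>q. gap ?A a g p q")
      case True
      then obtain q where q: "gap ?A a g p q" by blast
      then show ?thesis using flip_up_gap[OF q] nx[OF q] le[OF gap_in(2)[OF q]] p by auto
    next
      case False
      then show ?thesis using flip_up_no_gap[OF p] by auto
    qed
  qed
  also have "\<dots> = sum (hi a g) ?A + (\<Sum>p\<in>?D. lo a g (?nx p) - b (?nx p))"
    by (subst sum.distrib, subst sum.inter_filter) simp_all
  also have "(\<Sum>p\<in>?D. lo a g (?nx p) - b (?nx p)) = (\<Sum>q\<in>?R. lo a g q - b q)"
    by (rule sum.reindex_bij_betw[OF bij])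
  also have "\<dots> = (\<Sum>q\<in>?A. lo a g q - b q)"
    using gap_below_range(1)[OF lh low_end_pos gl b] by (intro sum.mono_neutral_left) auto
  finally have "sum (flip_up ?A a g b) ?A = sum (hi a g) ?A + (\<Sum>q\<in>?A. lo a g q - b q)" .
  moreover have "(\<Sum>q\<in>?A. lo a g q - b q) + sum b ?A = sum (lo a g) ?A"
    using le by (simp add: sum.distrib[symmetric])
  ultimately have "sum (flip_up ?A a g b) ?A + sum b ?A = sum (hi a g) ?A + sum (lo a g) ?A"
    by simp
  also have "\<dots> = (\<Sum>i\<in>?A. hi a g i + lo a g i)" by (simp add: sum.distrib)
  also have "\<dots> = (\<Sum>i\<in>?A. a i + g i)" by (intro sum.cong) (auto simp: hi_def lo_def)
  finally show ?thesis by (simp add: sum.distrib)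
qed

end

section \<open>Finiteness of steps and the interchange theorem\<close>

lemma finite_bounded_update:
  fixes a :: "nat \<Rightarrow> nat"
  assumes "finite A"
  shows "finite {b. (\<forall>i. i \<notin> A \<longrightarrow> b i = a i) \<and> (\<forall>i\<in>A. b i \<le> (M :: nat))}" (is "finite ?S")
proof -
  have "inj_on (\<lambda>b. restrict b A) ?S"
  proof (rule inj_onI, rule ext)
    fix b c i assume "b \<in> ?S" "c \<in> ?S" "restrict b A = restrict c A"
    then show "b i = c i" by (cases "i \<in> A") (auto simp: restrict_def fun_eq_iff split: if_splits)
  qed
  moreover have "(\<lambda>b. restrict b A) ` ?S \<subseteq> A \<rightarrow>\<^sub>E {..M}" by auto
  ultimately show ?thesis
    using finite_PiE[OF assms, of "\<lambda>_. {..M}"] by (meson finite_atMost finite_imageD finite_subset)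
qed

lemma finite_west_step: "finite {b. west_step l h a b}"
proof (rule finite_subset[OF _ finite_bounded_update[of "{l..h}" a "sum a {l..h}"]])
  show "{b. west_step l h a b} \<subseteq> {b. (\<forall>i. i \<notin> {l..h} \<longrightarrow> b i = a i) \<and> (\<forall>i\<in>{l..h}. b i \<le> sum a {l..h})}"
    using member_le_sum[of _ "{l..h}" a] unfolding west_step_def by (auto intro: order_trans)
qed simp

lemma finite_east_step:
  assumes "1 \<le> l" "l \<le> h" "live N l h a"
  shows "finite {b. east_step N l h a b}"
proof (rule finite_subset[OF _ finite_bounded_update[of "{l..h}" a "N + 2"]])
  have "b i \<le> N + 2" if "east_step N l h a b" "i \<in> {l..h}" for b i
  proof (cases "i = h")
    case True
    then show ?thesis using that unfolding east_step_def by simp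
  next
    case False
    then show ?thesis using east_step_live[OF that(1) assms(3,2,1)] that unfolding live_def by force
  qed
  then show "{b. east_step N l h a b} \<subseteq> {b. (\<forall>i. i \<notin> {l..h} \<longrightarrow> b i = a i) \<and> (\<forall>i\<in>{l..h}. b i \<le> N + 2)}"
    unfolding east_step_def by auto
qed simp

theorem row_sum_commute:
  assumes lh: "1 \<le> l" "l < h" and lv: "live N l h a"
  shows "row_sum N (W # E # ds) l h a = row_sum N (E # W # ds) l h a"
proof -
  let ?S = "SIGMA b:{b. west_step l h a b}. {g. east_step N (Suc l) h b g}"
  let ?S' = "SIGMA b:{b. east_step N l h a b}. {g. west_step l (h - 1) b g}"
  let ?F = "\<lambda>(b, g). var l ^ (sum a {l..h} - sum b {l..h} - 1)
      * (var h ^ (N + 1 - (sum g {Suc l..h} - sum b {Suc l..h})) * row_sum N ds (Suc l) (h - 1) g)"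
  let ?F' = "\<lambda>(b, g). var h ^ (N + 1 - (sum b {l..h} - sum a {l..h}))
      * (var l ^ (sum b {l..h - 1} - sum g {l..h - 1} - 1) * row_sum N ds (Suc l) (h - 1) g)"
  have lv1: "live N (Suc l) h b" if "west_step l h a b" for b
    using west_step_live[OF that lv] lh by simp
  have lv2: "live N l (h - 1) b" if "east_step N l h a b" for b
    using east_step_live[OF that lv] lh by simp
  have 1: "row_sum N (W # E # ds) l h a = sum ?F ?S"
    using lh lv1 finite_west_step finite_east_step
    by (simp add: sum_distrib_left sum.Sigma)
  have 2: "row_sum N (E # W # ds) l h a = sum ?F' ?S'"
    using lh lv finite_west_step finite_east_step[of l h N a]
    by (simp add: sum_distrib_left sum.Sigma)
  have g_le: "\<forall>i\<in>{l..h}. g i \<le> N + 2"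
    if "g l = 0" "g h = N + 2" "live N (Suc l) (h - 1) g" for g
  proof
    fix i assume i: "i \<in> {l..h}"
    show "g i \<le> N + 2"
    proof (cases "i = l \<or> i = h")
      case True
      then show ?thesis using that by auto
    next
      case False
      then have "i \<in> {Suc l..h - 1}" using i by auto
      then show ?thesis using that(3) unfolding live_def by force
    qed
  qed
  have S: "b l = 0 \<and> g l = 0 \<and> g h = N + 2 \<and> (\<forall>i\<in>{l..h}. g i \<le> N + 2)
      \<and> (\<forall>i. i \<notin> {l..h} \<longrightarrow> b i = a i \<and> g i = a i)
      \<and> (\<forall>p\<in>{l..h}. \<forall>q\<in>{l..h}. p < q \<longrightarrow> commute_pair (a p) (g p) (a q) (g q))
      \<and> (\<forall>q\<in>{l..h}. below_ok {l..h} a g q (b q))" if "(b, g) \<in> ?S" for b g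
  proof -
    have "west_step l h a b" "east_step N (Suc l) h b g" using that by auto
    then show ?thesis
      using west_east_iff[OF lh(2), of a b N g] g_le east_step_live[OF _ lv1] lh by auto
  qed
  have S': "b h = N + 2 \<and> g l = 0 \<and> g h = N + 2 \<and> (\<forall>i\<in>{l..h}. g i \<le> N + 2)
      \<and> (\<forall>i. i \<notin> {l..h} \<longrightarrow> b i = a i \<and> g i = a i)
      \<and> (\<forall>p\<in>{l..h}. \<forall>q\<in>{l..h}. p < q \<longrightarrow> commute_pair (a p) (g p) (a q) (g q))
      \<and> (\<forall>q\<in>{l..h}. above_ok {l..h} a g q (b q))" if "(b, g) \<in> ?S'" for b g
  proof -
    have "east_step N l h a b" "west_step l (h - 1) b g" using that by auto
    then show ?thesis
      using east_west_iff[OF lh(2) lh(1) lv, of b g] g_le west_step_live[OF _ lv2] lh by auto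
  qed
  have up: "flip_down {l..h} a g (flip_up {l..h} a g b) = b" "(flip_up {l..h} a g b, g) \<in> ?S'"
      "?F' (flip_up {l..h} a g b, g) = ?F (b, g)" if bg: "(b, g) \<in> ?S" for b g
  proof -
    note s = S[OF bg]
    let ?b = "flip_up {l..h} a g b"
    show "flip_down {l..h} a g ?b = b" using flip_down_flip_up[OF lh(2) lv] s by simp
    have "?b i = a i" if "i \<notin> {l..h}" for i using that s by (simp add: flip_up_def)
    then have e: "east_step N l h a ?b \<and> west_step l (h - 1) ?b g"
      using s flip_up_h[OF lh(2) lv] flip_up_above_ok[OF lh(2) lv]
      by (subst east_west_iff[OF lh(2) lh(1) lv]) auto
    then show "(?b, g) \<in> ?S'" by simp
    have sm: "sum ?b {l..h} + sum b {l..h} = sum a {l..h} + sum g {l..h}"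
      using sum_flip_up[OF lh(2) lv] s by simp
    have "sum g {l..h} = sum g {Suc l..h}" "sum b {l..h} = sum b {Suc l..h}"
      using s lh by (simp_all add: sum.atLeast_Suc_atMost)
    moreover have hh: "h = Suc (h - 1)" using lh by simp
    have "sum f {l..h} = sum f {l..h - 1} + f h" for f :: "nat \<Rightarrow> nat"
      using sum.atLeast_Suc_atMost lh hh by (metis less_Suc_eq_le sum.nat_ivl_Suc' add.commute le_SucI)
    then have "sum ?b {l..h} = sum ?b {l..h - 1} + (N + 2)" "sum g {l..h} = sum g {l..h - 1} + (N + 2)"
      using s flip_up_h[OF lh(2) lv] by auto
    \<comment> \<open>The exponents of \<open>var l\<close> and \<open>var h\<close> agree
      separately: the boundary values 0 at \<open>l\<close> and \<open>N + 2\<close> at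
      \<open>h\<close> cancel, and the rest is the complementarity \<open>sm\<close>.\<close>
    ultimately have x: "sum a {l..h} - sum b {l..h} - 1 = sum ?b {l..h - 1} - sum g {l..h - 1} - 1"
        "sum g {Suc l..h} - sum b {Suc l..h} = sum ?b {l..h} - sum a {l..h}"
      using sm by auto
    show "?F' (?b, g) = ?F (b, g)"
      unfolding x prod.case by (simp add: mult_ac)
  qed
  have down: "flip_up {l..h} a g (flip_down {l..h} a g b) = b" "(flip_down {l..h} a g b, g) \<in> ?S"
    if bg: "(b, g) \<in> ?S'" for b g
  proof -
    note s = S'[OF bg]
    let ?b = "flip_down {l..h} a g b"
    show "flip_up {l..h} a g ?b = b" using flip_up_flip_down[OF lh(2) lv] s by simp
    have "?b i = a i" if "i \<notin> {l..h}" for i using that s by (simp add: flip_down_def)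
    then have e: "west_step l h a ?b \<and> east_step N (Suc l) h ?b g"
      using s flip_down_l[OF lh(2) lv] flip_down_below_ok[OF lh(2) lv]
      by (subst west_east_iff[OF lh(2)]) auto
    then show "(?b, g) \<in> ?S" by simp
  qed
  have "sum ?F ?S = sum ?F' ?S'"
  proof (rule sum.reindex_bij_witness[where
        i = "\<lambda>(b, g). (flip_down {l..h} a g b, g)" and j = "\<lambda>(b, g). (flip_up {l..h} a g b, g)"])
    fix x assume x: "x \<in> ?S"
    obtain b g where bg: "x = (b, g)" by (cases x)
    show "(case case x of (b, g) \<Rightarrow> (flip_up {l..h} a g b, g) of (b, g) \<Rightarrow> (flip_down {l..h} a g b, g)) = x"
      using up(1)[of b g] x unfolding bg by simp
    show "(case x of (b, g) \<Rightarrow> (flip_up {l..h} a g b, g)) \<in> ?S'"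
      using up(2)[of b g] x unfolding bg by simp
    show "?F' (case x of (b, g) \<Rightarrow> (flip_up {l..h} a g b, g)) = ?F x"
      using up(3)[of b g] x unfolding bg by simp
  next
    fix x assume x: "x \<in> ?S'"
    obtain b g where bg: "x = (b, g)" by (cases x)
    show "(case case x of (b, g) \<Rightarrow> (flip_down {l..h} a g b, g) of (b, g) \<Rightarrow> (flip_up {l..h} a g b, g)) = x"
      using down(1)[of b g] x unfolding bg by simp
    show "(case x of (b, g) \<Rightarrow> (flip_down {l..h} a g b, g)) \<in> ?S"
      using down(2)[of b g] x unfolding bg by simp
  qed
  then show ?thesis using 1 2 by simp
qed

section \<open>Rows commute with sorting adjacent colours\<close>

text \<open>On row sums this realises the \<open>i\<close>-th Demazure operator, which exchanges the
  two entries at a descent and fixes everything else.\<close>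

definition sort_pair :: "nat \<Rightarrow> (nat \<Rightarrow> nat) \<Rightarrow> (nat \<Rightarrow> nat)" where
  "sort_pair i s = (if s (Suc i) < s i then swap_comp i s else s)"

lemma swap_comp_apply [simp]:
  "swap_comp i s i = s (Suc i)" "swap_comp i s (Suc i) = s i"
  "k \<noteq> i \<Longrightarrow> k \<noteq> Suc i \<Longrightarrow> swap_comp i s k = s k"
  by (auto simp: swap_comp_def tr_def)

lemma swap_comp_swap_comp [simp]: "swap_comp i (swap_comp i s) = s"
  by (auto simp: swap_comp_def tr_def)

lemma bij_betw_tr: "i \<in> A \<Longrightarrow> Suc i \<in> A \<Longrightarrow> bij_betw (tr i) A A"
  by (rule bij_betw_byWitness[of _ "tr i"]) (auto simp: tr_def)

lemma sum_swap_comp: "i \<in> A \<Longrightarrow> Suc i \<in> A \<Longrightarrow> sum (swap_comp i s) A = sum s A"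
  unfolding swap_comp_def comp_def by (rule sum.reindex_bij_betw[OF bij_betw_tr])

lemma sum_sort_pair: "i \<in> A \<Longrightarrow> Suc i \<in> A \<Longrightarrow> sum (sort_pair i s) A = sum s A"
  by (simp add: sort_pair_def sum_swap_comp)

lemma sort_pair_other [simp]: "k \<noteq> i \<Longrightarrow> k \<noteq> Suc i \<Longrightarrow> sort_pair i s k = s k"
  by (auto simp: sort_pair_def)

lemma live_sort_pair: "i \<in> {l..h} \<Longrightarrow> Suc i \<in> {l..h} \<Longrightarrow> live N l h s \<Longrightarrow> live N l h (sort_pair i s)"
  by (auto simp: sort_pair_def live_def swap_comp_def tr_def)

lemma pairs_split:
  assumes "l \<le> i" "Suc i \<le> h"
  shows "(\<forall>p\<in>{l..h}. \<forall>q\<in>{l..h}. p < q \<longrightarrow> R p q) \<longleftrightarrow>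
    (\<forall>p\<in>{l..h} - {i, Suc i}. \<forall>q\<in>{l..h} - {i, Suc i}. p < q \<longrightarrow> R p q) \<and> R i (Suc i)
    \<and> (\<forall>k\<in>{l..<i}. R k i \<and> R k (Suc i)) \<and> (\<forall>k\<in>{i+2..h}. R i k \<and> R (Suc i) k)" (is "?L = ?R")
proof
  assume ?R
  moreover have "p < q \<Longrightarrow> p \<in> {l..h} \<Longrightarrow> q \<in> {l..h} \<Longrightarrow>
      (p \<in> {l..h} - {i, Suc i} \<and> q \<in> {l..h} - {i, Suc i}) \<or> (p = i \<and> q = Suc i)
      \<or> (p \<in> {l..<i} \<and> (q = i \<or> q = Suc i)) \<or> ((p = i \<or> p = Suc i) \<and> q \<in> {i+2..h})" for p q
    by auto
  ultimately show ?L by blast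
qed (use assms in auto)

lemma all_split:
  assumes "l \<le> i" "Suc i \<le> (h::nat)"
  shows "(\<forall>p\<in>{l..h}. R p) \<longleftrightarrow> (\<forall>p\<in>{l..h} - {i, Suc i}. R p) \<and> R i \<and> R (Suc i)"
  using assms by auto

text \<open>Sorting leaves this part of a step untouched. \<open>C\<close> and \<open>R\<close> are
  parameters so that east and west rows share the bookkeeping.\<close>

definition steps_off :: "(nat \<Rightarrow> nat \<Rightarrow> bool) \<Rightarrow> (nat \<Rightarrow> nat \<Rightarrow> nat \<Rightarrow> nat \<Rightarrow> bool) \<Rightarrow> nat \<Rightarrow> nat \<Rightarrow> nat
    \<Rightarrow> (nat \<Rightarrow> nat) \<Rightarrow> (nat \<Rightarrow> nat) \<Rightarrow> bool" where
  "steps_off C R l h i a b \<longleftrightarrow> (\<forall>k. k \<notin> {l..h} \<longrightarrow> b k = a k)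
    \<and> (\<forall>k\<in>{l..h} - {i, Suc i}. C (a k) (b k))
    \<and> (\<forall>p\<in>{l..h} - {i, Suc i}. \<forall>q\<in>{l..h} - {i, Suc i}. p < q \<longrightarrow> R (a p) (b p) (a q) (b q))"

lemma steps_off_cong:
  assumes "l \<le> i" "Suc i \<le> h"
    and "\<And>k. k \<noteq> i \<Longrightarrow> k \<noteq> Suc i \<Longrightarrow> a' k = a k" "\<And>k. k \<noteq> i \<Longrightarrow> k \<noteq> Suc i \<Longrightarrow> b' k = b k"
  shows "steps_off C R l h i a' b' = steps_off C R l h i a b"
proof -
  have "k \<notin> {l..h} \<Longrightarrow> k \<noteq> i \<and> k \<noteq> Suc i" for k using assms(1,2) by auto
  then have "k \<notin> {l..h} \<Longrightarrow> (b' k = a' k) = (b k = a k)" for k using assms(3,4) by simp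
  then show ?thesis unfolding steps_off_def using assms(3,4) by simp
qed

lemma steps_split:
  assumes "l \<le> i" "Suc i \<le> h"
  shows "(\<forall>k. k \<notin> {l..h} \<longrightarrow> b k = a k) \<and> (\<forall>k\<in>{l..h}. C (a k) (b k))
      \<and> (\<forall>p\<in>{l..h}. \<forall>q\<in>{l..h}. p < q \<longrightarrow> R (a p) (b p) (a q) (b q))
    \<longleftrightarrow> steps_off C R l h i a b \<and> C (a i) (b i) \<and> C (a (Suc i)) (b (Suc i))
      \<and> R (a i) (b i) (a (Suc i)) (b (Suc i))
      \<and> (\<forall>k\<in>{l..<i}. R (a k) (b k) (a i) (b i) \<and> R (a k) (b k) (a (Suc i)) (b (Suc i)))
      \<and> (\<forall>k\<in>{i+2..h}. R (a i) (b i) (a k) (b k) \<and> R (a (Suc i)) (b (Suc i)) (a k) (b k))"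
proof -
  note p = pairs_split[OF assms, where R = "\<lambda>p q. R (a p) (b p) (a q) (b q)"]
  note c = all_split[OF assms, where R = "\<lambda>p. C (a p) (b p)"]
  show ?thesis unfolding steps_off_def p c by (simp only: conj_ac)
qed

text \<open>Inverse of \<open>sort_pair i\<close> on the floors of an east row; \<open>v\<close> is the larger of the ceiling
  entries \<open>i\<close>, \<open>i + 1\<close>.\<close>

definition east_unsort :: "nat \<Rightarrow> nat \<Rightarrow> (nat \<Rightarrow> nat) \<Rightarrow> (nat \<Rightarrow> nat)" where
  "east_unsort i v b = (if b i < v then swap_comp i b else b)"

lemma east_unsort_other [simp]: "k \<noteq> i \<Longrightarrow> k \<noteq> Suc i \<Longrightarrow> east_unsort i v s k = s k"
  by (auto simp: east_unsort_def)

text \<open>For a third colour, two abutting runs, from \<open>y\<close> to \<open>x\<close> and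
  from \<open>x\<close> to \<open>v\<close>, obstruct exactly as much as one run from
  \<open>y\<close> to \<open>v\<close> together with a vertical pipe at \<open>x\<close>.\<close>

lemma east_pair_merge_low:
  assumes "y < (x::nat)" "x \<le> v"
  shows "east_pair s t y x \<and> east_pair s t x v \<longleftrightarrow> east_pair s t x x \<and> east_pair s t y v"
  using assms unfolding east_pair_def by linarith

lemma east_pair_merge_high:
  assumes "y < (x::nat)" "x \<le> v"
  shows "east_pair y x s t \<and> east_pair x v s t \<longleftrightarrow> east_pair x x s t \<and> east_pair y v s t"
  using assms unfolding east_pair_def by linarith

text \<open>If the run from the smaller ceiling stops before column \<open>a i\<close>, the two runs
  are merely recoloured; any other colour is smaller than both \<open>i\<close> and
  \<open>i + 1\<close> or larger than both, and cannot tell them apart. If it stops exactly at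
  \<open>a i\<close>, the runs abut and are regrouped by the merge lemmas. \<open>Suc i < h\<close>
  keeps the removed colour out of the exchange.\<close>

lemma east_step_sorted_iff:
  assumes i: "l \<le> i" "Suc i < h" and lt: "a (Suc i) < a i"
  shows "east_step N l h (swap_comp i a) b \<longleftrightarrow>
    a (Suc i) \<le> b i \<and> b i \<le> a i \<and> a i \<le> b (Suc i) \<and> east_step N l h a (east_unsort i (a i) b)"
    (is "?L \<longleftrightarrow> ?R")
proof -
  let ?b = "east_unsort i (a i) b"
  let ?x = "a i" and ?y = "a (Suc i)" and ?u = "b i" and ?v = "b (Suc i)"
  have i': "l \<le> i" "Suc i \<le> h" using i by auto
  let ?O = "steps_off (\<le>) east_pair l h i a b"
  have L: "?L \<longleftrightarrow> b h = N + 2 \<and> ?O \<and> ?y \<le> ?u \<and> ?x \<le> ?v \<and> east_pair ?y ?u ?x ?v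
    \<and> (\<forall>k\<in>{l..<i}. east_pair (a k) (b k) ?y ?u \<and> east_pair (a k) (b k) ?x ?v)
    \<and> (\<forall>k\<in>{i+2..h}. east_pair ?y ?u (a k) (b k) \<and> east_pair ?x ?v (a k) (b k))"
  proof -
    have o: "steps_off (\<le>) east_pair l h i (swap_comp i a) b = ?O"
      by (rule steps_off_cong[OF i']) simp_all
    have "b h = b h" using i by simp
    then show ?thesis
      unfolding east_step_def steps_split[OF i', of b "swap_comp i a" "(\<le>)" east_pair]
      by (simp add: o conj_ac)
  qed
  have R: "east_step N l h a ?b \<longleftrightarrow> b h = N + 2 \<and> ?O \<and> ?x \<le> ?b i \<and> ?y \<le> ?b (Suc i) \<and> east_pair ?x (?b i) ?y (?b (Suc i))
    \<and> (\<forall>k\<in>{l..<i}. east_pair (a k) (b k) ?x (?b i) \<and> east_pair (a k) (b k) ?y (?b (Suc i)))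
    \<and> (\<forall>k\<in>{i+2..h}. east_pair ?x (?b i) (a k) (b k) \<and> east_pair ?y (?b (Suc i)) (a k) (b k))"
  proof -
    have o: "steps_off (\<le>) east_pair l h i a ?b = ?O"
      by (rule steps_off_cong[OF i']) simp_all
    have "?b h = b h" using i by simp
    then show ?thesis
      unfolding east_step_def steps_split[OF i', of ?b a "(\<le>)" east_pair]
      by (simp add: o conj_ac)
  qed
  have rng: "east_pair ?y ?u ?x ?v \<longleftrightarrow> ?u \<le> ?x" using lt unfolding east_pair_def by auto
  show ?thesis
  proof (cases "?u < ?x")
    case True
    then have "?b i = ?v" "?b (Suc i) = ?u" by (simp_all add: east_unsort_def)
    moreover have "east_pair ?x ?v ?y ?u" using True lt unfolding east_pair_def by auto
    ultimately show ?thesis unfolding L R rng using True by auto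
  next
    case False
    then have "?b = b" by (simp add: east_unsort_def)
    moreover have "east_pair ?x ?x ?y ?v" using lt unfolding east_pair_def by auto
    ultimately show ?thesis
      unfolding L R rng using False lt
      by (cases "?u = ?x \<and> ?x \<le> ?v")
        (auto simp: east_pair_merge_low[OF lt] east_pair_merge_high[OF lt])
  qed
qed

lemma sum_east_step_sort_pair:
  assumes i: "l \<le> i" "Suc i < h"
  shows "(\<Sum>b | east_step N l h (sort_pair i a) b. f b) = (\<Sum>b | east_step N l h a b. f (sort_pair i b))"
proof (cases "a (Suc i) < a i")
  case True
  have s: "sort_pair i a = swap_comp i a" using True by (simp add: sort_pair_def)
  have rng: "a i \<le> b i \<and> a (Suc i) \<le> b (Suc i) \<and> (a i \<le> b (Suc i) \<longrightarrow> b i = a i)" if "east_step N l h a b" for b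
  proof -
    have "east_pair (a i) (b i) (a (Suc i)) (b (Suc i))" using east_step_pair[OF that, of i "Suc i"] i by simp
    moreover have "a i \<le> b i \<and> a (Suc i) \<le> b (Suc i)" using that i unfolding east_step_def by simp
    ultimately show ?thesis using True by (simp add: east_pair_def)
  qed
  show ?thesis unfolding s
  proof (rule sum.reindex_bij_witness[where i = "sort_pair i" and j = "east_unsort i (a i)"])
    fix b assume b: "b \<in> {b. east_step N l h (swap_comp i a) b}"
    then have b': "a (Suc i) \<le> b i \<and> b i \<le> a i \<and> a i \<le> b (Suc i) \<and> east_step N l h a (east_unsort i (a i) b)"
      using east_step_sorted_iff[where a = a, OF i True] by auto
    then show "east_unsort i (a i) b \<in> {b. east_step N l h a b}" by simp
    show "sort_pair i (east_unsort i (a i) b) = b"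
      using b' by (auto simp: sort_pair_def east_unsort_def)
    then show "f (sort_pair i (east_unsort i (a i) b)) = f b" by simp
  next
    fix b assume b: "b \<in> {b. east_step N l h a b}"
    then have r: "a i \<le> b i \<and> a (Suc i) \<le> b (Suc i) \<and> (a i \<le> b (Suc i) \<longrightarrow> b i = a i)" using rng by auto
    then show u: "east_unsort i (a i) (sort_pair i b) = b"
      by (auto simp: sort_pair_def east_unsort_def)
    show "sort_pair i b \<in> {b. east_step N l h (swap_comp i a) b}"
    proof -
      have "a (Suc i) \<le> sort_pair i b i \<and> sort_pair i b i \<le> a i \<and> a i \<le> sort_pair i b (Suc i)"
        using r True by (cases "b (Suc i) < b i") (auto simp: sort_pair_def)
      moreover have "east_step N l h a (east_unsort i (a i) (sort_pair i b))" using b u by simp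
      ultimately show ?thesis by (simp add: east_step_sorted_iff[where a = a, OF i True])
    qed
  qed
next
  case False
  \<comment> \<open>Increasing ceilings force increasing floors, so sorting does nothing on either
    side.\<close>
  have "sort_pair i b = b" if b: "east_step N l h a b" for b
  proof -
    have "east_pair (a i) (b i) (a (Suc i)) (b (Suc i))" using east_step_pair[OF b, of i "Suc i"] i by simp
    moreover have "a (Suc i) \<le> b (Suc i)" using b i unfolding east_step_def by simp
    ultimately show ?thesis using False by (simp add: east_pair_def sort_pair_def)
  qed
  then show ?thesis using False by (simp add: sort_pair_def[of i a])
qed

text \<open>Mirror image of \<open>east_unsort\<close>: the threshold \<open>v\<close> is now the
  smaller of the two ceilings and is compared with the floor of \<open>i + 1\<close>.\<close>

definition west_unsort :: "nat \<Rightarrow> nat \<Rightarrow> (nat \<Rightarrow> nat) \<Rightarrow> (nat \<Rightarrow> nat)" where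
  "west_unsort i v b = (if v < b (Suc i) then swap_comp i b else b)"

lemma west_unsort_other [simp]: "k \<noteq> i \<Longrightarrow> k \<noteq> Suc i \<Longrightarrow> west_unsort i v s k = s k"
  by (auto simp: west_unsort_def)

lemma west_pair_merge_low:
  assumes "y < (x::nat)" "u \<le> y"
  shows "west_pair s t y u \<and> west_pair s t x y \<longleftrightarrow> west_pair s t x u \<and> west_pair s t y y"
  using assms unfolding west_pair_def by linarith

lemma west_pair_merge_high:
  assumes "y < (x::nat)" "u \<le> y"
  shows "west_pair y u s t \<and> west_pair x y s t \<longleftrightarrow> west_pair x u s t \<and> west_pair y y s t"
  using assms unfolding west_pair_def by linarith

text \<open>As for east rows: recolouring, except that runs abutting at column
  \<open>a (Suc i)\<close> are regrouped. The removed colour is \<open>l\<close>, kept out of the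
  exchange by \<open>l < i\<close>.\<close>

lemma west_step_sorted_iff:
  assumes i: "l < i" "Suc i \<le> h" and lt: "a (Suc i) < a i"
  shows "west_step l h (swap_comp i a) b \<longleftrightarrow>
    b i \<le> a (Suc i) \<and> a (Suc i) \<le> b (Suc i) \<and> b (Suc i) \<le> a i \<and> west_step l h a (west_unsort i (a (Suc i)) b)"
    (is "?L \<longleftrightarrow> ?R")
proof -
  let ?b = "west_unsort i (a (Suc i)) b"
  let ?x = "a i" and ?y = "a (Suc i)" and ?u = "b i" and ?v = "b (Suc i)"
  have i': "l \<le> i" "Suc i \<le> h" using i by auto
  let ?O = "steps_off (\<ge>) west_pair l h i a b"
  have L: "?L \<longleftrightarrow> b l = 0 \<and> ?O \<and> ?u \<le> ?y \<and> ?v \<le> ?x \<and> west_pair ?y ?u ?x ?v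
    \<and> (\<forall>k\<in>{l..<i}. west_pair (a k) (b k) ?y ?u \<and> west_pair (a k) (b k) ?x ?v)
    \<and> (\<forall>k\<in>{i+2..h}. west_pair ?y ?u (a k) (b k) \<and> west_pair ?x ?v (a k) (b k))"
  proof -
    have o: "steps_off (\<ge>) west_pair l h i (swap_comp i a) b = ?O"
      by (rule steps_off_cong[OF i']) simp_all
    have "b l = b l" using i by simp
    then show ?thesis
      unfolding west_step_def steps_split[OF i', of b "swap_comp i a" "(\<ge>)" west_pair]
      by (simp add: o conj_ac)
  qed
  have R: "west_step l h a ?b \<longleftrightarrow> b l = 0 \<and> ?O \<and> ?b i \<le> ?x \<and> ?b (Suc i) \<le> ?y \<and> west_pair ?x (?b i) ?y (?b (Suc i))
    \<and> (\<forall>k\<in>{l..<i}. west_pair (a k) (b k) ?x (?b i) \<and> west_pair (a k) (b k) ?y (?b (Suc i)))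
    \<and> (\<forall>k\<in>{i+2..h}. west_pair ?x (?b i) (a k) (b k) \<and> west_pair ?y (?b (Suc i)) (a k) (b k))"
  proof -
    have o: "steps_off (\<ge>) west_pair l h i a ?b = ?O"
      by (rule steps_off_cong[OF i']) simp_all
    have "?b l = b l" using i by simp
    then show ?thesis
      unfolding west_step_def steps_split[OF i', of ?b a "(\<ge>)" west_pair]
      by (simp add: o conj_ac)
  qed
  have rng: "west_pair ?y ?u ?x ?v \<longleftrightarrow> ?y \<le> ?v" using lt unfolding west_pair_def by auto
  show ?thesis
  proof (cases "?y < ?v")
    case True
    then have "?b i = ?v" "?b (Suc i) = ?u" by (simp_all add: west_unsort_def)
    moreover have "west_pair ?x ?v ?y ?u" using True lt unfolding west_pair_def by auto
    ultimately show ?thesis unfolding L R rng using True by auto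
  next
    case False
    then have "?b = b" by (simp add: west_unsort_def)
    moreover have "west_pair ?x ?u ?y ?y" using lt unfolding west_pair_def by auto
    ultimately show ?thesis
      unfolding L R rng using False lt
      by (cases "?v = ?y \<and> ?u \<le> ?y")
        (auto simp: west_pair_merge_low[OF lt] west_pair_merge_high[OF lt])
  qed
qed

lemma sum_west_step_sort_pair:
  assumes i: "l < i" "Suc i \<le> h"
  shows "(\<Sum>b | west_step l h (sort_pair i a) b. f b) = (\<Sum>b | west_step l h a b. f (sort_pair i b))"
proof (cases "a (Suc i) < a i")
  case True
  have s: "sort_pair i a = swap_comp i a" using True by (simp add: sort_pair_def)
  have rng: "b i \<le> a i \<and> b (Suc i) \<le> a (Suc i) \<and> (b i \<le> a (Suc i) \<longrightarrow> b (Suc i) = a (Suc i))"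
    if "west_step l h a b" for b
  proof -
    have "west_pair (a i) (b i) (a (Suc i)) (b (Suc i))" using west_step_pair[OF that, of i "Suc i"] i by simp
    moreover have "b i \<le> a i \<and> b (Suc i) \<le> a (Suc i)" using that i unfolding west_step_def by simp
    ultimately show ?thesis using True by (simp add: west_pair_def)
  qed
  show ?thesis unfolding s
  proof (rule sum.reindex_bij_witness[where i = "sort_pair i" and j = "west_unsort i (a (Suc i))"])
    fix b assume b: "b \<in> {b. west_step l h (swap_comp i a) b}"
    then have b': "b i \<le> a (Suc i) \<and> a (Suc i) \<le> b (Suc i) \<and> b (Suc i) \<le> a i
        \<and> west_step l h a (west_unsort i (a (Suc i)) b)"
      using west_step_sorted_iff[where a = a, OF i True] by auto
    then show "west_unsort i (a (Suc i)) b \<in> {b. west_step l h a b}" by simp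
    show "sort_pair i (west_unsort i (a (Suc i)) b) = b"
      using b' by (auto simp: sort_pair_def west_unsort_def)
    then show "f (sort_pair i (west_unsort i (a (Suc i)) b)) = f b" by simp
  next
    fix b assume b: "b \<in> {b. west_step l h a b}"
    then have r: "b i \<le> a i \<and> b (Suc i) \<le> a (Suc i) \<and> (b i \<le> a (Suc i) \<longrightarrow> b (Suc i) = a (Suc i))"
      using rng by auto
    then show u: "west_unsort i (a (Suc i)) (sort_pair i b) = b"
      by (auto simp: sort_pair_def west_unsort_def)
    show "sort_pair i b \<in> {b. west_step l h (swap_comp i a) b}"
    proof -
      have "sort_pair i b i \<le> a (Suc i) \<and> a (Suc i) \<le> sort_pair i b (Suc i) \<and> sort_pair i b (Suc i) \<le> a i"
        using r True by (cases "b (Suc i) < b i") (auto simp: sort_pair_def)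
      moreover have "west_step l h a (west_unsort i (a (Suc i)) (sort_pair i b))" using b u by simp
      ultimately show ?thesis by (simp add: west_step_sorted_iff[where a = a, OF i True])
    qed
  qed
next
  case False
  have "sort_pair i b = b" if b: "west_step l h a b" for b
  proof -
    have "west_pair (a i) (b i) (a (Suc i)) (b (Suc i))" using west_step_pair[OF b, of i "Suc i"] i by simp
    moreover have "b i \<le> a i" using b i unfolding west_step_def by simp
    ultimately show ?thesis using False by (simp add: west_pair_def sort_pair_def)
  qed
  then show ?thesis using False by (simp add: sort_pair_def[of i a])
qed

section \<open>Key polynomials as row sums\<close>

lemma tr_tr [simp]: "tr i (tr i k) = k"
  by (simp add: tr_def)

lemma lookup_swap_mono [simp]: "Poly_Mapping.lookup (swap_mono i m) k = Poly_Mapping.lookup m (tr i k)"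
proof -
  have "inj (tr i)" by (rule inj_on_inverseI[where g = "tr i"]) simp
  then have "finite (tr i -` {k. Poly_Mapping.lookup m k \<noteq> 0})" by (intro finite_vimageI) simp_all
  then show ?thesis unfolding swap_mono_def by (simp add: vimage_def)
qed

lemma swap_mono_swap_mono [simp]: "swap_mono i (swap_mono i m) = m"
  by (rule poly_mapping_eqI) simp

lemma swap_mono_add: "swap_mono i (m + m') = swap_mono i m + swap_mono i m'"
  by (rule poly_mapping_eqI) (simp add: lookup_add)

lemma lookup_swap_vars [simp]: "Poly_Mapping.lookup (swap_vars i f) m = Poly_Mapping.lookup f (swap_mono i m)"
proof -
  have "inj (swap_mono i)" by (rule inj_on_inverseI[where g = "swap_mono i"]) simp
  then have "finite (swap_mono i -` {m. Poly_Mapping.lookup f m \<noteq> 0})" by (intro finite_vimageI) simp_all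
  then show ?thesis unfolding swap_vars_def by (simp add: vimage_def)
qed

lemma swap_vars_add: "swap_vars i (f + g) = swap_vars i f + swap_vars i g"
  by (rule poly_mapping_eqI) (simp add: lookup_add)

lemma swap_vars_diff: "swap_vars i (f - g) = swap_vars i f - swap_vars i g"
  by (rule poly_mapping_eqI) (simp add: lookup_minus)

lemma swap_vars_0 [simp]: "swap_vars i 0 = 0"
  by (rule poly_mapping_eqI) simp

lemma swap_vars_sum: "swap_vars i (sum f A) = (\<Sum>x\<in>A. swap_vars i (f x))"
  by (induction A rule: infinite_finite_induct) (simp_all add: swap_vars_add)

lemma swap_vars_single: "swap_vars i (Poly_Mapping.single m c) = Poly_Mapping.single (swap_mono i m) c"
  by (rule poly_mapping_eqI) (auto simp: lookup_single when_def)

text \<open>Polynomials form the free abelian group on monomials, so \<open>frag_induction\<close>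
  in each factor leaves only products of two monomials.\<close>

lemma swap_vars_mult: "swap_vars i (f * g) = swap_vars i f * swap_vars i g"
proof -
  have frag: "swap_vars i (frag_of m * g) = swap_vars i (frag_of m) * swap_vars i g" for m g
  proof -
    have "Poly_Mapping.keys g \<subseteq> UNIV" by simp
    then show ?thesis
      by (induction g rule: frag_induction)
        (simp_all add: mult_single swap_vars_single swap_mono_add swap_vars_diff right_diff_distrib)
  qed
  have "Poly_Mapping.keys f \<subseteq> UNIV" by simp
  then show ?thesis
    by (induction f rule: frag_induction) (simp_all add: frag swap_vars_diff left_diff_distrib)
qed

lemma swap_vars_1: "swap_vars i 1 = 1"
proof -
  have "swap_mono i 0 = 0" by (rule poly_mapping_eqI) simp
  then show ?thesis using swap_vars_single[of i 0 1] by simp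
qed

lemma swap_vars_power: "swap_vars i (f ^ k) = swap_vars i f ^ k"
  by (induction k) (simp_all add: swap_vars_1 swap_vars_mult)

lemma swap_vars_var: "swap_vars i (var k) = var (tr i k)"
proof -
  have "swap_mono i (Poly_Mapping.single k 1) = Poly_Mapping.single (tr i k) 1"
    by (rule poly_mapping_eqI) (auto simp: lookup_single when_def tr_def)
  then show ?thesis unfolding var_def swap_vars_single by simp
qed

lemma var_diff_nonzero: "i \<noteq> j \<Longrightarrow> var i - var j \<noteq> 0"
  by (metis var_def lookup_single_eq lookup_single_not_eq right_minus_eq zero_neq_one)

text \<open>The defining equation as a relation: it is linear at once, whereas the description
  \<open>demazure\<close> is informative only where a quotient is known to exist.\<close>

definition is_demazure :: "nat \<Rightarrow> mpoly \<Rightarrow> mpoly \<Rightarrow> bool" where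
  "is_demazure i f g \<longleftrightarrow> (var i - var (Suc i)) * g = var i * f - var (Suc i) * swap_vars i f"

lemma demazure_eqI: "is_demazure i f g \<Longrightarrow> demazure i f = g"
  unfolding demazure_def is_demazure_def
  using var_diff_nonzero[of i "Suc i"] by (intro the_equality) (auto, metis mult_left_cancel right_minus_eq)

lemma is_demazure_sum:
  assumes "\<And>x. x \<in> A \<Longrightarrow> is_demazure i (f x) (g x)" "\<And>x. x \<in> A \<Longrightarrow> swap_vars i (c x) = c x"
  shows "is_demazure i (\<Sum>x\<in>A. c x * f x) (\<Sum>x\<in>A. c x * g x)"
proof -
  have "(var i - var (Suc i)) * (c x * g x) = var i * (c x * f x) - var (Suc i) * swap_vars i (c x * f x)"
    if "x \<in> A" for x
  proof -
    have "(var i - var (Suc i)) * (c x * g x) = c x * ((var i - var (Suc i)) * g x)" by (simp add: mult_ac)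
    also have "\<dots> = c x * (var i * f x - var (Suc i) * swap_vars i (f x))"
      using assms(1)[OF that] by (simp add: is_demazure_def)
    finally show ?thesis using assms(2)[OF that] by (simp add: swap_vars_mult algebra_simps)
  qed
  then show ?thesis
    unfolding is_demazure_def swap_vars_sum sum_distrib_left sum_subtractf[symmetric]
    by (intro sum.cong) auto
qed

text \<open>The sum is \<open>(x * y) ^ (q - 1)\<close> times the complete homogeneous polynomial of
  degree \<open>p - q\<close> in two variables, so this is the factorisation of a difference of
  powers.\<close>

lemma complete_sum_telescope:
  fixes x y :: "'a :: comm_ring_1"
  assumes "1 \<le> q" "q \<le> p"
  shows "(x - y) * (\<Sum>v=q..p. y ^ (p + q - v - 1) * x ^ (v - 1)) = x ^ p * y ^ (q - 1) - x ^ (q - 1) * y ^ p"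
proof -
  have "(\<Sum>v=q..p. y ^ (p + q - v - 1) * x ^ (v - 1))
      = (\<Sum>k<Suc (p - q). x ^ (q - 1) * y ^ (q - 1) * (x ^ k * y ^ (p - q - k)))"
  proof (rule sum.reindex_bij_witness[where i = "\<lambda>k. q + k" and j = "\<lambda>v. v - q"])
    fix v assume v: "v \<in> {q..p}"
    then have "v - 1 = (q - 1) + (v - q)" "p + q - v - 1 = (q - 1) + (p - q - (v - q))" using assms by auto
    then show "x ^ (q - 1) * y ^ (q - 1) * (x ^ (v - q) * y ^ (p - q - (v - q))) = y ^ (p + q - v - 1) * x ^ (v - 1)"
      by (simp only: power_add mult_ac)
  qed (use assms in auto)
  also have "\<dots> = x ^ (q - 1) * y ^ (q - 1) * (\<Sum>k<Suc (p - q). x ^ k * y ^ (p - q - k))"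
    by (simp only: sum_distrib_left)
  finally have "(x - y) * (\<Sum>v=q..p. y ^ (p + q - v - 1) * x ^ (v - 1))
      = x ^ (q - 1) * y ^ (q - 1) * ((x - y) * (\<Sum>k<Suc (p - q). x ^ k * y ^ (p - q - k)))"
    by (simp add: mult_ac)
  also have "(x - y) * (\<Sum>k<Suc (p - q). x ^ k * y ^ (p - q - k)) = x ^ Suc (p - q) - y ^ Suc (p - q)"
    using diff_power_eq_sum[of x "p - q" y] by simp
  also have "x ^ (q - 1) * y ^ (q - 1) * (x ^ Suc (p - q) - y ^ Suc (p - q))
      = x ^ ((q - 1) + Suc (p - q)) * y ^ (q - 1) - x ^ (q - 1) * y ^ ((q - 1) + Suc (p - q))"
    by (simp only: power_add right_diff_distrib mult_ac)
  also have "(q - 1) + Suc (p - q) = p" using assms by simp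
  finally show ?thesis .
qed

section \<open>Independence of the row types\<close>

lemma row_sum_W_single:
  assumes "live N l l s"
  shows "row_sum N [W] l l s = var l ^ (s l - 1)"
proof -
  have "{b. west_step l l s b} = {s(l := 0)}"
    unfolding west_step_def by (auto simp: fun_eq_iff)
  then show ?thesis by simp
qed

lemma row_sum_E_single:
  assumes "live N l l s"
  shows "row_sum N [E] l l s = var l ^ (s l - 1)"
proof -
  have s: "1 \<le> s l" "s l \<le> N + 1" using assms by (auto simp: live_def)
  have "{b. east_step N l l s b} = {s(l := N + 2)}"
    using s unfolding east_step_def by (auto simp: fun_eq_iff)
  moreover have "N + 1 - (N + 2 - s l) = s l - 1" using s by simp
  ultimately show ?thesis by simp
qed

text \<open>The west row sinks below the east rows one at a time by \<open>row_sum_commute\<close>.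
  At the bottom a single colour is left, and there both types have the same weight.\<close>

lemma row_sum_W_replicate_E:
  assumes "1 \<le> l" "live N l (l + k) s"
  shows "row_sum N (W # replicate k E) l (l + k) s = row_sum N (replicate (Suc k) E) l (l + k) s"
  using assms(2)
proof (induction k arbitrary: s)
  case 0
  then show ?case using row_sum_W_single[of N l s] row_sum_E_single[of N l s] by simp
next
  case (Suc k)
  have "row_sum N (W # replicate (Suc k) E) l (l + Suc k) s = row_sum N (E # W # replicate k E) l (l + Suc k) s"
    using row_sum_commute[OF assms(1) _ Suc.prems] by simp
  also have "\<dots> = (\<Sum>b | east_step N l (l + Suc k) s b.
      var (l + Suc k) ^ (N + 1 - (sum b {l..l + Suc k} - sum s {l..l + Suc k})) * row_sum N (W # replicate k E) l (l + k) b)"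
    by simp
  also have "\<dots> = (\<Sum>b | east_step N l (l + Suc k) s b.
      var (l + Suc k) ^ (N + 1 - (sum b {l..l + Suc k} - sum s {l..l + Suc k})) * row_sum N (replicate (Suc k) E) l (l + k) b)"
    using Suc.IH east_step_live[OF _ Suc.prems _ assms(1)] by (intro sum.cong) auto
  also have "\<dots> = row_sum N (replicate (Suc (Suc k)) E) l (l + Suc k) s" by simp
  finally show ?case .
qed

lemma row_sum_eq_replicate_E:
  assumes "1 \<le> l" "live N l h s" "length ds = Suc h - l"
  shows "row_sum N ds l h s = row_sum N (replicate (Suc h - l) E) l h s"
  using assms
proof (induction ds arbitrary: l h s)
  case (Cons d ds)
  then have lh: "l \<le> h" by auto
  then obtain k where k: "h = l + k" using le_Suc_ex by blast
  have r: "replicate (Suc h - l) E = E # replicate k E" using k by simp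
  show ?case
  proof (cases d)
    case W
    have "row_sum N ds (Suc l) h b = row_sum N (replicate k E) (Suc l) h b" if "west_step l h s b" for b
      using Cons.IH[of "Suc l" h b] west_step_live[OF that Cons.prems(2) lh] Cons.prems k by simp
    then have "row_sum N (d # ds) l h s = row_sum N (W # replicate k E) l h s" using W by simp
    also have "\<dots> = row_sum N (replicate (Suc h - l) E) l h s"
      using row_sum_W_replicate_E[of l N k s] Cons.prems k by simp
    finally show ?thesis .
  next
    case E
    have "row_sum N ds l (h - 1) b = row_sum N (replicate k E) l (h - 1) b" if "east_step N l h s b" for b
      using Cons.IH[of l "h - 1" b] east_step_live[OF that Cons.prems(2) lh Cons.prems(1)] Cons.prems k by simp
    then show ?thesis using E unfolding r by simp
  qed
qed simp

corollary row_sum_independent: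
  assumes "1 \<le> l" "live N l h s" "length ds = Suc h - l" "length ds' = Suc h - l"
  shows "row_sum N ds l h s = row_sum N ds' l h s"
  using row_sum_eq_replicate_E[OF assms(1-3)] row_sum_eq_replicate_E[OF assms(1,2,4)] by simp

section \<open>The Demazure operator on row sums\<close>

lemma row_sum_two_rows:
  assumes "1 \<le> l" "live N l (Suc l) s"
  shows "row_sum N [E, E] l (Suc l) s =
    (\<Sum>v\<in>(if s l \<le> s (Suc l) then {s l..s (Suc l)} else {s l}).
       var (Suc l) ^ (s l + s (Suc l) - v - 1) * var l ^ (v - 1))"
proof -
  let ?V = "if s l \<le> s (Suc l) then {s l..s (Suc l)} else {s l}"
  let ?u = "\<lambda>v. s(l := v, Suc l := N + 2)"
  have s: "1 \<le> s l" "s l \<le> N + 1" "1 \<le> s (Suc l)" "s (Suc l) \<le> N + 1" using assms by (auto simp: live_def)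
  have A: "{l..Suc l} = {l, Suc l}" by auto
  \<comment> \<open>The upper row sends \<open>Suc l\<close> out on the right, so the floor
    \<open>v\<close> of \<open>l\<close> is the only freedom. It may lie anywhere up to the ceiling
    of \<open>Suc l\<close> if that is not to its left; otherwise the run of \<open>Suc l\<close>
    passes \<open>l\<close> and forces it straight down.\<close>
  have set: "{b. east_step N l (Suc l) s b} = ?u ` ?V"
  proof (intro equalityI subsetI)
    fix b assume b: "b \<in> {b. east_step N l (Suc l) s b}"
    then have "b = ?u (b l)" unfolding east_step_def A by (auto simp: fun_eq_iff)
    moreover have "b l \<in> ?V"
      using b s unfolding east_step_def A east_pair_def by (auto split: if_splits)
    ultimately show "b \<in> ?u ` ?V" by blast
  next
    fix b assume "b \<in> ?u ` ?V"
    then show "b \<in> {b. east_step N l (Suc l) s b}"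
      using s unfolding east_step_def A east_pair_def by (auto split: if_splits)
  qed
  have inj: "inj_on ?u ?V" by (auto simp: inj_on_def fun_eq_iff split: if_splits)
  have "row_sum N [E, E] l (Suc l) s = (\<Sum>b | east_step N l (Suc l) s b.
      var (Suc l) ^ (N + 1 - (sum b {l..Suc l} - sum s {l..Suc l})) * row_sum N [E] l l b)" by simp
  also have "\<dots> = (\<Sum>v\<in>?V. var (Suc l) ^ (N + 1 - (sum (?u v) {l..Suc l} - sum s {l..Suc l})) * row_sum N [E] l l (?u v))"
    unfolding set by (subst sum.reindex[OF inj]) (simp only: comp_def)
  also have "\<dots> = (\<Sum>v\<in>?V. var (Suc l) ^ (s l + s (Suc l) - v - 1) * var l ^ (v - 1))"
  proof (rule sum.cong[OF refl])
    fix v assume v: "v \<in> ?V"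
    then have v': "1 \<le> v" "v \<le> N + 1" "s l \<le> v" "v < s l + s (Suc l)" using s by (auto split: if_splits)
    then have "row_sum N [E] l l (?u v) = var l ^ (v - 1)" using row_sum_E_single[of N l "?u v"] by (simp add: live_def)
    moreover have "N + 1 - (sum (?u v) {l..Suc l} - sum s {l..Suc l}) = s l + s (Suc l) - v - 1"
      using v' s unfolding A by simp
    ultimately show "var (Suc l) ^ (N + 1 - (sum (?u v) {l..Suc l} - sum s {l..Suc l})) * row_sum N [E] l l (?u v)
        = var (Suc l) ^ (s l + s (Suc l) - v - 1) * var l ^ (v - 1)" by simp
  qed
  finally show ?thesis .
qed

text \<open>A descent gives a monomial, and its image is the complete sum by telescoping. Otherwise
  the sum is already symmetric in the two variables, and the operator fixes symmetric
  polynomials.\<close>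

lemma is_demazure_two_rows:
  assumes "1 \<le> l" "live N l (Suc l) s"
  shows "is_demazure l (row_sum N [E, E] l (Suc l) s) (row_sum N [E, E] l (Suc l) (sort_pair l s))"
proof -
  let ?x = "var l" and ?y = "var (Suc l)"
  have s: "1 \<le> s l" "1 \<le> s (Suc l)" using assms by (auto simp: live_def)
  have sw: "swap_vars l ?x = ?y" "swap_vars l ?y = ?x" by (simp_all add: swap_vars_var tr_def)
  have lv: "live N l (Suc l) (sort_pair l s)" by (rule live_sort_pair) (use assms in auto)
  show ?thesis
  proof (cases "s (Suc l) < s l")
    case True
    then have "row_sum N [E, E] l (Suc l) s = ?y ^ (s (Suc l) - 1) * ?x ^ (s l - 1)"
      using row_sum_two_rows[OF assms] by simp
    moreover have "row_sum N [E, E] l (Suc l) (sort_pair l s)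
        = (\<Sum>v=s (Suc l)..s l. ?y ^ (s l + s (Suc l) - v - 1) * ?x ^ (v - 1))"
      using row_sum_two_rows[OF assms(1) lv] True by (simp add: sort_pair_def add.commute)
    moreover have "?x ^ s l = ?x * ?x ^ (s l - 1)" "?y ^ s l = ?y * ?y ^ (s l - 1)"
      using s by (simp_all add: power_eq_if)
    ultimately show ?thesis
      using complete_sum_telescope[of "s (Suc l)" "s l" ?x ?y] True s
      unfolding is_demazure_def by (simp only: swap_vars_mult swap_vars_power sw mult_ac)
  next
    case False
    let ?H = "\<Sum>v=s l..s (Suc l). ?y ^ (s l + s (Suc l) - v - 1) * ?x ^ (v - 1)"
    have H: "row_sum N [E, E] l (Suc l) s = ?H" using row_sum_two_rows[OF assms] False by simp
    have "swap_vars l ?H = (\<Sum>v=s l..s (Suc l). ?x ^ (s l + s (Suc l) - v - 1) * ?y ^ (v - 1))"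
      by (simp add: swap_vars_sum swap_vars_mult swap_vars_power sw)
    also have "\<dots> = ?H"
      by (rule sum.reindex_bij_witness[where i = "\<lambda>v. s l + s (Suc l) - v" and j = "\<lambda>v. s l + s (Suc l) - v"])
        (auto simp: mult.commute)
    finally show ?thesis using False H by (simp add: is_demazure_def sort_pair_def left_diff_distrib)
  qed
qed

text \<open>Induction on the number of colours present. Independence of the row types is used afresh
  at each stage, to put on top a row that removes a colour other than \<open>i\<close> and
  \<open>i + 1\<close>; its variable is fixed by the exchange and passes through the
  operator.\<close>

theorem is_demazure_row_sum:
  assumes "1 \<le> l" "l \<le> i" "i < h" "live N l h s" "length ds = Suc h - l"
  shows "is_demazure i (row_sum N ds l h s) (row_sum N ds l h (sort_pair i s))"
  using assms
proof (induction "h - l" arbitrary: l h s ds rule: less_induct)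
  case less
  note p = less.prems
  have lv: "live N l h (sort_pair i s)" by (rule live_sort_pair) (use p in auto)
  have sm: "sum (sort_pair i t) {l..h} = sum t {l..h}" for t by (rule sum_sort_pair) (use p in auto)
  consider "l < i" | "l = i" "Suc i < h" | "l = i" "h = Suc i" using p by linarith
  then show ?case
  proof cases
    case 1
    define es where "es = replicate (h - l) E"
    have "length (W # es) = Suc h - l" using p by (simp add: es_def)
    note eq = row_sum_independent[OF p(1) _ p(5) this]
    have "is_demazure i (row_sum N es (Suc l) h b) (row_sum N es (Suc l) h (sort_pair i b))" if "west_step l h s b" for b
      using less.hyps[of h "Suc l" b es] west_step_live[OF that p(4)] 1 p by (simp add: es_def)
    then have "is_demazure i
        (\<Sum>b | west_step l h s b. var l ^ (sum s {l..h} - sum b {l..h} - 1) * row_sum N es (Suc l) h b)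
        (\<Sum>b | west_step l h s b. var l ^ (sum s {l..h} - sum b {l..h} - 1) * row_sum N es (Suc l) h (sort_pair i b))"
      using 1 by (intro is_demazure_sum) (auto simp: swap_vars_power swap_vars_var tr_def)
    moreover have "row_sum N (W # es) l h (sort_pair i s)
        = (\<Sum>b | west_step l h s b. var l ^ (sum s {l..h} - sum b {l..h} - 1) * row_sum N es (Suc l) h (sort_pair i b))"
      using sum_west_step_sort_pair[of l i h, where a = s and f = "\<lambda>b. var l ^ (sum s {l..h} - sum b {l..h} - 1) * row_sum N es (Suc l) h b"] 1 p
      by (simp add: sm)
    ultimately show ?thesis unfolding eq[OF p(4)] eq[OF lv] by simp
  next
    case 2
    define es where "es = replicate (h - l) E"
    have "length (E # es) = Suc h - l" using p by (simp add: es_def)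
    note eq = row_sum_independent[OF p(1) _ p(5) this]
    have "is_demazure i (row_sum N es l (h - 1) b) (row_sum N es l (h - 1) (sort_pair i b))" if "east_step N l h s b" for b
      using less.hyps[of "h - 1" l b es] east_step_live[OF that p(4) _ p(1)] 2 p by (simp add: es_def)
    then have "is_demazure i
        (\<Sum>b | east_step N l h s b. var h ^ (N + 1 - (sum b {l..h} - sum s {l..h})) * row_sum N es l (h - 1) b)
        (\<Sum>b | east_step N l h s b. var h ^ (N + 1 - (sum b {l..h} - sum s {l..h})) * row_sum N es l (h - 1) (sort_pair i b))"
      using 2 by (intro is_demazure_sum) (auto simp: swap_vars_power swap_vars_var tr_def)
    moreover have "row_sum N (E # es) l h (sort_pair i s)
        = (\<Sum>b | east_step N l h s b. var h ^ (N + 1 - (sum b {l..h} - sum s {l..h})) * row_sum N es l (h - 1) (sort_pair i b))"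
      using sum_east_step_sort_pair[of l i h, where N = N and a = s and f = "\<lambda>b. var h ^ (N + 1 - (sum b {l..h} - sum s {l..h})) * row_sum N es l (h - 1) b"] 2 p
      by (simp add: sm[unfolded 2(1)])
    ultimately show ?thesis unfolding eq[OF p(4)] eq[OF lv] by simp
  next
    case 3
    then have "length [E, E] = Suc h - l" by simp
    note eq = row_sum_independent[OF p(1) _ p(5) this]
    show ?thesis unfolding eq[OF p(4)] eq[OF lv] using is_demazure_two_rows[of l N s] 3 p by (simp only:)
  qed
qed

lemma row_sum_dominant:
  assumes "1 \<le> l" "live N l h s" "length ds = Suc h - l" "\<And>i. l \<le> i \<Longrightarrow> i < h \<Longrightarrow> s (Suc i) \<le> s i"
  shows "row_sum N ds l h s = (\<Prod>i\<in>{l..h}. var i ^ (s i - 1))"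
proof -
  have "row_sum N (replicate k E) l h s = (\<Prod>i\<in>{l..h}. var i ^ (s i - 1))"
    if "live N l h s" "k = Suc h - l" "\<And>i. l \<le> i \<Longrightarrow> i < h \<Longrightarrow> s (Suc i) \<le> s i" for k s h
    using that
  proof (induction k arbitrary: h s)
    case (Suc k)
    then have lh: "l \<le> h" by simp
    have s: "1 \<le> s h" "s h \<le> N + 1" using Suc.prems(1) lh by (auto simp: live_def)
    have ge: "s j \<le> s i" if "l \<le> i" "i \<le> j" "j \<le> h" for i j
      using that(2,1,3)
    proof (induction j rule: dec_induct)
      case (step m)
      then show ?case using Suc.prems(3)[of m] by force
    qed simp
    let ?b = "s(h := N + 2)"
    have set: "{b. east_step N l h s b} = {?b}"
    proof (intro equalityI subsetI)
      fix b assume "b \<in> {b. east_step N l h s b}"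
      then have b: "east_step N l h s b" by simp
      \<comment> \<open>The run of \<open>h\<close> starts at the leftmost ceiling and extends to
        the right boundary. Colours whose ceilings it passes must go straight down; one in the same
        column precedes \<open>h\<close> there and would run into its start.\<close>
      have "b i = s i" if "l \<le> i" "i < h" for i
      proof -
        have "east_pair (s i) (b i) (s h) (N + 2)"
          using east_step_pair[OF b that] b unfolding east_step_def by simp
        moreover have "s i \<le> b i" using b that unfolding east_step_def by simp
        moreover have "s i \<le> N + 1" using Suc.prems(1) that by (auto simp: live_def)
        ultimately show ?thesis using ge[of i h] that unfolding east_pair_def by (cases "s i = s h") auto
      qed
      then have "b i = ?b i" for i
        using b unfolding east_step_def by (cases "i = h"; cases "i \<in> {l..h}") auto
      then have "b = ?b" by (rule ext)
      then show "b \<in> {?b}" by simp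
    next
      fix b assume "b \<in> {?b}"
      moreover have "east_step N l h s ?b"
      proof -
        have "east_pair (s i) (?b i) (s j) (?b j)" if "i < j" "j \<le> h" for i j
          using that by (simp add: east_pair_def)
        then show ?thesis using s lh unfolding east_step_def by simp
      qed
      ultimately show "b \<in> {b. east_step N l h s b}" by simp
    qed
    have sp: "{l..h} = insert h {l..h - 1}" "h \<notin> {l..h - 1}" using lh assms(1) by auto
    have "sum ?b {l..h - 1} = sum s {l..h - 1}" using sp(2) by (intro sum.cong) auto
    then have "sum ?b {l..h} = N + 2 + sum s {l..h - 1}" "sum s {l..h} = s h + sum s {l..h - 1}"
      unfolding sp(1) using sp(2) by simp_all
    then have ex: "N + 1 - (sum ?b {l..h} - sum s {l..h}) = s h - 1" using s by simp
    have rest: "row_sum N (replicate k E) l (h - 1) ?b = (\<Prod>i\<in>{l..h - 1}. var i ^ (s i - 1))"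
    proof -
      have lv: "live N l (h - 1) ?b" using Suc.prems(1) sp(2) by (auto simp: live_def)
      have k: "k = Suc (h - 1) - l" using Suc.prems(2) lh assms(1) by simp
      have "?b (Suc i) \<le> ?b i" if "l \<le> i" "i < h - 1" for i
        using Suc.prems(3)[of i] that by auto
      from Suc.IH[OF lv k this]
      have "row_sum N (replicate k E) l (h - 1) ?b = (\<Prod>i\<in>{l..h - 1}. var i ^ (?b i - 1))" .
      also have "\<dots> = (\<Prod>i\<in>{l..h - 1}. var i ^ (s i - 1))" using sp(2) by (intro prod.cong) auto
      finally show ?thesis .
    qed
    have "row_sum N (replicate (Suc k) E) l h s
        = var h ^ (N + 1 - (sum ?b {l..h} - sum s {l..h})) * row_sum N (replicate k E) l (h - 1) ?b"
      unfolding replicate_Suc row_sum.simps set by simp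
    also have "\<dots> = var h ^ (s h - 1) * (\<Prod>i\<in>{l..h - 1}. var i ^ (s i - 1))"
      unfolding ex rest ..
    also have "\<dots> = (\<Prod>i\<in>{l..h}. var i ^ (s i - 1))"
      unfolding sp(1) using sp(2) by simp
    finally show ?case .
  qed simp
  from this[OF assms(2) refl assms(4)] show ?thesis unfolding row_sum_eq_replicate_E[OF assms(1-3)] by simp
qed

section \<open>Key polynomials and their well-definedness\<close>

lemma key_rel_row_sum:
  assumes "key_rel n a f" "\<forall>i\<in>{1..n}. a i \<le> N" "length ds = n"
  shows "f = row_sum N ds 1 n (\<lambda>i. a i + 1)"
  using assms
proof (induction rule: key_rel.induct)
  case (dominant a)
  then have "row_sum N ds 1 n (\<lambda>i. a i + 1) = (\<Prod>i\<in>{1..n}. var i ^ (a i + 1 - 1))"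
    by (intro row_sum_dominant) (auto simp: live_def)
  then show ?case by (simp add: monomial_of_def)
next
  case (step i a g)
  have b: "\<forall>j\<in>{1..n}. swap_comp i a j \<le> N"
    using step.prems(1) step.hyps(1,2) by (auto simp: swap_comp_def tr_def)
  let ?s = "\<lambda>j. swap_comp i a j + 1"
  \<comment> \<open>Since \<open>a\<close> has an ascent at \<open>i\<close>, sorting its exchange
    recovers it.\<close>
  have "sort_pair i ?s = (\<lambda>j. a j + 1)"
    using step.hyps(3) by (auto simp: sort_pair_def swap_comp_def tr_def fun_eq_iff)
  moreover have "is_demazure i (row_sum N ds 1 n ?s) (row_sum N ds 1 n (sort_pair i ?s))"
    by (rule is_demazure_row_sum) (use step.hyps step.prems b in \<open>auto simp: live_def\<close>)
  ultimately show ?case using step.IH[OF b step.prems(2)] demazure_eqI by simp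
qed

text \<open>Exchanging an ascent lowers the sum of all \<open>i * a i\<close> by
  \<open>a (Suc i) - a i\<close>, so repeated exchanges end in a dominant composition.\<close>

lemma key_rel_exists: "\<exists>f. key_rel n a f"
proof (induction "\<Sum>i\<in>{1..n}. i * a i" arbitrary: a rule: less_induct)
  case less
  show ?case
  proof (cases "\<forall>i. 1 \<le> i \<and> i < n \<longrightarrow> a (Suc i) \<le> a i")
    case True
    then show ?thesis using key_rel.dominant[OF True] by blast
  next
    case False
    then obtain i where i: "1 \<le> i" "i < n" "a i < a (Suc i)" by auto
    have sp: "sum f {1..n} = sum f ({1..n} - {i, Suc i}) + (f i + f (Suc i))" for f :: "nat \<Rightarrow> nat"
      using i sum.subset_diff[of "{i, Suc i}" "{1..n}" f] by simp
    have "(\<Sum>j\<in>{1..n} - {i, Suc i}. j * swap_comp i a j) = (\<Sum>j\<in>{1..n} - {i, Suc i}. j * a j)"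
      by (intro sum.cong) auto
    then have "(\<Sum>j\<in>{1..n}. j * swap_comp i a j) < (\<Sum>j\<in>{1..n}. j * a j)"
      unfolding sp[of "\<lambda>j. j * swap_comp i a j"] sp[of "\<lambda>j. j * a j"] using i by (simp add: algebra_simps)
    then obtain g where "key_rel n (swap_comp i a) g" using less.hyps by blast
    then show ?thesis using key_rel.step[OF i] by blast
  qed
qed

text \<open>For fixed \<open>N\<close> and \<open>ds\<close> the row sum depends on \<open>a\<close>
  alone, which supplies the uniqueness that the description in \<open>key\<close> requires.\<close>

theorem key_eq_row_sum:
  assumes "\<forall>i\<in>{1..n}. a i \<le> N" "length ds = n"
  shows "key n a = row_sum N ds 1 n (\<lambda>i. a i + 1)"
proof -
  obtain f where "key_rel n a f" using key_rel_exists by blast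
  then show ?thesis
    unfolding key_def using key_rel_row_sum[OF _ assms] by (metis (mono_tags, lifting) the_equality)
qed

section \<open>Fillings of a single row\<close>

text \<open>Index 0 is the left wall of the tile, so the walls of a row are scanned along pairs
  \<open>(c, k)\<close>; the right wall of column \<open>c\<close> and the left wall of the next one
  are \<open>(c, n)\<close> and \<open>(Suc c, 0)\<close>.\<close>

definition wall :: "dir \<Rightarrow> (nat \<Rightarrow> tile) \<Rightarrow> nat \<Rightarrow> nat \<Rightarrow> nat option" where
  "wall d G c k = (if k = 0 then pleft d (G c 1) else pright d (G c k))"

definition row_frame :: "nat \<Rightarrow> nat \<Rightarrow> dir \<Rightarrow> nat \<Rightarrow> (nat \<Rightarrow> tile) \<Rightarrow> bool" where
  "row_frame n N d lab G \<longleftrightarrow>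
     (\<forall>c j. \<not> (c \<le> N \<and> j \<in> {1..n}) \<longrightarrow> G c j = Empty)
   \<and> (\<forall>c\<le>N. valid_tile n d (G c))
   \<and> (\<forall>c<N. tile_right n d (G c) = tile_left d (G (Suc c)))
   \<and> tile_left d (G 0) = (if d = W then Some lab else None)
   \<and> tile_right n d (G N) = (if d = E then Some lab else None)"

definition has_ceils :: "nat \<Rightarrow> nat \<Rightarrow> dir \<Rightarrow> (nat \<Rightarrow> tile) \<Rightarrow> (nat \<Rightarrow> nat) \<Rightarrow> bool" where
  "has_ceils n N d G s \<longleftrightarrow> (\<forall>c\<le>N. \<forall>j\<in>{1..n}. pceil d (G c j) = (if s j = Suc c then Some j else None))"

definition has_floors :: "nat \<Rightarrow> nat \<Rightarrow> dir \<Rightarrow> (nat \<Rightarrow> tile) \<Rightarrow> (nat \<Rightarrow> nat) \<Rightarrow> bool" where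
  "has_floors n N d G b \<longleftrightarrow> (\<forall>c\<le>N. \<forall>j\<in>{1..n}. pfloor d (G c j) = (if b j = Suc c then Some j else None))"

text \<open>Runs are read from left to right: they begin at the ceiling in an east row and at the
  floor in a west row. A vertical pipe, crossed or not, counts as beginning and ending at once,
  which makes both row types uniform.\<close>

definition starts :: "dir \<Rightarrow> piece \<Rightarrow> bool" where
  "starts d p \<longleftrightarrow> (if d = E then pceil d p else pfloor d p) \<noteq> None"

definition ends :: "dir \<Rightarrow> piece \<Rightarrow> bool" where
  "ends d p \<longleftrightarrow> (if d = E then pfloor d p else pceil d p) \<noteq> None"

definition passed :: "nat \<Rightarrow> nat \<Rightarrow> nat \<Rightarrow> nat set" where
  "passed i c k = {c'. c' < c \<or> c' = c \<and> i \<le> k}"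

text \<open>Because \<open>v\<close> is a shifted column, \<open>v = Suc c\<close> means column
  \<open>c\<close> itself, where sub-tile \<open>i\<close> precedes the wall \<open>k\<close> iff
  \<open>i \<le> k\<close>. The value 0 is reached from the outset, and \<open>N + 2\<close> is not
  reached within the grid.\<close>

definition reached :: "nat \<Rightarrow> nat \<Rightarrow> nat \<Rightarrow> nat \<Rightarrow> bool" where
  "reached v i c k \<longleftrightarrow> v \<le> c \<or> v = Suc c \<and> i \<le> k"

definition occupies :: "(nat \<Rightarrow> nat) \<Rightarrow> (nat \<Rightarrow> nat) \<Rightarrow> nat \<Rightarrow> nat \<Rightarrow> nat \<Rightarrow> bool" where
  "occupies P Q i c k \<longleftrightarrow> reached (P i) i c k \<and> \<not> reached (Q i) i c k"

lemma grid_induct: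
  assumes "P 0 0" "\<And>c k. c \<le> N \<Longrightarrow> k < n \<Longrightarrow> P c k \<Longrightarrow> P c (Suc k)" "\<And>c. c < N \<Longrightarrow> P c n \<Longrightarrow> P (Suc c) 0"
    and "c \<le> N" "k \<le> n"
  shows "P c k"
proof -
  have row: "P c k" if "P c 0" "c \<le> N" "k \<le> n" for c k
    using that(3) by (induction k) (use that(1,2) assms(2) in auto)
  have "P c 0" using assms(4) by (induction c) (use assms(1,3) row in auto)
  then show ?thesis using row assms(4,5) by simp
qed

lemma piece_balance:
  assumes "valid_piece n d j p"
  shows "of_bool (pright d p = Some i) + of_bool (i = j \<and> ends d p)
       = of_bool (pleft d p = Some i) + (of_bool (i = j \<and> starts d p) :: nat)"
  using assms by (cases p; cases d) (auto simp: valid_piece_def ends_def starts_def)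

lemma piece_eqI:
  assumes "pleft d p = pleft d q" "pright d p = pright d q" "pceil d p = pceil d q" "pfloor d p = pfloor d q"
  shows "p = q"
  using assms by (cases p; cases q; cases d) auto

lemma valid_piece_floor: "valid_piece n d j p \<Longrightarrow> pfloor d p = None \<or> pfloor d p = Some j"
  by (auto simp: valid_piece_def)

lemma valid_piece_crossing:
  assumes "valid_piece n d j p" "pceil d p \<noteq> None" "pfloor d p \<noteq> None" "pright d p = Some i"
  shows "if d = W then i < j else j < i"
  using assms by (cases p; cases d) (auto simp: valid_piece_def)

lemma row_frame_valid:
  "row_frame n N d lab G \<Longrightarrow> c \<le> N \<Longrightarrow> 1 \<le> j \<Longrightarrow> j \<le> n \<Longrightarrow> valid_piece n d j (G c j)"
  by (auto simp: row_frame_def valid_tile_def)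

lemma row_frame_left:
  assumes "row_frame n N d lab G" "c \<le> N" "k < n"
  shows "pleft d (G c (Suc k)) = wall d G c k"
proof (cases "k = 0")
  case False
  then have "pright d (G c k) = pleft d (G c (Suc k))"
    using assms unfolding row_frame_def valid_tile_def by simp
  then show ?thesis using False by (simp add: wall_def)
qed (simp add: wall_def)

lemma row_frame_next:
  assumes "row_frame n N d lab G" "c < N" "1 \<le> n"
  shows "wall d G (Suc c) 0 = wall d G c n"
proof -
  have "tile_right n d (G c) = tile_left d (G (Suc c))" using assms unfolding row_frame_def by blast
  then show ?thesis using assms(3) by (simp add: wall_def tile_right_def tile_left_def)
qed

lemma passed_0:
  "passed i 0 0 = {}" if "1 \<le> i"
  using that by (auto simp: passed_def)

lemma passed_Suc: "passed i c (Suc k) = (if i = Suc k then insert c (passed i c k) else passed i c k)"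
  by (auto simp: passed_def le_Suc_eq)

lemma passed_next: "1 \<le> i \<Longrightarrow> i \<le> n \<Longrightarrow> passed i (Suc c) 0 = passed i c n"
  by (auto simp: passed_def)

lemma finite_passed [simp]: "finite (passed i c k)"
  by (rule finite_subset[of _ "{..c}"]) (auto simp: passed_def)

text \<open>Conservation of pipes of colour \<open>i\<close>: this is what forces the floors of a row to be given by a
  function of the colour.\<close>

lemma wall_count:
  assumes G: "row_frame n N d lab G" and i: "1 \<le> i" "i \<le> n" and "c \<le> N" "k \<le> n"
  shows "of_bool (wall d G c k = Some i) + card {c' \<in> passed i c k. ends d (G c' i)}
       = of_bool (d = W \<and> i = lab) + card {c' \<in> passed i c k. starts d (G c' i)}"
proof -
  let ?I = "\<lambda>c k. of_bool (wall d G c k = Some i) + card {c' \<in> passed i c k. ends d (G c' i)}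
       = of_bool (d = W \<and> i = lab) + card {c' \<in> passed i c k. starts d (G c' i)}"
  show ?thesis
  proof (rule grid_induct[where P = ?I and N = N and n = n])
    have "wall d G 0 0 = (if d = W then Some lab else None)"
      using G by (simp add: row_frame_def wall_def tile_left_def)
    then show "?I 0 0" using passed_0[OF i(1)] by auto
  next
    fix c k assume 2: "c \<le> N" "k < n" "?I c k"
    have v: "valid_piece n d (Suc k) (G c (Suc k))" using row_frame_valid[OF G] 2 by simp
    have bal: "of_bool (wall d G c (Suc k) = Some i) + of_bool (i = Suc k \<and> ends d (G c i))
        = of_bool (wall d G c k = Some i) + (of_bool (i = Suc k \<and> starts d (G c i)) :: nat)"
    proof -
      have "wall d G c (Suc k) = pright d (G c (Suc k))" by (simp add: wall_def)
      then show ?thesis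
        using piece_balance[OF v, of i] unfolding row_frame_left[OF G 2(1,2)] by (cases "i = Suc k") simp_all
    qed
    have cd: "card {c' \<in> passed i c (Suc k). X (G c' i)} = card {c' \<in> passed i c k. X (G c' i)} + of_bool (i = Suc k \<and> X (G c i))"
      for X
    proof (cases "i = Suc k \<and> X (G c i)")
      case True
      then have "{c' \<in> passed i c (Suc k). X (G c' i)} = insert c {c' \<in> passed i c k. X (G c' i)}"
        by (auto simp: passed_Suc)
      moreover have "c \<notin> {c' \<in> passed i c k. X (G c' i)}" using True by (auto simp: passed_def)
      ultimately have e: "card {c' \<in> passed i c (Suc k). X (G c' i)} = Suc (card {c' \<in> passed i c k. X (G c' i)})"
        by simp
      show ?thesis unfolding e using True by auto
    next
      case False
      then have "{c' \<in> passed i c (Suc k). X (G c' i)} = {c' \<in> passed i c k. X (G c' i)}"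
        by (auto simp: passed_Suc)
      then show ?thesis using False by simp
    qed
    show "?I c (Suc k)" using bal 2(3) unfolding cd by linarith
  next
    fix c assume 3: "c < N" "?I c n"
    then show "?I (Suc c) 0" using row_frame_next[OF G] passed_next[OF i] i by simp
  qed (use assms in auto)
qed

lemma card_function_passed:
  assumes "v \<noteq> 0"
  shows "card {c' \<in> passed i c k. v = Suc c'} = of_bool (reached v i c k)"
proof -
  have "{c' \<in> passed i c k. v = Suc c'} = (if reached v i c k then {v - 1} else {})"
    using assms by (auto simp: passed_def reached_def)
  then show ?thesis by simp
qed

lemma passed_le: "c' \<in> passed i c k \<Longrightarrow> c' \<le> c"
  by (auto simp: passed_def)

text \<open>What validity of a row demands of its runs: a wall carries at most one pipe, and a run
  that crosses a vertical pipe, one with start and end in the same column, obeys the colour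
  order.\<close>

definition separated :: "nat \<Rightarrow> nat \<Rightarrow> dir \<Rightarrow> nat set \<Rightarrow> (nat \<Rightarrow> nat) \<Rightarrow> (nat \<Rightarrow> nat) \<Rightarrow> bool" where
  "separated n N d C P Q \<longleftrightarrow>
     (\<forall>c\<le>N. \<forall>k\<le>n. \<forall>i\<in>C. \<forall>j\<in>C. occupies P Q i c k \<longrightarrow> occupies P Q j c k \<longrightarrow> i = j)
   \<and> (\<forall>c\<le>N. \<forall>i\<in>C. \<forall>j\<in>C. P j = Suc c \<longrightarrow> Q j = Suc c \<longrightarrow> occupies P Q i c j \<longrightarrow> (if d = W then i < j else j < i))"

section \<open>Pair conditions and separated runs\<close>

lemma east_pairs_separated:
  assumes "\<And>i j. i \<in> C \<Longrightarrow> j \<in> C \<Longrightarrow> i < j \<Longrightarrow> east_pair (s i) (b i) (s j) (b j)"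
  shows "separated n N E C s b"
proof -
  have d: False if "i \<in> C" "j \<in> C" "i < j" "occupies s b i c k" "occupies s b j c k" for i j c k
    using assms[OF that(1-3)] that(3-) unfolding east_pair_def occupies_def reached_def by linarith
  have x: "j < i" if "i \<in> C" "j \<in> C" "s j = Suc c" "b j = Suc c" "occupies s b i c j" for i j c
    using assms[OF that(1,2)] that(3-) unfolding east_pair_def occupies_def reached_def
    by (cases i j rule: linorder_cases) auto
  have "i = j" if "i \<in> C" "j \<in> C" "occupies s b i c k" "occupies s b j c k" for i j c k
    using that d by (meson linorder_neqE_nat)
  then show ?thesis unfolding separated_def by (auto intro: x)
qed

lemma west_pairs_separated:
  assumes "\<And>i j. i \<in> C \<Longrightarrow> j \<in> C \<Longrightarrow> i < j \<Longrightarrow> west_pair (s i) (b i) (s j) (b j)"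
  shows "separated n N W C b s"
proof -
  have d: False if "i \<in> C" "j \<in> C" "i < j" "occupies b s i c k" "occupies b s j c k" for i j c k
    using assms[OF that(1-3)] that(3-) unfolding west_pair_def occupies_def reached_def by linarith
  have x: "i < j" if "i \<in> C" "j \<in> C" "b j = Suc c" "s j = Suc c" "occupies b s i c j" for i j c
    using assms[OF that(2,1)] that(3-) unfolding west_pair_def occupies_def reached_def
    by (cases i j rule: linorder_cases) auto
  have "i = j" if "i \<in> C" "j \<in> C" "occupies b s i c k" "occupies b s j c k" for i j c k
    using that d by (meson linorder_neqE_nat)
  then show ?thesis unfolding separated_def by (auto intro: x)
qed

text \<open>Overlapping runs overlap at the wall just after the later of the two starts, so testing
  these walls suffices. A vertical pipe occupies no wall and is tested by the crossing
  condition.\<close>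

lemma separated_east_pair:
  assumes sep: "separated n N E C s b" and ij: "i \<in> C" "j \<in> C" "i < j" "j \<le> n"
    and bd: "1 \<le> s i" "s i \<le> N + 1" "1 \<le> s j" "s j \<le> N + 1" "s i \<le> b i" "s j \<le> b j"
  shows "east_pair (s i) (b i) (s j) (b j)"
proof -
  have K1: "\<not> (occupies s b i c k \<and> occupies s b j c k)" if "c \<le> N" "k \<le> n" for c k
    using sep ij that unfolding separated_def by blast
  have K2: "\<not> (s j = Suc c \<and> b j = Suc c \<and> occupies s b i c j)" if "c \<le> N" for c
    using sep ij that unfolding separated_def by (metis dir.distinct(1) less_asym)
  have "s j - 1 \<le> N" "s i - 1 \<le> N" "j \<le> n" "i \<le> n" using bd ij by auto
  then show ?thesis
    using K1[of "s j - 1" j] K2[of "s j - 1"] K1[of "s i - 1" i] ij bd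
    unfolding east_pair_def occupies_def reached_def by auto
qed

text \<open>Ceilings are now the right ends of runs, so the test walls lie just before them, which
  explains the indices \<open>i - 1\<close> and \<open>j - 1\<close>.\<close>

lemma separated_west_pair:
  assumes sep: "separated n N W C b s" and ij: "i \<in> C" "j \<in> C" "i < j" "1 \<le> i" "j \<le> n"
    and bd: "1 \<le> s i" "s i \<le> N + 1" "1 \<le> s j" "s j \<le> N + 1" "b i \<le> s i" "b j \<le> s j"
  shows "west_pair (s i) (b i) (s j) (b j)"
proof -
  have K1: "\<not> (occupies b s i c k \<and> occupies b s j c k)" if "c \<le> N" "k \<le> n" for c k
    using sep ij that unfolding separated_def by blast
  have K2: "\<not> (b i = Suc c \<and> s i = Suc c \<and> occupies b s j c i)" if "c \<le> N" for c
    using sep ij that unfolding separated_def by (metis less_asym)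
  obtain x y where xy: "s i = Suc x" "s j = Suc y" using bd by (metis Suc_le_D One_nat_def)
  then have xN: "x \<le> N" "y \<le> N" using bd by auto
  have n: "i - 1 \<le> n" "j - 1 \<le> n" using ij by auto
  show ?thesis unfolding west_pair_def
  proof (intro conjI notI impI)
    assume a: "b j < s i \<and> s i \<le> s j"
    show False
    proof (cases "b i = s i")
      case True
      then show False using K2[OF xN(1)] a xy ij by (simp add: occupies_def reached_def)
    next
      case False
      then show False using K1[OF xN(1) n(1)] a xy ij bd by (simp add: occupies_def reached_def) arith
    qed
  next
    assume a: "b i \<le> s j \<and> s j < s i"
    show "b j = s j"
    proof (rule ccontr)
      assume "b j \<noteq> s j"
      then show False using K1[OF xN(2) n(2)] a xy ij bd by (simp add: occupies_def reached_def) arith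
    qed
  qed
qed

definition row_step :: "nat \<Rightarrow> dir \<Rightarrow> nat \<Rightarrow> nat \<Rightarrow> (nat \<Rightarrow> nat) \<Rightarrow> (nat \<Rightarrow> nat) \<Rightarrow> bool" where
  "row_step N d l h s b \<longleftrightarrow> (if d = W then west_step l h s b else east_step N l h s b)"

section \<open>From the tiles of a row to a step\<close>

locale row =
  fixes n N l h :: nat and d :: dir and s :: "nat \<Rightarrow> nat" and lab :: nat
  assumes l1: "1 \<le> l" and lh: "l \<le> h" and hn: "h \<le> n" and lv: "live N l h s"
    and dead: "\<And>i. 1 \<le> i \<Longrightarrow> i \<le> n \<Longrightarrow> i \<notin> {l..h} \<Longrightarrow> s i = 0 \<or> s i = N + 2"
    and lab: "lab = (if d = W then l else h)"
begin

text \<open>Only the ranges of the floors: conservation of pipes yields this much directly, and it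
  already makes the floor function unique. The pair conditions come afterwards, from
  \<open>separated\<close>.\<close>

definition good :: "(nat \<Rightarrow> nat) \<Rightarrow> bool" where
  "good b \<longleftrightarrow> b lab = (if d = W then 0 else N + 2) \<and> (\<forall>i. i \<notin> {l..h} \<longrightarrow> b i = s i)
     \<and> (\<forall>i\<in>{l..h}. i \<noteq> lab \<longrightarrow> 1 \<le> b i \<and> b i \<le> N + 1)"

definition seg_start :: "(nat \<Rightarrow> nat) \<Rightarrow> nat \<Rightarrow> nat" where "seg_start b = (if d = W then b else s)"
definition seg_end :: "(nat \<Rightarrow> nat) \<Rightarrow> nat \<Rightarrow> nat" where "seg_end b = (if d = W then s else b)"

lemma lab_in: "lab \<in> {l..h}" using lab lh by auto

lemma s_bounds: "i \<in> {l..h} \<Longrightarrow> 1 \<le> s i \<and> s i \<le> N + 1"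
  using lv by (auto simp: live_def)

lemma in_C_le: "i \<in> {l..h} \<Longrightarrow> 1 \<le> i \<and> i \<le> n"
  using l1 hn by auto

lemma not_W: "d \<noteq> W \<longleftrightarrow> d = E" by (cases d) auto

text \<open>Conservation read off at the right end of the row: a live colour has exactly one
  ceiling, and only \<open>lab\<close> uses a side boundary in place of a floor.\<close>

lemma floor_count:
  assumes G: "row_frame n N d lab G" "has_ceils n N d G s" and i: "1 \<le> i" "i \<le> n"
  shows "card {c. c \<le> N \<and> pfloor d (G c i) \<noteq> None} = of_bool (i \<in> {l..h} \<and> i \<noteq> lab)"
proof -
  have ps: "passed i N n = {..N}" using i by (auto simp: passed_def)
  have wl: "wall d G N n = (if d = E then Some lab else None)"
    using G(1) i by (simp add: row_frame_def wall_def tile_right_def)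
  have "pceil d (G c i) \<noteq> None \<longleftrightarrow> s i = Suc c" if "c \<le> N" for c
    using G(2) i that unfolding has_ceils_def by auto
  then have "{c \<in> {..N}. pceil d (G c i) \<noteq> None} = {c \<in> {..N}. s i = Suc c}" by auto
  also have "\<dots> = (if i \<in> {l..h} then {s i - 1} else {})"
    using dead[OF i] s_bounds[of i] by auto
  finally have "{c \<in> {..N}. pceil d (G c i) \<noteq> None} = (if i \<in> {l..h} then {s i - 1} else {})" .
  then have ce: "card {c \<in> {..N}. pceil d (G c i) \<noteq> None} = of_bool (i \<in> {l..h})" by simp
  have st: "{c. c \<le> N \<and> pfloor d (G c i) \<noteq> None} = {c \<in> {..N}. pfloor d (G c i) \<noteq> None}" by auto
  show ?thesis
    using wall_count[OF G(1) i, of N n] ce lab_in lab unfolding ps wl st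
    by (cases d) (auto simp: ends_def starts_def)
qed

lemma row_floors_exist:
  assumes G: "row_frame n N d lab G" "has_ceils n N d G s"
  shows "\<exists>b. good b \<and> has_floors n N d G b"
proof -
  define b where "b i = (if i \<in> {l..h} then if i = lab then (if d = W then 0 else N + 2)
      else Suc (THE c. c \<le> N \<and> pfloor d (G c i) \<noteq> None) else s i)" for i
  have one: "\<exists>!c. c \<le> N \<and> pfloor d (G c i) \<noteq> None" if "i \<in> {l..h}" "i \<noteq> lab" for i
  proof -
    have "card {c. c \<le> N \<and> pfloor d (G c i) \<noteq> None} = 1"
      using floor_count[OF G, of i] in_C_le[OF that(1)] that by simp
    then obtain x where x: "{c. c \<le> N \<and> pfloor d (G c i) \<noteq> None} = {x}" by (rule card_1_singletonE)
    have "c \<le> N \<and> pfloor d (G c i) \<noteq> None \<longleftrightarrow> c = x" for c using x by blast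
    then show ?thesis by simp
  qed
  have none: "pfloor d (G c i) = None" if "1 \<le> i" "i \<le> n" "\<not> (i \<in> {l..h} \<and> i \<noteq> lab)" "c \<le> N" for c i
  proof -
    have "finite {c. c \<le> N \<and> pfloor d (G c i) \<noteq> None}" by simp
    then show ?thesis using floor_count[OF G that(1,2)] that(3,4) by auto
  qed
  have bi: "b i = Suc c \<longleftrightarrow> pfloor d (G c i) \<noteq> None" if "i \<in> {l..h}" "i \<noteq> lab" "c \<le> N" for i c
    using theI'[OF one[OF that(1,2)]] one[OF that(1,2)] that unfolding b_def by auto
  have "good b"
    using theI'[OF one] lab_in unfolding good_def b_def by auto
  moreover have "has_floors n N d G b"
    unfolding has_floors_def
  proof (intro allI impI ballI)
    fix c j assume c: "c \<le> N" and j: "j \<in> {1..n}"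
    show "pfloor d (G c j) = (if b j = Suc c then Some j else None)"
    proof (cases "j \<in> {l..h} \<and> j \<noteq> lab")
      case True
      then show ?thesis
        using bi[of j c] c j valid_piece_floor[OF row_frame_valid[OF G(1) c, of j]] by auto
    next
      case False
      then have "b j \<noteq> Suc c" using dead[of j] j c by (auto simp: b_def)
      then show ?thesis using none[of j c] False c j by auto
    qed
  qed
  ultimately show ?thesis by blast
qed

lemma good_seg_bounds:
  assumes "good b"
  shows "i \<in> {l..h} \<Longrightarrow> seg_end b i \<noteq> 0" "i \<in> {l..h} \<Longrightarrow> seg_start b i = 0 \<longleftrightarrow> d = W \<and> i = lab"
    "i \<in> {l..h} \<Longrightarrow> seg_end b i \<le> N + 2" "i \<in> {l..h} \<Longrightarrow> seg_start b i \<le> N + 1"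
    "i \<in> {l..h} \<Longrightarrow> seg_end b i = N + 2 \<longleftrightarrow> d = E \<and> i = lab"
  using assms s_bounds[of i] lab_in unfolding good_def seg_start_def seg_end_def
  by (cases "d = W"; cases "i = lab"; force simp: not_W)+

context
  fixes G b
  assumes G: "row_frame n N d lab G" "has_ceils n N d G s" "has_floors n N d G b" and gd: "good b"
begin

lemma starts_iff: "c \<le> N \<Longrightarrow> 1 \<le> i \<Longrightarrow> i \<le> n \<Longrightarrow> starts d (G c i) \<longleftrightarrow> seg_start b i = Suc c"
  using G(2,3) unfolding starts_def has_ceils_def has_floors_def seg_start_def by (cases d) auto

lemma ends_iff: "c \<le> N \<Longrightarrow> 1 \<le> i \<Longrightarrow> i \<le> n \<Longrightarrow> ends d (G c i) \<longleftrightarrow> seg_end b i = Suc c"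
  using G(2,3) unfolding ends_def has_ceils_def has_floors_def seg_end_def by (cases d) auto

lemma wall_balance:
  assumes "i \<in> {l..h}" "c \<le> N" "k \<le> n"
  shows "of_bool (wall d G c k = Some i) + of_bool (reached (seg_end b i) i c k) = (of_bool (reached (seg_start b i) i c k) :: nat)"
proof -
  have i: "1 \<le> i" "i \<le> n" using in_C_le[OF assms(1)] by auto
  have "{c' \<in> passed i c k. ends d (G c' i)} = {c' \<in> passed i c k. seg_end b i = Suc c'}"
    using ends_iff i assms(2) by (auto dest: passed_le)
  then have e: "card {c' \<in> passed i c k. ends d (G c' i)} = of_bool (reached (seg_end b i) i c k)"
    using card_function_passed good_seg_bounds(1)[OF gd assms(1)] by simp
  have st: "{c' \<in> passed i c k. starts d (G c' i)} = {c' \<in> passed i c k. seg_start b i = Suc c'}"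
    using starts_iff i assms(2) by (auto dest: passed_le)
  have "of_bool (d = W \<and> i = lab) + card {c' \<in> passed i c k. starts d (G c' i)} = of_bool (reached (seg_start b i) i c k)"
  proof (cases "seg_start b i = 0")
    case True
    then show ?thesis unfolding st using good_seg_bounds(2)[OF gd assms(1)] by (simp add: reached_def)
  next
    case False
    then show ?thesis unfolding st using good_seg_bounds(2)[OF gd assms(1)] card_function_passed[OF False] by simp
  qed
  then show ?thesis using wall_count[OF G(1) i assms(2,3)] e by simp
qed

lemma wall_dead:
  assumes "1 \<le> i" "i \<le> n" "i \<notin> {l..h}" "c \<le> N" "k \<le> n"
  shows "wall d G c k \<noteq> Some i"
proof -
  have "seg_start b i = s i" "seg_end b i = s i" using gd assms(3) unfolding good_def seg_start_def seg_end_def by auto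
  then have "\<not> starts d (G c' i)" "\<not> ends d (G c' i)" if "c' \<le> N" for c'
    using that starts_iff[OF that assms(1,2)] ends_iff[OF that assms(1,2)] dead[OF assms(1-3)] by auto
  then have st: "{c' \<in> passed i c k. starts d (G c' i)} = {}" using assms(4) by (auto dest: passed_le)
  have "i \<noteq> lab" using lab_in assms(3) by auto
  then show ?thesis using wall_count[OF G(1) assms(1,2,4,5)] unfolding st by auto
qed

lemma wall_color:
  assumes "c \<le> N" "k \<le> n" "wall d G c k = Some i"
  shows "1 \<le> i \<and> i \<le> n"
proof -
  have n: "1 \<le> n" using l1 lh hn by simp
  have col: "pleft d p = Some i \<or> pright d p = Some i \<Longrightarrow> i \<in> pcolors p" for p by (cases p; cases d) auto
  show ?thesis
  proof (cases "k = 0")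
    case True
    then show ?thesis using assms col row_frame_valid[OF G(1) assms(1), of 1] n
      unfolding wall_def valid_piece_def by fastforce
  next
    case False
    then show ?thesis using assms col row_frame_valid[OF G(1) assms(1), of k]
      unfolding wall_def valid_piece_def by fastforce
  qed
qed

text \<open>Floors and ceilings force all horizontal pipes, by the balance for live colours and its
  analogue for dead ones. Uniqueness of the row and the count of touched walls rest on this.\<close>

lemma wall_iff:
  assumes "c \<le> N" "k \<le> n"
  shows "wall d G c k = Some i \<longleftrightarrow> i \<in> {l..h} \<and> occupies (seg_start b) (seg_end b) i c k"
proof (cases "i \<in> {l..h}")
  case True
  then show ?thesis using wall_balance[OF True assms] unfolding occupies_def
    by (cases "wall d G c k = Some i"; cases "reached (seg_end b i) i c k"; cases "reached (seg_start b i) i c k") auto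
next
  case False
  then show ?thesis using wall_color[OF assms, of i] wall_dead[OF _ _ False assms] by auto
qed

text \<open>At the wall just after its end a run is counted as ended, and the balance then requires
  that it has started.\<close>

lemma seg_start_le_end:
  assumes "i \<in> {l..h}"
  shows "seg_start b i \<le> seg_end b i"
proof (cases "seg_end b i \<le> N + 1")
  case True
  then have q: "seg_end b i = Suc (seg_end b i - 1)" "seg_end b i - 1 \<le> N" using good_seg_bounds(1)[OF gd assms] by auto
  have "reached (seg_end b i) i (seg_end b i - 1) i" using q by (simp add: reached_def)
  then have "reached (seg_start b i) i (seg_end b i - 1) i"
    using wall_balance[OF assms q(2), of i] in_C_le[OF assms] by (auto split: if_splits simp: of_bool_def)
  then show ?thesis using q(1) unfolding reached_def by linarith
next
  case False
  then show ?thesis using good_seg_bounds(4)[OF gd assms] by simp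
qed

lemma row_separated: "separated n N d {l..h} (seg_start b) (seg_end b)"
  unfolding separated_def
proof (intro conjI allI impI ballI)
  fix c k i j
  assume "c \<le> N" "k \<le> n" "i \<in> {l..h}" "j \<in> {l..h}" "occupies (seg_start b) (seg_end b) i c k" "occupies (seg_start b) (seg_end b) j c k"
  then show "i = j" using wall_iff[of c k i] wall_iff[of c k j] by simp
next
  fix c i j
  assume a: "c \<le> N" "i \<in> {l..h}" "j \<in> {l..h}" "seg_start b j = Suc c" "seg_end b j = Suc c" "occupies (seg_start b) (seg_end b) i c j"
  have j: "1 \<le> j" "j \<le> n" using in_C_le[OF a(3)] by auto
  have "pright d (G c j) = Some i" using wall_iff[OF a(1) j(2), of i] a j by (auto simp: wall_def)
  moreover have "starts d (G c j)" "ends d (G c j)" using starts_iff ends_iff a j by auto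
  then have "pceil d (G c j) \<noteq> None" "pfloor d (G c j) \<noteq> None"
    unfolding starts_def ends_def by (auto split: if_splits)
  ultimately show "if d = W then i < j else j < i"
    using valid_piece_crossing[OF row_frame_valid[OF G(1) a(1) j]] by blast
qed

lemma row_step_floors: "row_step N d l h s b"
proof (cases "d = W")
  case True
  have le: "b i \<le> s i" if "i \<in> {l..h}" for i using seg_start_le_end[OF that] True unfolding seg_start_def seg_end_def by simp
  have "separated n N W {l..h} b s" using row_separated True unfolding seg_start_def seg_end_def by simp
  then have "west_pair (s i) (b i) (s j) (b j)" if "i \<in> {l..h}" "j \<in> {l..h}" "i < j" for i j
    using separated_west_pair[of n N "{l..h}" b s i j] that s_bounds in_C_le le by auto
  then show ?thesis using True gd lab le unfolding row_step_def west_step_def good_def by auto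
next
  case False
  then have E: "d = E" using not_W by simp
  have le: "s i \<le> b i" if "i \<in> {l..h}" for i using seg_start_le_end[OF that] E unfolding seg_start_def seg_end_def by simp
  have "separated n N E {l..h} s b" using row_separated E unfolding seg_start_def seg_end_def by simp
  then have "east_pair (s i) (b i) (s j) (b j)" if "i \<in> {l..h}" "j \<in> {l..h}" "i < j" for i j
    using separated_east_pair[of n N "{l..h}" s b i j] that s_bounds in_C_le le by auto
  then show ?thesis using E gd lab le unfolding row_step_def east_step_def good_def by auto
qed

lemma tile_right_iff:
  assumes "c \<le> N"
  shows "tile_right n d (G c) \<noteq> None \<longleftrightarrow> (\<exists>i\<in>{l..h}. seg_start b i \<le> Suc c \<and> Suc c < seg_end b i)"
proof -
  have n: "n \<noteq> 0" using l1 lh hn by simp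
  have "occupies (seg_start b) (seg_end b) i c n \<longleftrightarrow> seg_start b i \<le> Suc c \<and> Suc c < seg_end b i" if "i \<in> {l..h}" for i
    using in_C_le[OF that] unfolding occupies_def reached_def by auto
  moreover have "tile_right n d (G c) = wall d G c n" using n by (simp add: tile_right_def wall_def)
  ultimately show ?thesis using wall_iff[OF assms, of n] by (metis not_Some_eq order_refl)
qed

text \<open>At most one run touches a given right wall, so the count splits over colours. The run
  that enters from the left starts at 0, one step before the first column; this is the summand
  \<open>of_bool (d = W)\<close>.\<close>

lemma card_touched:
  "card {c\<in>{0..N}. tile_right n d (G c) \<noteq> None} + of_bool (d = W) + sum (seg_start b) {l..h} = sum (seg_end b) {l..h}"
proof -
  let ?A = "\<lambda>i. {c\<in>{0..N}. seg_start b i \<le> Suc c \<and> Suc c < seg_end b i}"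
  have "{c\<in>{0..N}. tile_right n d (G c) \<noteq> None} = (\<Union>i\<in>{l..h}. ?A i)"
    using tile_right_iff by auto
  moreover have "?A i \<inter> ?A j = {}" if "i \<in> {l..h}" "j \<in> {l..h}" "i \<noteq> j" for i j
  proof -
    have occ: "occupies (seg_start b) (seg_end b) i c n" if "c \<in> ?A i" "i \<in> {l..h}" for i c
      using that in_C_le[OF that(2)] unfolding occupies_def reached_def by auto
    have "i = j" if c: "c \<in> ?A i" "c \<in> ?A j" for c
    proof -
      have "c \<le> N" using c by simp
      then show ?thesis
        using wall_iff[of c n] occ[OF c(1) \<open>i \<in> {l..h}\<close>] occ[OF c(2) \<open>j \<in> {l..h}\<close>]
          \<open>i \<in> {l..h}\<close> \<open>j \<in> {l..h}\<close> by (metis option.inject order_refl)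
    qed
    then show ?thesis using that(3) by blast
  qed
  ultimately have "card {c\<in>{0..N}. tile_right n d (G c) \<noteq> None} = (\<Sum>i\<in>{l..h}. card (?A i))"
    by (simp add: card_UN_disjoint)
  moreover have "card (?A i) + of_bool (d = W \<and> i = lab) + seg_start b i = seg_end b i" if i: "i \<in> {l..h}" for i
  proof (cases "seg_start b i = 0")
    case True
    then have "?A i = {0..<seg_end b i - 1}" using good_seg_bounds(3,5)[OF gd i] good_seg_bounds(2)[OF gd i] by auto
    then show ?thesis using True good_seg_bounds(1)[OF gd i] good_seg_bounds(2)[OF gd i] by auto
  next
    case False
    then have "?A i = {seg_start b i - 1..<seg_end b i - 1}" using good_seg_bounds(3)[OF gd i] by auto
    then show ?thesis using False seg_start_le_end[OF i] good_seg_bounds(2)[OF gd i] by auto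
  qed
  then have "(\<Sum>i\<in>{l..h}. card (?A i) + of_bool (d = W \<and> i = lab) + seg_start b i) = sum (seg_end b) {l..h}"
    by (intro sum.cong) auto
  moreover have "(\<Sum>i\<in>{l..h}. of_bool (d = W \<and> i = lab)) = (of_bool (d = W) :: nat)"
    using lab_in by (cases "d = W") (auto simp: of_bool_def)
  ultimately show ?thesis by (simp add: sum.distrib)
qed

end

lemma row_unique:
  assumes "row_frame n N d lab G" "has_ceils n N d G s" "has_floors n N d G b" "good b"
    and "row_frame n N d lab G'" "has_ceils n N d G' s" "has_floors n N d G' b"
  shows "G = G'"
proof (intro ext)
  fix c j
  show "G c j = G' c j"
  proof (cases "c \<le> N \<and> 1 \<le> j \<and> j \<le> n")
    case True
    have w: "wall d G c k = wall d G' c k" if "k \<le> n" for k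
      using wall_iff[OF assms(1-4), of c k] wall_iff[OF assms(5-7,4), of c k] True that
      by (metis option.exhaust)
    show ?thesis
    proof (rule piece_eqI[of d])
      show "pleft d (G c j) = pleft d (G' c j)"
      proof -
        have j: "c \<le> N" "j - 1 < n" "j - 1 \<le> n" "Suc (j - 1) = j" using True by auto
        show ?thesis
          using row_frame_left[OF assms(1) j(1,2)] row_frame_left[OF assms(5) j(1,2)] w[OF j(3)]
          unfolding j(4) by simp
      qed
      show "pright d (G c j) = pright d (G' c j)" using w[of j] True by (simp add: wall_def)
      show "pceil d (G c j) = pceil d (G' c j)" using assms(2,6) True by (simp add: has_ceils_def)
      show "pfloor d (G c j) = pfloor d (G' c j)" using assms(3,7) True by (simp add: has_floors_def)
    qed
  next
    case False
    then have "\<not> (c \<le> N \<and> j \<in> {1..n})" by auto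
    then show ?thesis using assms(1,5) unfolding row_frame_def by metis
  qed
qed

lemma good_unique:
  assumes "has_floors n N d G b" "has_floors n N d G b'" "good b" "good b'"
  shows "b = b'"
proof
  fix i
  show "b i = b' i"
  proof (cases "i \<in> {l..h} \<and> i \<noteq> lab")
    case True
    then have i: "i \<in> {1..n}" using in_C_le[of i] by auto
    have b: "1 \<le> b i" "b i \<le> N + 1" using True assms(3) unfolding good_def by auto
    then have "pfloor d (G (b i - 1) i) = Some i" using assms(1) i unfolding has_floors_def by simp
    moreover have "b i - 1 \<le> N" using b by simp
    ultimately show ?thesis using assms(2) i b unfolding has_floors_def by (metis Suc_pred' less_eq_Suc_le One_nat_def option.distinct(1))
  next
    case False
    then show ?thesis using assms(3,4) unfolding good_def by metis
  qed
qed

lemma row_step_good: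
  assumes "row_step N d l h s b"
  shows "good b"
proof (cases "d = W")
  case True
  then have "west_step l h s b" using assms by (simp add: row_step_def)
  then show ?thesis using west_step_live[OF _ lv lh] True lab unfolding good_def west_step_def live_def
    by (auto simp: Suc_le_eq)
next
  case False
  then have "east_step N l h s b" using assms by (simp add: row_step_def)
  then show ?thesis using east_step_live[OF _ lv lh l1] False lab unfolding good_def east_step_def live_def
    by auto
qed

end

section \<open>From a step to the tiles of a row\<close>

definition site :: "bool \<Rightarrow> bool \<Rightarrow> nat \<Rightarrow> nat option \<Rightarrow> piece" where
  "site t f j w = (if t then if f then case w of None \<Rightarrow> Vert j | Some i \<Rightarrow> Cross j i else Elb1 j
     else if f then Elb2 j else case w of None \<Rightarrow> Empty | Some i \<Rightarrow> Horiz i)"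

lemma site_ceil: "pceil d (site t f j w) = (if t then Some j else None)"
  by (auto simp: site_def split: option.split)

lemma site_floor: "pfloor d (site t f j w) = (if f then Some j else None)"
  by (auto simp: site_def split: option.split)

context row
begin

lemma row_step_separated:
  assumes "row_step N d l h s b"
  shows "separated n N d {l..h} (seg_start b) (seg_end b)" "i \<in> {l..h} \<Longrightarrow> seg_start b i \<le> seg_end b i"
proof -
  show "separated n N d {l..h} (seg_start b) (seg_end b)"
  proof (cases "d = W")
    case True
    then have st: "west_step l h s b" using assms by (simp add: row_step_def)
    have "separated n N W {l..h} b s"
      by (rule west_pairs_separated) (use west_step_pair[OF st] in auto)
    then show ?thesis using True unfolding seg_start_def seg_end_def by simp
  next
    case False
    then have st: "east_step N l h s b" using assms by (simp add: row_step_def)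
    have "separated n N E {l..h} s b"
      by (rule east_pairs_separated) (use east_step_pair[OF st] in auto)
    then show ?thesis using False not_W unfolding seg_start_def seg_end_def by simp
  qed
  show "i \<in> {l..h} \<Longrightarrow> seg_start b i \<le> seg_end b i"
    using assms unfolding row_step_def west_step_def east_step_def seg_start_def seg_end_def by (auto split: if_splits)
qed

context
  fixes b assumes st: "row_step N d l h s b"
begin

definition hw :: "nat \<Rightarrow> nat \<Rightarrow> nat option" where
  "hw c k = (if \<exists>i\<in>{l..h}. occupies (seg_start b) (seg_end b) i c k
     then Some (THE i. i \<in> {l..h} \<and> occupies (seg_start b) (seg_end b) i c k) else None)"

definition built :: "nat \<Rightarrow> tile" where
  "built c j = (if c \<le> N \<and> j \<in> {1..n} then site (s j = Suc c) (b j = Suc c) j (hw c (j - 1)) else Empty)"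

lemma hw_iff:
  assumes "c \<le> N" "k \<le> n"
  shows "hw c k = Some i \<longleftrightarrow> i \<in> {l..h} \<and> occupies (seg_start b) (seg_end b) i c k"
proof -
  have u: "i = j" if "i \<in> {l..h}" "occupies (seg_start b) (seg_end b) i c k" "j \<in> {l..h}" "occupies (seg_start b) (seg_end b) j c k" for i j
    using row_step_separated(1)[OF st] that assms unfolding separated_def by blast
  have "(THE i. i \<in> {l..h} \<and> occupies (seg_start b) (seg_end b) i c k) = i" if "i \<in> {l..h}" "occupies (seg_start b) (seg_end b) i c k" for i
    by (rule the_equality) (use that u in auto)
  then show ?thesis unfolding hw_def by (auto split: if_splits)
qed

lemma hw_eqI:
  assumes "c \<le> N" "k \<le> n" "c' \<le> N" "k' \<le> n"
    and "\<And>i. i \<in> {l..h} \<Longrightarrow> occupies (seg_start b) (seg_end b) i c k \<longleftrightarrow> occupies (seg_start b) (seg_end b) i c' k'"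
  shows "hw c k = hw c' k'"
proof -
  have "hw c k = Some i \<longleftrightarrow> hw c' k' = Some i" for i
    using hw_iff[OF assms(1,2)] hw_iff[OF assms(3,4)] assms(5) by blast
  then show ?thesis by (metis option.exhaust)
qed

lemma occupies_other: "i \<noteq> j \<Longrightarrow> 1 \<le> j \<Longrightarrow> occupies p q i c (j - 1) \<longleftrightarrow> occupies p q i c j"
  unfolding occupies_def reached_def by (cases j) (auto simp: le_Suc_eq)

lemma built_site:
  assumes c: "c \<le> N" and j: "1 \<le> j" "j \<le> n"
  shows "pleft d (built c j) = hw c (j - 1) \<and> pright d (built c j) = hw c j \<and> valid_piece n d j (built c j)"
proof -
  have gd: "good b" using row_step_good[OF st] .
  have bt: "built c j = site (s j = Suc c) (b j = Suc c) j (hw c (j - 1))" using c j by (simp add: built_def)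
  have j1: "j - 1 \<le> n" using j by simp
  have col: "i \<in> {1..n}" if "hw c k = Some i" "k \<le> n" for i k
    using hw_iff[OF c that(2)] that(1) in_C_le by auto
  have inC: "j \<in> {l..h}" if "s j = Suc c \<or> b j = Suc c"
  proof (rule ccontr)
    assume "j \<notin> {l..h}"
    moreover from this have "b j = s j" using gd unfolding good_def by auto
    ultimately show False using dead[OF j] that c by auto
  qed
  \<comment> \<open>Sub-tile \<open>j\<close> can change only the run of colour \<open>j\<close>,
    and not even that if it neither starts nor ends here, or does both.\<close>
  have keep: "hw c j = hw c (j - 1)" if "(seg_start b j = Suc c) = (seg_end b j = Suc c)"
  proof (rule hw_eqI[OF c j(2) c j1])
    fix i assume "i \<in> {l..h}"
    show "occupies (seg_start b) (seg_end b) i c j = occupies (seg_start b) (seg_end b) i c (j - 1)"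
    proof (cases "i = j")
      case True
      then show ?thesis using that j unfolding occupies_def reached_def by auto
    next
      case False
      then show ?thesis using occupies_other j by blast
    qed
  qed
  \<comment> \<open>Any other run present to the left of the sub-tile would continue and share the
    right wall with \<open>j\<close>, against separation.\<close>
  have start: "hw c j = Some j \<and> hw c (j - 1) = None" if "j \<in> {l..h}" "seg_start b j = Suc c" "seg_end b j \<noteq> Suc c"
  proof -
    have "seg_end b j > Suc c" using row_step_separated(2)[OF st that(1)] that by simp
    then have a: "hw c j = Some j" using hw_iff[OF c j(2)] that unfolding occupies_def reached_def by simp
    have "hw c (j - 1) \<noteq> Some i" for i
    proof
      assume i: "hw c (j - 1) = Some i"
      have "i \<noteq> j" using hw_iff[OF c j1] i that j unfolding occupies_def reached_def by auto
      then have "hw c j = Some i" using hw_iff[OF c j1, of i] hw_iff[OF c j(2), of i] i occupies_other j by blast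
      then show False using a \<open>i \<noteq> j\<close> by simp
    qed
    then show ?thesis using a by auto
  qed
  have stop: "hw c (j - 1) = Some j \<and> hw c j = None" if "j \<in> {l..h}" "seg_start b j \<noteq> Suc c" "seg_end b j = Suc c"
  proof -
    have "seg_start b j \<le> c" using row_step_separated(2)[OF st that(1)] that by simp
    then have a: "hw c (j - 1) = Some j" using hw_iff[OF c j1] that j unfolding occupies_def reached_def by auto
    have "hw c j \<noteq> Some i" for i
    proof
      assume i: "hw c j = Some i"
      have "i \<noteq> j" using hw_iff[OF c j(2)] i that j unfolding occupies_def reached_def by auto
      then have "hw c (j - 1) = Some i" using hw_iff[OF c j1, of i] hw_iff[OF c j(2), of i] i occupies_other j by blast
      then show False using a \<open>i \<noteq> j\<close> by simp
    qed
    then show ?thesis using a by auto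
  qed
  have cross: "if d = W then i < j else j < i"
    if "j \<in> {l..h}" "seg_start b j = Suc c" "seg_end b j = Suc c" "hw c j = Some i" for i
    using row_step_separated(1)[OF st] that hw_iff[OF c j(2), of i] c unfolding separated_def by blast
  have PQ: "d = W \<Longrightarrow> seg_start b j = b j \<and> seg_end b j = s j" "d = E \<Longrightarrow> seg_start b j = s j \<and> seg_end b j = b j"
    unfolding seg_start_def seg_end_def by auto
  consider "s j = Suc c" "b j = Suc c" | "s j = Suc c" "b j \<noteq> Suc c" | "s j \<noteq> Suc c" "b j = Suc c"
    | "s j \<noteq> Suc c" "b j \<noteq> Suc c" by blast
  then show ?thesis
  proof cases
    case 1
    have pq: "seg_start b j = Suc c" "seg_end b j = Suc c" using PQ 1 not_W by (cases "d = W"; simp)+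
    have k: "hw c j = hw c (j - 1)" using keep pq by simp
    show ?thesis
    proof (cases "hw c j")
      case None
      then show ?thesis unfolding bt using 1 k j by (simp add: site_def valid_piece_def)
    next
      case (Some i)
      have "i \<in> {1..n}" using col[OF Some j(2)] .
      moreover have w: "hw c (j - 1) = Some i" using k Some by simp
      moreover have "built c j = Cross j i" unfolding bt site_def w using 1 by simp
      ultimately show ?thesis using j 1 Some cross[OF inC pq Some] by (simp add: valid_piece_def)
    qed
  next
    case 2
    have "built c j = Elb1 j" unfolding bt site_def using 2 by simp
    moreover have "hw c (j - 1) = pleft d (Elb1 j) \<and> hw c j = pright d (Elb1 j)"
    proof (cases "d = W")
      case True
      then show ?thesis using stop[OF inC] PQ(1)[OF True] 2 by simp
    next
      case False
      then have "d = E" using not_W by simp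
      then show ?thesis using start[OF inC] PQ(2) 2 by simp
    qed
    ultimately show ?thesis using j by (simp add: valid_piece_def)
  next
    case 3
    have "built c j = Elb2 j" unfolding bt site_def using 3 by simp
    moreover have "hw c (j - 1) = pleft d (Elb2 j) \<and> hw c j = pright d (Elb2 j)"
    proof (cases "d = W")
      case True
      then show ?thesis using start[OF inC] PQ(1)[OF True] 3 by simp
    next
      case False
      then have "d = E" using not_W by simp
      then show ?thesis using stop[OF inC] PQ(2) 3 by simp
    qed
    ultimately show ?thesis using j by (simp add: valid_piece_def)
  next
    case 4
    have "seg_start b j \<noteq> Suc c" "seg_end b j \<noteq> Suc c" using PQ 4 not_W by (cases "d = W"; simp)+
    then have k: "hw c j = hw c (j - 1)" using keep by simp
    show ?thesis
    proof (cases "hw c j")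
      case None
      then show ?thesis unfolding bt using 4 k j by (simp add: site_def valid_piece_def)
    next
      case (Some i)
      have w: "hw c (j - 1) = Some i" using k Some by simp
      have "built c j = Horiz i" unfolding bt site_def w using 4 by simp
      then show ?thesis using Some w col[OF Some j(2)] by (simp add: valid_piece_def)
    qed
  qed
qed

lemma row_built:
  "row_frame n N d lab built \<and> has_ceils n N d built s \<and> has_floors n N d built b"
proof (intro conjI)
  have gd: "good b" using row_step_good[OF st] .
  have n: "1 \<le> n" using l1 lh hn by simp
  show "has_ceils n N d built s" unfolding has_ceils_def by (simp add: built_def site_ceil)
  show "has_floors n N d built b" unfolding has_floors_def by (simp add: built_def site_floor)
  have right: "tile_right n d (built c) = hw c n" if "c \<le> N" for c
    using built_site[OF that n order_refl] by (simp add: tile_right_def)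
  have left: "tile_left d (built c) = hw c 0" if "c \<le> N" for c
    using built_site[OF that _ n] by (simp add: tile_left_def)
  show "row_frame n N d lab built"
    unfolding row_frame_def
  proof (intro conjI allI impI)
    fix c j assume "\<not> (c \<le> N \<and> j \<in> {1..n})"
    then show "built c j = Empty" unfolding built_def by (rule if_not_P)
  next
    fix c assume c: "c \<le> N"
    show "valid_tile n d (built c)"
      unfolding valid_tile_def
    proof (intro conjI ballI allI impI)
      fix j assume "j \<in> {1..n}"
      then show "valid_piece n d j (built c j)" using built_site[OF c] by simp
    next
      fix j assume "1 \<le> j \<and> j < n"
      then show "pright d (built c j) = pleft d (built c (Suc j))"
        using built_site[OF c, of j] built_site[OF c, of "Suc j"] by simp
    qed
  next
    fix c assume c: "c < N"
    have "hw c n = hw (Suc c) 0"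
    proof (rule hw_eqI)
      fix i assume "i \<in> {l..h}"
      then show "occupies (seg_start b) (seg_end b) i c n = occupies (seg_start b) (seg_end b) i (Suc c) 0"
        using in_C_le[of i] unfolding occupies_def reached_def by auto
    qed (use c in auto)
    then show "tile_right n d (built c) = tile_left d (built (Suc c))" using right left c by simp
  next
    have "occupies (seg_start b) (seg_end b) i 0 0 \<longleftrightarrow> d = W \<and> i = lab" if "i \<in> {l..h}" for i
      using good_seg_bounds(1,2)[OF gd that] in_C_le[OF that] unfolding occupies_def reached_def by auto
    then have "hw 0 0 = Some i \<longleftrightarrow> d = W \<and> i = lab" for i using hw_iff[of 0 0 i] lab_in by auto
    then have "hw 0 0 = (if d = W then Some lab else None)" by (metis option.exhaust)
    then show "tile_left d (built 0) = (if d = W then Some lab else None)" using left by simp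
  next
    have "occupies (seg_start b) (seg_end b) i N n \<longleftrightarrow> d = E \<and> i = lab" if "i \<in> {l..h}" for i
      using good_seg_bounds(3,4,5)[OF gd that] in_C_le[OF that] unfolding occupies_def reached_def by auto
    then have "hw N n = Some i \<longleftrightarrow> d = E \<and> i = lab" for i using hw_iff[of N n i] lab_in by auto
    then have "hw N n = (if d = E then Some lab else None)" by (metis option.exhaust)
    then show "tile_right n d (built N) = (if d = E then Some lab else None)" using right by simp
  qed
qed

end

lemma row_exists:
  "row_step N d l h s b \<Longrightarrow> \<exists>G. row_frame n N d lab G \<and> has_ceils n N d G s \<and> has_floors n N d G b"
  using row_built by blast

lemma row_exponent:
  assumes "row_frame n N d lab G" "has_ceils n N d G s" "has_floors n N d G b" "good b"
  shows "(if d = W then card {c\<in>{0..N}. tile_right n d (G c) \<noteq> None}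
          else card {c\<in>{0..N}. tile_right n d (G c) = None})
       = (if d = W then sum s {l..h} - sum b {l..h} - 1 else N + 1 - (sum b {l..h} - sum s {l..h}))"
proof -
  let ?T = "{c\<in>{0..N}. tile_right n d (G c) \<noteq> None}"
  have e: "{c\<in>{0..N}. tile_right n d (G c) = None} = {0..N} - ?T" by auto
  have "card ({0..N} - ?T) = card {0..N} - card ?T" by (rule card_Diff_subset) auto
  then have "card {c\<in>{0..N}. tile_right n d (G c) = None} = N + 1 - card ?T" unfolding e by simp
  then show ?thesis using card_touched[OF assms] unfolding seg_start_def seg_end_def by auto
qed

end

section \<open>Fillings of the grid\<close>

text \<open>The rows from \<open>r\<close> on, with everything above empty, so that the top row can
  be split off recursively. The guard \<open>r \<le> n\<close> leaves exactly the empty filling for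
  \<open>r = Suc n\<close>.\<close>

definition fills :: "nat \<Rightarrow> nat \<Rightarrow> (nat \<Rightarrow> dir) \<Rightarrow> nat \<Rightarrow> (nat \<Rightarrow> nat) \<Rightarrow> filling set" where
  "fills n N tau r s = {F.
      (\<forall>r'. r' \<notin> {r..n} \<longrightarrow> F r' = (\<lambda>_ _. Empty))
    \<and> (\<forall>r'\<in>{r..n}. row_frame n N (tau r') (row_label n tau r') (F r'))
    \<and> (\<forall>r'. r \<le> r' \<and> r' < n \<longrightarrow> (\<forall>c\<le>N. \<forall>j\<in>{1..n}.
          pfloor (tau r') (F r' c j) = pceil (tau (Suc r')) (F (Suc r') c j)))
    \<and> (r \<le> n \<longrightarrow> has_ceils n N (tau r) (F r) s \<and> (\<forall>c\<le>N. \<forall>j\<in>{1..n}. pfloor (tau n) (F n c j) = None))}"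

lemma HPD_eq_fills:
  assumes "1 \<le> n"
  shows "HPD n N tau a = fills n N tau 1 (\<lambda>i. a i + 1)"
proof -
  have "F \<in> HPD n N tau a \<longleftrightarrow> F \<in> fills n N tau 1 (\<lambda>i. a i + 1)" for F
  proof
    assume F: "F \<in> HPD n N tau a"
    note H = F[unfolded HPD_def mem_Collect_eq]
    note H1 = H[THEN conjunct1]
    note H2 = H[THEN conjunct2, THEN conjunct1]
    note H3 = H[THEN conjunct2, THEN conjunct2, THEN conjunct1]
    note H4 = H[THEN conjunct2, THEN conjunct2, THEN conjunct2, THEN conjunct1]
    note H5 = H[THEN conjunct2, THEN conjunct2, THEN conjunct2, THEN conjunct2, THEN conjunct1]
    note H6 = H[THEN conjunct2, THEN conjunct2, THEN conjunct2, THEN conjunct2, THEN conjunct2, THEN conjunct1]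
    note H7 = H[THEN conjunct2, THEN conjunct2, THEN conjunct2, THEN conjunct2, THEN conjunct2, THEN conjunct2, THEN conjunct1]
    note H8 = H[THEN conjunct2, THEN conjunct2, THEN conjunct2, THEN conjunct2, THEN conjunct2, THEN conjunct2, THEN conjunct2]
    have "F r' = (\<lambda>_ _. Empty)" if "r' \<notin> {1..n}" for r'
      using H1 that by (intro ext) blast
    moreover have "row_frame n N (tau r) (row_label n tau r) (F r)" if r: "r \<in> {1..n}" for r
      unfolding row_frame_def
    proof (intro conjI)
      show "\<forall>c j. \<not> (c \<le> N \<and> j \<in> {1..n}) \<longrightarrow> F r c j = Empty" using H1 by blast
    qed (rule bspec[OF H2 r] bspec[OF H3 r] bspec[OF H5 r] bspec[OF H6 r])+
    moreover have "has_ceils n N (tau 1) (F 1) (\<lambda>i. a i + 1)"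
      unfolding has_ceils_def
    proof (intro allI impI ballI)
      fix c j assume "c \<le> N" "j \<in> {1..n}"
      then have "pceil (tau 1) (F 1 c j) = (if c = a j then Some j else None)" using H7 by blast
      then show "pceil (tau 1) (F 1 c j) = (if a j + 1 = Suc c then Some j else None)" by simp
    qed
    ultimately show "F \<in> fills n N tau 1 (\<lambda>i. a i + 1)"
      unfolding fills_def mem_Collect_eq using H4 H8 by blast
  next
    assume F: "F \<in> fills n N tau 1 (\<lambda>i. a i + 1)"
    note H = F[unfolded fills_def mem_Collect_eq]
    note H1 = H[THEN conjunct1]
    note H2 = H[THEN conjunct2, THEN conjunct1]
    note H3 = H[THEN conjunct2, THEN conjunct2, THEN conjunct1]
    note H4 = H[THEN conjunct2, THEN conjunct2, THEN conjunct2]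
    note fr = H2[unfolded row_frame_def]
    have "F r c j = Empty" if "\<not> (r \<in> {1..n} \<and> c \<le> N \<and> j \<in> {1..n})" for r c j
    proof (cases "r \<in> {1..n}")
      case True
      then show ?thesis using fr[rule_format, OF True] that by blast
    next
      case False
      then have "F r = (\<lambda>_ _. Empty)" using H1 by blast
      then show ?thesis by simp
    qed
    then have K1: "\<forall>r c j. \<not> (r \<in> {1..n} \<and> c \<le> N \<and> j \<in> {1..n}) \<longrightarrow> F r c j = Empty" by blast
    have K2: "\<forall>r\<in>{1..n}. \<forall>c\<le>N. valid_tile n (tau r) (F r c)"
      "\<forall>r\<in>{1..n}. \<forall>c<N. tile_right n (tau r) (F r c) = tile_left (tau r) (F r (Suc c))"
      "\<forall>r\<in>{1..n}. tile_left (tau r) (F r 0) = (if tau r = W then Some (row_label n tau r) else None)"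
      "\<forall>r\<in>{1..n}. tile_right n (tau r) (F r N) = (if tau r = E then Some (row_label n tau r) else None)"
      using fr by blast+
    have K3: "\<forall>c\<le>N. \<forall>i\<in>{1..n}. pceil (tau 1) (F 1 c i) = (if c = a i then Some i else None)"
    proof (intro allI impI ballI)
      fix c i assume "c \<le> N" "i \<in> {1..n}"
      then have "pceil (tau 1) (F 1 c i) = (if a i + 1 = Suc c then Some i else None)"
        using H4 assms unfolding has_ceils_def by blast
      then show "pceil (tau 1) (F 1 c i) = (if c = a i then Some i else None)" by auto
    qed
    have K4: "\<forall>c\<le>N. \<forall>j\<in>{1..n}. pfloor (tau n) (F n c j) = None" using H4 assms by blast
    show "F \<in> HPD n N tau a" unfolding HPD_def by (intro CollectI conjI K1 K2 H3 K3 K4)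
  qed
  then show ?thesis by blast
qed

text \<open>Together with \<open>fill_low\<close> this delimits the colours still present at row
  \<open>r\<close>: each east row above has removed the largest, each west row the smallest.\<close>

definition fill_top :: "nat \<Rightarrow> (nat \<Rightarrow> dir) \<Rightarrow> nat \<Rightarrow> nat" where
  "fill_top n tau r = n - card {q\<in>{1..<r}. tau q = E}"

definition fill_low :: "(nat \<Rightarrow> dir) \<Rightarrow> nat \<Rightarrow> nat" where
  "fill_low tau r = Suc (card {q\<in>{1..<r}. tau q = W})"

lemma card_rows_Suc:
  assumes "1 \<le> r"
  shows "card {q\<in>{1..<Suc r}. tau q = (d :: dir)} = card {q\<in>{1..<r}. tau q = d} + of_bool (tau r = d)"
proof (cases "tau r = d")
  case True
  then have "{q\<in>{1..<Suc r}. tau q = d} = insert r {q\<in>{1..<r}. tau q = d}" using assms by auto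
  then show ?thesis using True by simp
next
  case False
  then have "{q\<in>{1..<Suc r}. tau q = d} = {q\<in>{1..<r}. tau q = d}" using assms by (auto simp: less_Suc_eq)
  then show ?thesis using False by simp
qed

lemma card_rows_add:
  assumes "1 \<le> r"
  shows "card {q\<in>{1..<r}. tau q = W} + card {q\<in>{1..<r}. tau q = E} = r - 1"
  using assms
proof (induction r rule: dec_induct)
  case (step r)
  then show ?case using card_rows_Suc[of r tau W] card_rows_Suc[of r tau E] by (cases "tau r") auto
qed simp

text \<open>One colour disappears per row. The additive form avoids truncated subtraction and shows
  that the interval is empty at \<open>r = Suc n\<close>.\<close>

lemma fill_bounds:
  assumes "1 \<le> r" "r \<le> Suc n"
  shows "fill_low tau r + n = fill_top n tau r + r" "1 \<le> fill_low tau r" "fill_top n tau r \<le> n"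
  using card_rows_add[OF assms(1), of tau] assms unfolding fill_low_def fill_top_def by auto

lemma fill_Suc:
  assumes "1 \<le> r" "r \<le> n"
  shows "fill_low tau (Suc r) = fill_low tau r + of_bool (tau r = W)"
    "fill_top n tau (Suc r) = fill_top n tau r - of_bool (tau r = E)"
  using card_rows_Suc[OF assms(1), of tau] unfolding fill_low_def fill_top_def by auto

text \<open>This ties the labelling to the recursion of \<open>row_sum\<close>: a row is labelled by
  the colour that it removes.\<close>

lemma row_label_fill:
  assumes "1 \<le> r" "r \<le> n"
  shows "row_label n tau r = (if tau r = W then fill_low tau r else fill_top n tau r)"
proof -
  have "{1..r} = {1..<Suc r}" by auto
  then show ?thesis
    using card_rows_Suc[OF assms(1), of tau] unfolding row_label_def fill_low_def fill_top_def
    by (cases "tau r") auto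
qed

definition live_from :: "nat \<Rightarrow> nat \<Rightarrow> (nat \<Rightarrow> dir) \<Rightarrow> nat \<Rightarrow> (nat \<Rightarrow> nat) \<Rightarrow> bool" where
  "live_from n N tau r s \<longleftrightarrow> live N (fill_low tau r) (fill_top n tau r) s
     \<and> (\<forall>i\<in>{1..n}. i \<notin> {fill_low tau r..fill_top n tau r} \<longrightarrow> s i = 0 \<or> s i = N + 2)"

lemma row_of_live_from:
  assumes "1 \<le> r" "r \<le> n" "live_from n N tau r s"
  shows "row n N (fill_low tau r) (fill_top n tau r) (tau r) s (row_label n tau r)"
proof
  show "fill_low tau r \<le> fill_top n tau r" using fill_bounds[of r n tau] assms by simp
qed (use fill_bounds[of r n tau] assms row_label_fill[OF assms(1,2), of tau] in \<open>auto simp: live_from_def\<close>)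

lemma live_from_Suc:
  assumes r: "1 \<le> r" "r \<le> n" and s: "live_from n N tau r s"
    and b: "row_step N (tau r) (fill_low tau r) (fill_top n tau r) s b"
  shows "live_from n N tau (Suc r) b"
proof -
  interpret row n N "fill_low tau r" "fill_top n tau r" "tau r" s "row_label n tau r"
    by (rule row_of_live_from[OF r s])
  have gd: "good b" by (rule row_step_good[OF b])
  have rng: "i \<in> {fill_low tau (Suc r)..fill_top n tau (Suc r)}
      \<longleftrightarrow> i \<in> {fill_low tau r..fill_top n tau r} \<and> i \<noteq> row_label n tau r" for i
    unfolding fill_Suc[OF r] row_label_fill[OF r] using l1 lh by (cases "tau r") auto
  show ?thesis
    unfolding live_from_def live_def
  proof (intro conjI ballI impI)
    fix i assume "i \<in> {fill_low tau (Suc r)..fill_top n tau (Suc r)}"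
    then show "1 \<le> b i" "b i \<le> N + 1" using gd unfolding rng good_def by auto
  next
    fix i assume "i \<in> {1..n}" "i \<notin> {fill_low tau (Suc r)..fill_top n tau (Suc r)}"
    then show "b i = 0 \<or> b i = N + 2" using gd dead[of i] unfolding rng good_def by (auto split: if_splits)
  qed
qed

lemma finite_row_step:
  assumes "1 \<le> l" "l \<le> h" "live N l h s"
  shows "finite {b. row_step N d l h s b}"
  using finite_west_step finite_east_step[OF assms] by (cases "d = W") (simp_all add: row_step_def)

text \<open>Floors \<open>b\<close> determine row \<open>r\<close>, for which \<open>rowG b\<close>
  is the chosen name, and they are the ceilings of the rest; so a filling is a step together with a
  filling of the rows below.\<close>

lemma fills_split:
  assumes r: "1 \<le> r" "r \<le> n" and s: "live_from n N tau r s"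
    and rowG: "\<And>b. row_step N (tau r) (fill_low tau r) (fill_top n tau r) s b \<Longrightarrow>
      row_frame n N (tau r) (row_label n tau r) (rowG b) \<and> has_ceils n N (tau r) (rowG b) s
        \<and> has_floors n N (tau r) (rowG b) b"
  shows "bij_betw (\<lambda>(b, F). F(r := rowG b))
    (SIGMA b:{b. row_step N (tau r) (fill_low tau r) (fill_top n tau r) s b}. fills n N tau (Suc r) b)
    (fills n N tau r s)"
proof -
  interpret row n N "fill_low tau r" "fill_top n tau r" "tau r" s "row_label n tau r"
    by (rule row_of_live_from[OF r s])
  let ?st = "row_step N (tau r) (fill_low tau r) (fill_top n tau r) s"
  \<comment> \<open>After the last row no colour is present and every position is 0 or
    \<open>N + 2\<close>, so the bottom floors are empty automatically.\<close>
  have nofloor: "b j \<noteq> Suc c" if "?st b" "r = n" "c \<le> N" "j \<in> {1..n}" for b c j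
  proof -
    have "live_from n N tau (Suc r) b" by (rule live_from_Suc[OF r s that(1)])
    moreover have "fill_low tau (Suc r) > fill_top n tau (Suc r)"
      using fill_bounds[of "Suc r" n tau] r that by simp
    ultimately show ?thesis using that(3,4) unfolding live_from_def by fastforce
  qed
  show ?thesis
  proof (rule bij_betw_imageI)
    show "inj_on (\<lambda>(b, F). F(r := rowG b)) (SIGMA b:{b. ?st b}. fills n N tau (Suc r) b)"
    proof (rule inj_onI, clarify)
      fix b F b' F' assume b: "?st b" "?st b'" and F: "F \<in> fills n N tau (Suc r) b" "F' \<in> fills n N tau (Suc r) b'"
        and eq: "F(r := rowG b) = F'(r := rowG b')"
      have "rowG b = rowG b'" using fun_cong[OF eq, of r] by simp
      then have "b = b'" using good_unique[of "rowG b"] rowG[OF b(1)] rowG[OF b(2)] row_step_good b by metis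
      moreover have "F r = F' r" using F unfolding fills_def by simp
      then have "F = F'" using eq by (metis fun_upd_triv fun_upd_upd)
      ultimately show "b = b' \<and> F = F'" by simp
    qed
    show "(\<lambda>(b, F). F(r := rowG b)) ` (SIGMA b:{b. ?st b}. fills n N tau (Suc r) b) = fills n N tau r s"
    proof (intro equalityI subsetI)
      fix F assume "F \<in> (\<lambda>(b, F). F(r := rowG b)) ` (SIGMA b:{b. ?st b}. fills n N tau (Suc r) b)"
      then obtain b F' where b: "?st b" and F': "F' \<in> fills n N tau (Suc r) b" and F: "F = F'(r := rowG b)" by auto
      note R = rowG[OF b]
      have 1: "F r' = (\<lambda>_ _. Empty)" if "r' \<notin> {r..n}" for r'
        using F' F that r unfolding fills_def by auto
      have 2: "row_frame n N (tau r') (row_label n tau r') (F r')" if "r' \<in> {r..n}" for r'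
        using F' F R that unfolding fills_def by (cases "r' = r") auto
      have 3: "pfloor (tau r') (F r' c j) = pceil (tau (Suc r')) (F (Suc r') c j)"
        if "r \<le> r'" "r' < n" "c \<le> N" "j \<in> {1..n}" for r' c j
      proof (cases "r' = r")
        case True
        then show ?thesis using F' F R that unfolding fills_def has_ceils_def has_floors_def by simp
      next
        case False
        then show ?thesis using F' F that unfolding fills_def by simp
      qed
      have 4: "pfloor (tau n) (F n c j) = None" if "c \<le> N" "j \<in> {1..n}" for c j
      proof (cases "r = n")
        case True
        then show ?thesis using R F that nofloor[OF b True that] unfolding has_floors_def by simp
      next
        case False
        then show ?thesis using F' F r that unfolding fills_def by simp
      qed
      have 5: "has_ceils n N (tau r) (F r) s" using R F by simp
      show "F \<in> fills n N tau r s" unfolding fills_def using 1 2 3 4 5 by blast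
    next
      fix F assume F: "F \<in> fills n N tau r s"
      have fr: "row_frame n N (tau r) (row_label n tau r) (F r)" "has_ceils n N (tau r) (F r) s"
        using F r unfolding fills_def by auto
      obtain b where b: "good b" "has_floors n N (tau r) (F r) b" using row_floors_exist[OF fr] by blast
      have st: "?st b" by (rule row_step_floors[OF fr b(2,1)])
      let ?F = "F(r := (\<lambda>_ _. Empty))"
      have "rowG b = F r" using row_unique[OF _ _ _ b(1) fr b(2)] rowG[OF st] by blast
      then have "F = ?F(r := rowG b)" by simp
      moreover have "?F \<in> fills n N tau (Suc r) b"
      proof -
        have 1: "?F r' = (\<lambda>_ _. Empty)" if "r' \<notin> {Suc r..n}" for r'
          using F that r unfolding fills_def by (cases "r' = r") auto
        have 2: "row_frame n N (tau r') (row_label n tau r') (?F r')" if "r' \<in> {Suc r..n}" for r'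
          using F that unfolding fills_def by auto
        have 3: "pfloor (tau r') (?F r' c j) = pceil (tau (Suc r')) (?F (Suc r') c j)"
          if "Suc r \<le> r'" "r' < n" "c \<le> N" "j \<in> {1..n}" for r' c j
          using F that unfolding fills_def by simp
        have 4: "pfloor (tau n) (?F n c j) = None" if "Suc r \<le> n" "c \<le> N" "j \<in> {1..n}" for c j
          using F that unfolding fills_def by simp
        have 5: "has_ceils n N (tau (Suc r)) (?F (Suc r)) b" if "Suc r \<le> n"
          using F that b(2) r unfolding fills_def has_ceils_def has_floors_def by simp
        show ?thesis unfolding fills_def using 1 2 3 4 5 by blast
      qed
      ultimately show "F \<in> (\<lambda>(b, F). F(r := rowG b)) ` (SIGMA b:{b. ?st b}. fills n N tau (Suc r) b)"
        using st by (intro image_eqI[of _ _ "(b, ?F)"]) auto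
    qed
  qed
qed

lemma sum_fills:
  assumes "1 \<le> r" "r \<le> Suc n" "live_from n N tau r s"
  shows "finite (fills n N tau r s) \<and>
    (\<Sum>F\<in>fills n N tau r s. \<Prod>q\<in>{r..n}. var (row_label n tau q) ^ row_exp n N tau F q)
      = row_sum N (map tau [r..<Suc n]) (fill_low tau r) (fill_top n tau r) s"
  using assms
proof (induction "Suc n - r" arbitrary: r s)
  case 0
  then have r: "r = Suc n" by simp
  have "fills n N tau r s = {\<lambda>_ _ _. Empty}" unfolding r fills_def by (auto simp: fun_eq_iff)
  then show ?case using r by simp
next
  case (Suc m)
  then have r: "1 \<le> r" "r \<le> n" by auto
  note s = Suc.prems(3)
  interpret row n N "fill_low tau r" "fill_top n tau r" "tau r" s "row_label n tau r"
    by (rule row_of_live_from[OF r s])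
  let ?st = "row_step N (tau r) (fill_low tau r) (fill_top n tau r) s"
  let ?l = "fill_low tau r" and ?h = "fill_top n tau r"
  let ?w = "\<lambda>F q. var (row_label n tau q) ^ row_exp n N tau F q"
  obtain rowG where rowG: "\<And>b. ?st b \<Longrightarrow> row_frame n N (tau r) (row_label n tau r) (rowG b)
      \<and> has_ceils n N (tau r) (rowG b) s \<and> has_floors n N (tau r) (rowG b) b"
    using row_exists by metis
  note bij = fills_split[OF r s rowG]
  have IH: "finite (fills n N tau (Suc r) b) \<and> (\<Sum>F\<in>fills n N tau (Suc r) b. \<Prod>q\<in>{Suc r..n}. ?w F q)
      = row_sum N (map tau [Suc r..<Suc n]) (fill_low tau (Suc r)) (fill_top n tau (Suc r)) b" if "?st b" for b
    using Suc.hyps(1)[of "Suc r" b] Suc.hyps(2) live_from_Suc[OF r s that] r by simp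
  have fin: "finite {b. ?st b}" by (rule finite_row_step[OF l1 lh lv])
  let ?S = "SIGMA b:{b. ?st b}. fills n N tau (Suc r) b"
  have finS: "finite ?S" using fin IH by (intro finite_SigmaI) auto
  then have finF: "finite (fills n N tau r s)" using bij_betw_finite[OF bij] by simp
  define ex where "ex b = (if tau r = W then sum s {?l..?h} - sum b {?l..?h} - 1
      else N + 1 - (sum b {?l..?h} - sum s {?l..?h}))" for b
  have wt: "(\<Prod>q\<in>{r..n}. ?w (F(r := rowG b)) q) = var (row_label n tau r) ^ ex b * (\<Prod>q\<in>{Suc r..n}. ?w F q)"
    if b: "?st b" for b F
  proof -
    have "row_exp n N tau (F(r := rowG b)) r = ex b"
      unfolding row_exp_def ex_def fun_upd_same
      by (rule row_exponent) (use rowG[OF b] row_step_good[OF b] in auto)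
    moreover have "(\<Prod>q\<in>{Suc r..n}. ?w (F(r := rowG b)) q) = (\<Prod>q\<in>{Suc r..n}. ?w F q)"
      by (intro prod.cong) (auto simp: row_exp_def)
    moreover have "(\<Prod>q\<in>{r..n}. ?w (F(r := rowG b)) q)
        = ?w (F(r := rowG b)) r * (\<Prod>q\<in>{Suc r..n}. ?w (F(r := rowG b)) q)"
      by (rule prod.atLeast_Suc_atMost[OF r(2)])
    ultimately show ?thesis by simp
  qed
  have "(\<Sum>F\<in>fills n N tau r s. \<Prod>q\<in>{r..n}. ?w F q)
      = (\<Sum>x\<in>?S. \<Prod>q\<in>{r..n}. ?w ((\<lambda>(b, F). F(r := rowG b)) x) q)"
    by (rule sum.reindex_bij_betw[OF bij, symmetric])
  also have "\<dots> = (\<Sum>(b, F)\<in>?S. \<Prod>q\<in>{r..n}. ?w (F(r := rowG b)) q)"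
    by (intro sum.cong) auto
  also have "\<dots> = (\<Sum>b | ?st b. \<Sum>F\<in>fills n N tau (Suc r) b. \<Prod>q\<in>{r..n}. ?w (F(r := rowG b)) q)"
    using fin IH by (intro sum.Sigma[symmetric]) auto
  also have "\<dots> = (\<Sum>b | ?st b. var (row_label n tau r) ^ ex b
      * row_sum N (map tau [Suc r..<Suc n]) (fill_low tau (Suc r)) (fill_top n tau (Suc r)) b)"
    using IH wt by (intro sum.cong) (simp_all flip: sum_distrib_left)
  also have "\<dots> = row_sum N (tau r # map tau [Suc r..<Suc n]) ?l ?h s"
    using fill_Suc[OF r, of tau] row_label_fill[OF r, of tau]
    by (cases "tau r") (simp_all add: row_step_def ex_def)
  also have "tau r # map tau [Suc r..<Suc n] = map tau [r..<Suc n]"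
    using upt_conv_Cons[of r "Suc n"] r by (simp del: upt_Suc)
  finally show ?case using finF by simp
qed

theorem theorem2p1:
  fixes n N :: nat and a :: "nat \<Rightarrow> nat" and tau :: "nat \<Rightarrow> dir"
  assumes "1 \<le> n"
    and "\<forall>i\<in>{1..n}. a i \<le> N"
  shows "key n a = (\<Sum>F\<in>HPD n N tau a. wt n N tau F)"
proof -
  let ?s = "\<lambda>i. a i + 1"
  have e: "fill_low tau 1 = 1" "fill_top n tau 1 = n" by (simp_all add: fill_low_def fill_top_def)
  have "live_from n N tau 1 ?s" unfolding live_from_def e live_def using assms by auto
  then have "(\<Sum>F\<in>fills n N tau 1 ?s. \<Prod>q\<in>{1..n}. var (row_label n tau q) ^ row_exp n N tau F q)
      = row_sum N (map tau [1..<Suc n]) 1 n ?s"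
    using sum_fills[of 1 n N tau ?s] unfolding e by simp
  then have "(\<Sum>F\<in>HPD n N tau a. wt n N tau F) = row_sum N (map tau [1..<Suc n]) 1 n ?s"
    unfolding HPD_eq_fills[OF assms(1)] wt_def .
  then show ?thesis using key_eq_row_sum[OF assms(2), of "map tau [1..<Suc n]"] by simp
qed

end
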